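(* Let $d,r,s$ be positive integers, let $b_0,\tilde b_0\in (l_0(\mathbb{Z}^d))^{r\times r}$ and $b_1,\dots,b_s,\tilde b_1,\dots,\tilde b_s\in (l_0(\mathbb{Z}^d))^{1\times r}$ be finitely supported filters and let $\mathsf M_0,\dots,\mathsf M_s$ be $d\times d$ dilation matrices. The following statements (i) and (ii) are equivalent. (i) $(\{b_l!\mathsf M_l\}_{l=0}^s,\{\tilde b_l!\mathsf M_l\}_{l=0}^s)$ is a biorthogonal wavelet filter bank with mixed dilation factors. (ii) For every $J\in\mathbb N$, $$v=\sum_{k\in\mathbb{Z}^d}\langle v,b_{0,J;k}\rangle\tilde b_{0,J;k}+\sum_{j=1}^J\sum_{l=1}^s\sum_{k\in\mathbb{Z}^d}\langle v,b_{l,j;k}\rangle\tilde b_{l,j;k}\qquad\text{for all }v\in(l_2(\mathbb{Z}^d))^{1\times r},\tag{A}$$ and moreover $(\mathrm{DAS}_J(\{b_l!\mathsf M_l\}_{l=0}^s),\mathrm{DAS}_J(\{\tilde b_l!\mathsf M_l\}_{l=0}^s))$ is a pair of biorthogonal systems in $l_2(\mathbb{Z}^d)$, which satisfies the biorthogonality relations $$\langle\tilde b_{0,J;k'},b_{0,J;k}\rangle=\boldsymbol\delta(k-k')I_r,\qquad\langle\tilde b_{l,j;k},b_{0,J;k'}\rangle=0,\qquad l=1,\dots,s,\ j=1,\dots,J,\ k,k'\in\mathbb{Z}^d,\tag{B1}$$ $$\langle\tilde b_{l',j';k'},b_{l,j;k}\rangle=\boldsymbol\delta(l-l')\boldsymbol\delta(j-j')\boldsymbol\delta(k-k'),\qquad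 l,l'=1,\dots,s,\ j,j'=1,\dots,J,\ k,k'\in\mathbb{Z}^d.\tag{B2}$$ If it is further assumed that both $\{b_l!\mathsf M_l\}_{l=0}^s$ and $\{\tilde b_l!\mathsf M_l\}_{l=0}^s$ have stability in $l_2(\mathbb{Z}^d)$, then each of (i), (ii) is equivalent to: (iii) (A) holds for every $J\in\mathbb N$, there exist $C_1,C_2>0$ such that $$C_1\|v\|^2\le\sum_{k\in\mathbb{Z}^d}\|\langle v,b_{0,J;k}\rangle\|^2+\sum_{j=1}^J\sum_{l=1}^s\sum_{k\in\mathbb{Z}^d}|\langle v,b_{l,j;k}\rangle|^2\le C_2\|v\|^2,$$ $$C_2^{-1}\|v\|^2\le\sum_{k\in\mathbb{Z}^d}\|\langle v,\tilde b_{0,J;k}\rangle\|^2+\sum_{j=1}^J\sum_{l=1}^s\sum_{k\in\mathbb{Z}^d}|\langle v,\tilde b_{l,j;k}\rangle|^2\le C_1^{-1}\|v\|^2$$ hold for all $v\in(l_2(\mathbb{Z}^d))^{1\times r}$ and $J\in\mathbb N$, and moreover, for every $J\in\mathbb N$, $(\mathrm{DAS}_J(\{b_l!\mathsf M_l\}_{l=0}^s),\mathrm{DAS}_J(\{\tilde b_l!\mathsf M_l\}_{l=0}^s))$ is a pair of biorthogonal systems which satisfies (B1) and (B2).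
   Context: A $d\times d$ dilation matrix is an integer matrix all of whose eigenvalues have modulus greater than $1$. $(l(\mathbb{Z}^d))^{p\times q}$: all sequences $\mathbb{Z}^d\to\mathbb{C}^{p\times q}$; $(l_0(\mathbb{Z}^d))^{p\times q}$: finitely supported ones; $(l_2(\mathbb{Z}^d))^{p\times q}$: square-summable ones, with $\|u\|^2$ the sum of squared moduli of all entries. $\widehat u(\xi):=\sum_{k}u(k)e^{-ik\cdot\xi}$; $\overline A^{\mathsf T}$ is the conjugate transpose; $\boldsymbol\delta(0)=1$, $\boldsymbol\delta(x)=0$ for $x\neq0$. For $u$ with values in $\mathbb{C}^{t\times r}$ and $v$ with values in $\mathbb{C}^{p\times r}$, $\langle u,v\rangle:=\sum_{k\in\mathbb{Z}^d}u(k)\overline{v(k)}^{\mathsf T}\in\mathbb{C}^{t\times p}$. For $j\in\mathbb N$ and $l=0,\dots,s$, the filter $b_{l,j}$ is defined by $\widehat{b_{l,j}}(\xi):=\widehat{b_l}((\mathsf M_0^{\mathsf T})^{j-1}\xi)\widehat{b_0}((\mathsf M_0^{\mathsf T})^{j-2}\xi)\cdots\widehat{b_0}(\mathsf M_0^{\mathsf T}\xi)\widehat{b_0}(\xi)$ (so $b_{l,1}=b_l$), and for $k\in\mathbb{Z}^d$, $b_{l,j;k}:=|\det(\mathsf M_0)|^{\frac{j-1}2}|\det(\mathsf M_l)|^{\frac12}b_{l,j}(\cdot-\mathsf M_0^{j-1}\mathsf M_lk)$; $\tilde b_{l,j},\tilde b_{l,j;k}$ are defined likewise from the $\tilde b_l$.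 The $J$-level discrete affine system is $\mathrm{DAS}_J(\{b_l!\mathsf M_l\}_{l=0}^s)=\{b_{0,J;k}:k\in\mathbb{Z}^d\}\cup\{b_{l,j;k}:l=1,\dots,s;\ j=1,\dots,J;\ k\in\mathbb{Z}^d\}$. A pair of such (identically indexed) systems is biorthogonal if the inner product $\langle\cdot,\cdot\rangle$ of an element of one with an element of the other is the identity (of the appropriate size) when the indices agree and $0$ otherwise. Dual framelet filter bank with mixed dilation factors: with $\Omega_l:=[\mathsf M_l^{-\mathsf T}\mathbb{Z}^d]\cap[0,1)^d$ and $\chi_E$ the indicator function of $E$, $\sum_{l=0}^s\chi_{\Omega_l}(\omega)\overline{\widehat{b_l}(\xi)}^{\mathsf T}\widehat{\tilde b_l}(\xi+2\pi\omega)=\boldsymbol\delta(\omega)I_r$ for a.e. $\xi\in\mathbb{R}^d$ and all $\omega\in\bigcup_{l=0}^s\Omega_l$. Operators: $[\mathcal S_{a,\mathsf M}u](n):=|\det(\mathsf M)|^{1/2}\sum_{k}u(k)a(n-\mathsf Mk)$, $[\mathcal T_{b,\mathsf M}u](n):=|\det(\mathsf M)|^{1/2}\sum_{k}u(k)\overline{b(k-\mathsf Mn)}^{\mathsf T}$; $\mathcal W:(l(\mathbb{Z}^d))^{1\times r}\to(l(\mathbb{Z}^d))^{1\times(s+r)}$, $\mathcal Wv=(\mathcal T_{b_1,\mathsf M_1}v,\dots,\mathcal T_{b_s,\mathsf M_s}v,\mathcal T_{b_0,\mathsf M_0}v)$; $\tilde{\mathcal V}(w_1,\dots,w_s,w_0)=\sum_{l=0}^s\mathcal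 S_{\tilde b_l,\mathsf M_l}w_l$ on $(l(\mathbb{Z}^d))^{1\times(s+r)}$. Biorthogonal wavelet filter bank with mixed dilation factors: a dual framelet filter bank with mixed dilation factors for which one (equivalently, each) of the following holds: $\mathcal W$ is surjective; $\tilde{\mathcal V}$ is injective; $\tilde{\mathcal V}\mathcal W$ and $\mathcal W\tilde{\mathcal V}$ are both identity operators. Stability in $l_2(\mathbb{Z}^d)$ of $\{b_l!\mathsf M_l\}_{l=0}^s$: with $v_{0,0}:=v$, $v_{l,j}:=\mathcal T_{b_l,\mathsf M_l}v_{0,j-1}$ and $\mathcal W_Jv:=(v_{1,1},\dots,v_{s,1},\dots,v_{1,J},\dots,v_{s,J},v_{0,J})$, there are positive constants $c_1,c_2$ with $c_1\|v\|^2\le\|\mathcal W_Jv\|^2\le c_2\|v\|^2$ for all $J\in\mathbb N$ and $v\in(l_2(\mathbb{Z}^d))^{1\times r}$; similarly for $\{\tilde b_l!\mathsf M_l\}_{l=0}^s$. *)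

theory Defs
  imports "HOL-Analysis.Analysis"
begin

text \<open>
  Conventions. The lattice \<open>Z^d\<close> is \<open>int^'d\<close> with \<open>d = CARD('d)\<close>, and \<open>r = CARD('r)\<close>,
  \<open>s = CARD('s)\<close> for index types of class \<open>finite\<close> (so all three are positive). A sequence
  with values in the complex \<open>p \<times> q\<close> matrices is a function \<open>int^'d \<Rightarrow> complex^'q^'p\<close>; row
  vectors are \<open>complex^'q^1\<close>. The index \<open>l = 0\<close> is kept separate from \<open>l = 1,\<dots>,s\<close>, since
  \<open>b\<^sub>0\<close> has values of a different size: \<open>b0\<close>, \<open>M0\<close> belong to \<open>l = 0\<close>, whereas \<open>b\<close>, \<open>M\<close> are
  families over \<open>'s\<close>. Levels \<open>j\<close>, \<open>J\<close> are positive natural numbers.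
\<close>

type_synonym ('d, 'p, 'q) mseq = "int^'d \<Rightarrow> complex^'q^'p"


subsection \<open>Matrices and sequences\<close>

definition dilation_matrix :: "int^'d^'d \<Rightarrow> bool" where
  "dilation_matrix A \<longleftrightarrow>
     (\<forall>(c::complex) x. x \<noteq> 0 \<and> map_matrix of_int A *v x = c *s x \<longrightarrow> cmod c > 1)"

primrec mat_pow :: "'a::semiring_1^'d^'d \<Rightarrow> nat \<Rightarrow> 'a^'d^'d" where
  "mat_pow A 0 = mat 1"
| "mat_pow A (Suc n) = A ** mat_pow A n"

abbreviation real_mat :: "int^'d^'d \<Rightarrow> real^'d^'d" where
  "real_mat A \<equiv> map_matrix real_of_int A"

definition real_vec :: "int^'d \<Rightarrow> real^'d" where
  "real_vec k = (\<chi> i. real_of_int (k $ i))"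

definition conj_transpose :: "complex^'q^'p \<Rightarrow> complex^'p^'q" where
  "conj_transpose A = (\<chi> i j. cnj (A $ j $ i))"

definition finitely_supported :: "('d::finite, 'p::finite, 'q::finite) mseq \<Rightarrow> bool" where
  "finitely_supported u \<longleftrightarrow> finite {k. u k \<noteq> 0}"

text \<open>The norm of \<open>complex^'q^'p\<close> is the Frobenius norm, so this is the sum of the squared moduli
  of all entries, as an element of \<open>[0,\<infinity>]\<close>.\<close>
definition l2_norm_sq :: "('d::finite, 'p::finite, 'q::finite) mseq \<Rightarrow> ennreal" where
  "l2_norm_sq u = (\<Sum>\<^sub>\<infinity>k. ennreal ((norm (u k))\<^sup>2))"

definition l2_seq :: "('d::finite, 'p::finite, 'q::finite) mseq set" where
  "l2_seq = {u. (\<lambda>k. (norm (u k))\<^sup>2) summable_on UNIV}"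

definition inner_seq ::
    "('d::finite, 't::finite, 'r::finite) mseq \<Rightarrow> ('d, 'p::finite, 'r) mseq \<Rightarrow> complex^'p^'t" where
  "inner_seq u v = (\<Sum>\<^sub>\<infinity>k. u k ** conj_transpose (v k))"

text \<open>\<open>g\<close> is the sum of the series \<open>\<Sum>\<^sub>k f k\<close>, unconditionally convergent in \<open>l\<^sub>2\<close>.\<close>
definition l2_has_sum ::
    "('i \<Rightarrow> ('d::finite, 'p::finite, 'q::finite) mseq) \<Rightarrow> ('d, 'p, 'q) mseq \<Rightarrow> bool" where
  "l2_has_sum f g \<longleftrightarrow> g \<in> l2_seq \<and>
     ((\<lambda>F. l2_norm_sq (\<lambda>n. g n - (\<Sum>k\<in>F. f k n))) \<longlongrightarrow> 0) (finite_subsets_at_top UNIV)"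

definition fourier ::
    "('d::finite, 'p::finite, 'q::finite) mseq \<Rightarrow> real^'d \<Rightarrow> complex^'q^'p" where
  "fourier u \<xi> =
     (\<chi> i j. \<Sum>\<^sub>\<infinity>k. u k $ i $ j * exp (- \<i> * complex_of_real (real_vec k \<bullet> \<xi>)))"


subsection \<open>Multilevel filters and discrete affine systems\<close>

text \<open>\<open>fourier_cascade M0 b0 n \<xi>\<close> is the product of the \<open>n\<close> factors
  \<open>fourier b0 ((M0\<^sup>T)\<^sup>i \<xi>)\<close>, with \<open>i\<close> decreasing from \<open>n - 1\<close> to \<open>0\<close>.\<close>
primrec fourier_cascade ::
    "int^'d^'d \<Rightarrow> ('d::finite, 'r::finite, 'r) mseq \<Rightarrow> nat \<Rightarrow> real^'d \<Rightarrow> complex^'r^'r" where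
  "fourier_cascade M0 b0 0 \<xi> = mat 1"
| "fourier_cascade M0 b0 (Suc n) \<xi> =
     fourier b0 (mat_pow (transpose (real_mat M0)) n *v \<xi>) ** fourier_cascade M0 b0 n \<xi>"

text \<open>For \<open>a = b l\<close> this is the filter \<open>b\<^bsub>l,j\<^esub>\<close>, and for \<open>a = b0\<close> it is \<open>b\<^bsub>0,j\<^esub>\<close>.\<close>
definition level_filter ::
    "int^'d^'d \<Rightarrow> ('d::finite, 'r::finite, 'r) mseq \<Rightarrow> ('d, 'p::finite, 'r) mseq \<Rightarrow> nat
       \<Rightarrow> ('d, 'p, 'r) mseq" where
  "level_filter M0 b0 a j = (THE u. finitely_supported u \<and>
     (\<forall>\<xi>. fourier u \<xi> =
        fourier a (mat_pow (transpose (real_mat M0)) (j - 1) *v \<xi>)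
          ** fourier_cascade M0 b0 (j - 1) \<xi>))"

text \<open>With \<open>a = b l\<close>, \<open>N = M l\<close> this is \<open>b\<^bsub>l,j;k\<^esub>\<close>, and with \<open>a = b0\<close>, \<open>N = M0\<close> it is
  \<open>b\<^bsub>0,j;k\<^esub>\<close>.\<close>
definition das_elem ::
    "int^'d^'d \<Rightarrow> ('d::finite, 'r::finite, 'r) mseq \<Rightarrow> int^'d^'d \<Rightarrow> ('d, 'p::finite, 'r) mseq
       \<Rightarrow> nat \<Rightarrow> int^'d \<Rightarrow> ('d, 'p, 'r) mseq" where
  "das_elem M0 b0 N a j k = (\<lambda>n.
     (real_of_int \<bar>det M0\<bar> powr ((real j - 1) / 2) * real_of_int \<bar>det N\<bar> powr (1 / 2))
       *\<^sub>R level_filter M0 b0 a j (n - (mat_pow M0 (j - 1) ** N) *v k))"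

text \<open>The two parts of the \<open>J\<close>-level discrete affine system, as indexed families: the low-pass part
  is indexed by \<open>k\<close>, the high-pass part by the \<open>(l, j, k)\<close> in \<open>das_index J\<close>.\<close>
definition das_low ::
    "int^'d^'d \<Rightarrow> ('d::finite, 'r::finite, 'r) mseq \<Rightarrow> nat \<Rightarrow> int^'d \<Rightarrow> ('d, 'r, 'r) mseq" where
  "das_low M0 b0 J k = das_elem M0 b0 M0 b0 J k"

definition das_high ::
    "int^'d^'d \<Rightarrow> ('s \<Rightarrow> int^'d^'d) \<Rightarrow> ('d::finite, 'r::finite, 'r) mseq
       \<Rightarrow> ('s \<Rightarrow> ('d, 1, 'r) mseq) \<Rightarrow> 's \<times> nat \<times> (int^'d) \<Rightarrow> ('d, 1, 'r) mseq" where
  "das_high M0 M b0 b = (\<lambda>(l, j, k). das_elem M0 b0 (M l) (b l) j k)"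

definition das_index :: "nat \<Rightarrow> ('s \<times> nat \<times> (int^'d)) set" where
  "das_index J = {(l, j, k). 1 \<le> j \<and> j \<le> J}"

text \<open>Biorthogonality in \<open>l\<^sub>2\<close> of two identically indexed systems, each made of a family \<open>f\<close> (over
  \<open>I\<close>) with \<open>r\<close> rows and a family \<open>g\<close> (over \<open>K\<close>) with one row.\<close>
definition biorthogonal_systems ::
    "'i set \<Rightarrow> 'k set \<Rightarrow>
     ('i \<Rightarrow> ('d::finite, 'r::finite, 'r) mseq) \<Rightarrow> ('k \<Rightarrow> ('d, 1, 'r) mseq) \<Rightarrow>
     ('i \<Rightarrow> ('d, 'r, 'r) mseq) \<Rightarrow> ('k \<Rightarrow> ('d, 1, 'r) mseq) \<Rightarrow> bool" where
  "biorthogonal_systems I K f g ft gt \<longleftrightarrow>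
     (\<forall>i\<in>I. f i \<in> l2_seq \<and> ft i \<in> l2_seq) \<and> (\<forall>k\<in>K. g k \<in> l2_seq \<and> gt k \<in> l2_seq) \<and>
     (\<forall>i\<in>I. \<forall>i'\<in>I. inner_seq (ft i') (f i) = mat (of_bool (i = i'))) \<and>
     (\<forall>i\<in>I. \<forall>k\<in>K. inner_seq (ft i) (g k) = 0 \<and> inner_seq (gt k) (f i) = 0) \<and>
     (\<forall>k\<in>K. \<forall>k'\<in>K. inner_seq (gt k') (g k) = mat (of_bool (k = k')))"

definition biorthogonal_das ::
    "int^'d^'d \<Rightarrow> ('s \<Rightarrow> int^'d^'d) \<Rightarrow>
     ('d::finite, 'r::finite, 'r) mseq \<Rightarrow> ('s \<Rightarrow> ('d, 1, 'r) mseq) \<Rightarrow>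
     ('d, 'r, 'r) mseq \<Rightarrow> ('s \<Rightarrow> ('d, 1, 'r) mseq) \<Rightarrow> nat \<Rightarrow> bool" where
  "biorthogonal_das M0 M b0 b bt0 bt J \<longleftrightarrow>
     biorthogonal_systems UNIV (das_index J)
       (das_low M0 b0 J) (das_high M0 M b0 b) (das_low M0 bt0 J) (das_high M0 M bt0 bt)"

text \<open>The relations (B1) and (B2).\<close>
definition biorthogonality_relations ::
    "int^'d^'d \<Rightarrow> ('s \<Rightarrow> int^'d^'d) \<Rightarrow>
     ('d::finite, 'r::finite, 'r) mseq \<Rightarrow> ('s \<Rightarrow> ('d, 1, 'r) mseq) \<Rightarrow>
     ('d, 'r, 'r) mseq \<Rightarrow> ('s \<Rightarrow> ('d, 1, 'r) mseq) \<Rightarrow> nat \<Rightarrow> bool" where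
  "biorthogonality_relations M0 M b0 b bt0 bt J \<longleftrightarrow>
     (\<forall>k k'. inner_seq (das_low M0 bt0 J k') (das_low M0 b0 J k) = mat (of_bool (k = k'))) \<and>
     (\<forall>l. \<forall>j\<in>{1..J}. \<forall>k k'.
        inner_seq (das_high M0 M bt0 bt (l, j, k)) (das_low M0 b0 J k') = 0) \<and>
     (\<forall>l l'. \<forall>j\<in>{1..J}. \<forall>j'\<in>{1..J}. \<forall>k k'.
        inner_seq (das_high M0 M bt0 bt (l', j', k')) (das_high M0 M b0 b (l, j, k)) =
          mat (of_bool (l = l') * of_bool (j = j') * of_bool (k = k')))"

text \<open>The expansion (A); each of the series over \<open>k\<close> converges unconditionally in \<open>l\<^sub>2\<close>, to \<open>g0\<close>
  and \<open>g l j\<close>, respectively.\<close>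
definition das_expansion ::
    "int^'d^'d \<Rightarrow> ('s::finite \<Rightarrow> int^'d^'d) \<Rightarrow>
     ('d::finite, 'r::finite, 'r) mseq \<Rightarrow> ('s \<Rightarrow> ('d, 1, 'r) mseq) \<Rightarrow>
     ('d, 'r, 'r) mseq \<Rightarrow> ('s \<Rightarrow> ('d, 1, 'r) mseq) \<Rightarrow> nat \<Rightarrow> ('d, 1, 'r) mseq \<Rightarrow> bool" where
  "das_expansion M0 M b0 b bt0 bt J v \<longleftrightarrow>
     (\<exists>g0 g.
        l2_has_sum (\<lambda>k n. inner_seq v (das_low M0 b0 J k) ** das_low M0 bt0 J k n) g0 \<and>
        (\<forall>l. \<forall>j\<in>{1..J}. l2_has_sum (\<lambda>k n.
            inner_seq v (das_high M0 M b0 b (l, j, k)) ** das_high M0 M bt0 bt (l, j, k) n)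
          (g l j)) \<and>
        (\<forall>n. v n = g0 n + (\<Sum>j=1..J. \<Sum>l\<in>UNIV. g l j n)))"

definition das_coeff_norm_sq ::
    "int^'d^'d \<Rightarrow> ('s::finite \<Rightarrow> int^'d^'d) \<Rightarrow>
     ('d::finite, 'r::finite, 'r) mseq \<Rightarrow> ('s \<Rightarrow> ('d, 1, 'r) mseq) \<Rightarrow> nat \<Rightarrow> ('d, 1, 'r) mseq
       \<Rightarrow> ennreal" where
  "das_coeff_norm_sq M0 M b0 b J v =
     (\<Sum>\<^sub>\<infinity>k. ennreal ((norm (inner_seq v (das_low M0 b0 J k)))\<^sup>2)) +
     (\<Sum>j=1..J. \<Sum>l\<in>UNIV. \<Sum>\<^sub>\<infinity>k.
        ennreal ((norm (inner_seq v (das_high M0 M b0 b (l, j, k))))\<^sup>2))"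


subsection \<open>Filter banks\<close>

definition digit_set :: "int^'d^'d \<Rightarrow> (real^'d::finite) set" where
  "digit_set A =
     range (\<lambda>k. transpose (matrix_inv (real_mat A)) *v real_vec k) \<inter> {x. \<forall>i. 0 \<le> x $ i \<and> x $ i < 1}"

definition dual_framelet_filter_bank ::
    "int^'d^'d \<Rightarrow> ('s::finite \<Rightarrow> int^'d^'d) \<Rightarrow>
     ('d::finite, 'r::finite, 'r) mseq \<Rightarrow> ('s \<Rightarrow> ('d, 1, 'r) mseq) \<Rightarrow>
     ('d, 'r, 'r) mseq \<Rightarrow> ('s \<Rightarrow> ('d, 1, 'r) mseq) \<Rightarrow> bool" where
  "dual_framelet_filter_bank M0 M b0 b bt0 bt \<longleftrightarrow>
     (AE \<xi> in lborel. \<forall>\<omega> \<in> digit_set M0 \<union> (\<Union>l. digit_set (M l)).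
        indicator (digit_set M0) \<omega> *\<^sub>R
          (conj_transpose (fourier b0 \<xi>) ** fourier bt0 (\<xi> + (2 * pi) *\<^sub>R \<omega>)) +
        (\<Sum>l\<in>UNIV. indicator (digit_set (M l)) \<omega> *\<^sub>R
          (conj_transpose (fourier (b l) \<xi>) ** fourier (bt l) (\<xi> + (2 * pi) *\<^sub>R \<omega>)))
        = mat (of_bool (\<omega> = 0)))"

text \<open>For finitely supported filters and invertible \<open>A\<close>, the sums over \<open>k\<close> below have only finitely
  many nonzero terms, for arbitrary \<open>u\<close>.\<close>
definition subdivision_op ::
    "('d, 'p, 'r) mseq \<Rightarrow> int^'d^'d \<Rightarrow> ('d::finite, 'q::finite, 'p::finite) mseq
       \<Rightarrow> ('d, 'q, 'r::finite) mseq" where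
  "subdivision_op a A u = (\<lambda>n.
     (real_of_int \<bar>det A\<bar> powr (1 / 2)) *\<^sub>R (\<Sum>\<^sub>\<infinity>k. u k ** a (n - A *v k)))"

definition transition_op ::
    "('d, 'p, 'r) mseq \<Rightarrow> int^'d^'d \<Rightarrow> ('d::finite, 'q::finite, 'r::finite) mseq
       \<Rightarrow> ('d, 'q, 'p::finite) mseq" where
  "transition_op b A u = (\<lambda>n.
     (real_of_int \<bar>det A\<bar> powr (1 / 2)) *\<^sub>R (\<Sum>\<^sub>\<infinity>k. u k ** conj_transpose (b (k - A *v n))))"

text \<open>Row vectors of length \<open>s + r\<close> are indexed by the sum type \<open>'s + 'r\<close>: the columns \<open>Inl l\<close> are
  the scalar components \<open>w\<^sub>l\<close>, the columns \<open>Inr i\<close> form the component \<open>w\<^sub>0\<close>.\<close>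
definition analysis_op ::
    "int^'d^'d \<Rightarrow> ('s::finite \<Rightarrow> int^'d^'d) \<Rightarrow>
     ('d::finite, 'r::finite, 'r) mseq \<Rightarrow> ('s \<Rightarrow> ('d, 1, 'r) mseq) \<Rightarrow>
     ('d, 1, 'r) mseq \<Rightarrow> ('d, 1, 's + 'r) mseq" where
  "analysis_op M0 M b0 b v = (\<lambda>n. \<chi> i c. case c of
       Inl l \<Rightarrow> transition_op (b l) (M l) v n $ i $ 1
     | Inr c' \<Rightarrow> transition_op b0 M0 v n $ i $ c')"

definition synthesis_op ::
    "int^'d^'d \<Rightarrow> ('s::finite \<Rightarrow> int^'d^'d) \<Rightarrow>
     ('d::finite, 'r::finite, 'r) mseq \<Rightarrow> ('s \<Rightarrow> ('d, 1, 'r) mseq) \<Rightarrow>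
     ('d, 1, 's + 'r) mseq \<Rightarrow> ('d, 1, 'r) mseq" where
  "synthesis_op M0 M bt0 bt w = (\<lambda>n.
     subdivision_op bt0 M0 (\<lambda>k. \<chi> i c. w k $ i $ Inr c) n +
     (\<Sum>l\<in>UNIV. subdivision_op (bt l) (M l) (\<lambda>k. \<chi> i (c::1). w k $ i $ Inl l) n))"

definition biorthogonal_wavelet_filter_bank ::
    "int^'d^'d \<Rightarrow> ('s::finite \<Rightarrow> int^'d^'d) \<Rightarrow>
     ('d::finite, 'r::finite, 'r) mseq \<Rightarrow> ('s \<Rightarrow> ('d, 1, 'r) mseq) \<Rightarrow>
     ('d, 'r, 'r) mseq \<Rightarrow> ('s \<Rightarrow> ('d, 1, 'r) mseq) \<Rightarrow> bool" where
  "biorthogonal_wavelet_filter_bank M0 M b0 b bt0 bt \<longleftrightarrow>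
     dual_framelet_filter_bank M0 M b0 b bt0 bt \<and>
     (surj (analysis_op M0 M b0 b) \<or>
      inj (synthesis_op M0 M bt0 bt) \<or>
      synthesis_op M0 M bt0 bt \<circ> analysis_op M0 M b0 b = id \<and>
      analysis_op M0 M b0 b \<circ> synthesis_op M0 M bt0 bt = id)"


subsection \<open>Stability of the multilevel transform\<close>

primrec dwt_low ::
    "int^'d^'d \<Rightarrow> ('d::finite, 'r::finite, 'r) mseq \<Rightarrow> ('d, 1, 'r) mseq \<Rightarrow> nat
       \<Rightarrow> ('d, 1, 'r) mseq" where
  "dwt_low M0 b0 v 0 = v"
| "dwt_low M0 b0 v (Suc j) = transition_op b0 M0 (dwt_low M0 b0 v j)"

definition dwt_high ::
    "int^'d^'d \<Rightarrow> ('s \<Rightarrow> int^'d^'d) \<Rightarrow> ('d::finite, 'r::finite, 'r) mseq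
       \<Rightarrow> ('s \<Rightarrow> ('d, 1, 'r) mseq) \<Rightarrow> ('d, 1, 'r) mseq \<Rightarrow> 's \<Rightarrow> nat \<Rightarrow> ('d, 1, 1) mseq" where
  "dwt_high M0 M b0 b v l j = transition_op (b l) (M l) (dwt_low M0 b0 v (j - 1))"

text \<open>The squared norm of the tuple \<open>\<W>\<^sub>J v\<close>.\<close>
definition dwt_norm_sq ::
    "int^'d^'d \<Rightarrow> ('s::finite \<Rightarrow> int^'d^'d) \<Rightarrow>
     ('d::finite, 'r::finite, 'r) mseq \<Rightarrow> ('s \<Rightarrow> ('d, 1, 'r) mseq) \<Rightarrow> nat \<Rightarrow> ('d, 1, 'r) mseq
       \<Rightarrow> ennreal" where
  "dwt_norm_sq M0 M b0 b J v =
     (\<Sum>j=1..J. \<Sum>l\<in>UNIV. l2_norm_sq (dwt_high M0 M b0 b v l j)) +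
     l2_norm_sq (dwt_low M0 b0 v J)"

definition l2_stable ::
    "int^'d^'d \<Rightarrow> ('s::finite \<Rightarrow> int^'d^'d) \<Rightarrow>
     ('d::finite, 'r::finite, 'r) mseq \<Rightarrow> ('s \<Rightarrow> ('d, 1, 'r) mseq) \<Rightarrow> bool" where
  "l2_stable M0 M b0 b \<longleftrightarrow>
     (\<exists>c1>0. \<exists>c2>0. \<forall>J\<ge>1. \<forall>v\<in>l2_seq.
        ennreal c1 * l2_norm_sq v \<le> dwt_norm_sq M0 M b0 b J v \<and>
        dwt_norm_sq M0 M b0 b J v \<le> ennreal c2 * l2_norm_sq v)"

end

theory Submission
  imports Defs
begin

text \<open>
  Sequences are acted on by block matrices ("kernels") indexed by the lattice that have finitely many
  nonzero entries in each column. In these terms, if \<open>low\<close> and \<open>high l\<close> are the matrices whose rows are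
  \<open>b\<^bsub>0,1;k\<^esub>\<close> and \<open>b\<^bsub>l,1;k\<^esub>\<close>, then subdivision is multiplication by them, transition is
  multiplication by their adjoints, and the rows of \<open>high l \<odot> low \<odot> \<dots> \<odot> low\<close> are the elements
  \<open>b\<^bsub>l,j;k\<^esub>\<close> of the discrete affine system.

  Comparing Fourier coefficients, the dual framelet condition says that the adjoint analysis matrix
  times the synthesis matrix is the identity; here one needs that the sum of a lattice character over
  the digit set of \<open>A\<close> is \<open>\<bar>det A\<bar>\<close> on \<open>A Z^d\<close> and \<open>0\<close> elsewhere. Surjectivity of the
  analysis operator or injectivity of the synthesis operator then says that the product in the other
  order is the identity as well, which is biorthogonality at level one. All higher levels follow by
  cancelling adjacent factors, and \<open>l\<^sub>2\<close> convergence of the expansions follows from boundedness of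
  sparse kernels. The sums in (iii) are the norms of the multilevel transforms, so under stability
  their bounds hold automatically.
\<close>

subsection \<open>Kernels on lattices\<close>

text \<open>The analysis and synthesis operators act on all sequences, whereas (A) speaks of
  \<open>l2_seq\<close> only. Finite columns make every product a finite sum at each lattice point,
  so associativity holds without a convergence argument; and a kernel is determined by its action on
  finitely supported sequences, which lie in both worlds. An identity known on \<open>l2_seq\<close>
  is thereby an identity on all sequences. The matrices may have different digit sets, so the filter
  bank condition cannot be inverted over a single coset group. Instead, it and its time-domain form
  are both expressed by one table of coefficients, indexed by a frequency t and a digit \<omega> in
  the union of the digit sets. The table is recovered from the former by independence of characters
  of R^d, and from the latter by independence of the characters of Z^d given by \<omega>; these are
  distinct because digits lie in a half-open cube. The size of a digit set comes from volumes:
  A[0,1)^d and the union of the unit cubes at its integer points tile space under the same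
  translations.\<close>

lemma bilinear_matrix_matrix_mult:
  "bilinear ((**) :: complex^'m::finite^'p::finite \<Rightarrow> complex^'q::finite^'m \<Rightarrow> complex^'q^'p)"
  by (auto simp: bilinear_def linear_iff matrix_matrix_mult_def vec_eq_iff
      algebra_simps sum.distrib scaleR_sum_right)

text \<open>Supplies zero, additivity, scaling and finite-sum rules for products of rectangular
  matrices, together with the norm constant used in the l2 estimates.\<close>

interpretation mm: bounded_bilinear
  "(**) :: complex^'m::finite^'p::finite \<Rightarrow> complex^'q::finite^'m \<Rightarrow> complex^'q^'p"
  using bilinear_conv_bounded_bilinear bilinear_matrix_matrix_mult by blast

lemma linear_conj_transpose:
  "linear (conj_transpose :: complex^'q::finite^'p::finite \<Rightarrow> complex^'p^'q)"
  by (auto simp: linear_iff conj_transpose_def vec_eq_iff)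

lemmas conj_transpose_0 [simp] = linear_0[OF linear_conj_transpose]
lemmas conj_transpose_sum = linear_sum[OF linear_conj_transpose]
lemmas conj_transpose_scaleR = linear_scale[OF linear_conj_transpose]

lemma conj_transpose_nth [simp]: "conj_transpose A $ i $ j = cnj (A $ j $ i)"
  by (simp add: conj_transpose_def)

lemma conj_transpose_conj_transpose [simp]: "conj_transpose (conj_transpose A) = A"
  by (simp add: vec_eq_iff)

lemma conj_transpose_eq_0_iff [simp]:
  "conj_transpose A = 0 \<longleftrightarrow> (A :: complex^'q::finite^'p::finite) = 0"
  by (metis conj_transpose_conj_transpose conj_transpose_0)

lemma conj_transpose_mult: "conj_transpose (A ** B) = conj_transpose B ** conj_transpose A"
  by (simp add: vec_eq_iff matrix_matrix_mult_def mult.commute)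

lemma infsum_finite_support:
  fixes f :: "'a \<Rightarrow> 'b::{topological_comm_monoid_add,t2_space}"
  assumes "finite F" "\<And>x. x \<notin> F \<Longrightarrow> f x = 0"
  shows "infsum f UNIV = sum f F"
proof -
  have "infsum f UNIV = infsum f F"
    using assms by (intro infsum_cong_neutral) auto
  then show ?thesis using assms by simp
qed

section \<open>Infinite block matrices acting on row vectors from the right\<close>

type_synonym ('i, 'j, 'p, 'q) kernel = "'i \<Rightarrow> 'j \<Rightarrow> complex^'q^'p"

definition kapp ::
    "('m \<Rightarrow> complex^'c::finite^'p::finite) \<Rightarrow> ('m, 'n, 'c, 'q::finite) kernel \<Rightarrow> 'n \<Rightarrow> complex^'q^'p"
    (infixl \<open>\<bullet>\<^sub>k\<close> 70) where
  "u \<bullet>\<^sub>k L = (\<lambda>n. \<Sum>\<^sub>\<infinity>m. u m ** L m n)"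

definition kcomp ::
    "('i, 'm, 'p::finite, 'c::finite) kernel \<Rightarrow> ('m, 'n, 'c, 'q::finite) kernel \<Rightarrow> ('i, 'n, 'p, 'q) kernel"
    (infixl \<open>\<odot>\<close> 70) where
  "K \<odot> L = (\<lambda>i. K i \<bullet>\<^sub>k L)"

definition kadj :: "('i, 'j, 'p::finite, 'q::finite) kernel \<Rightarrow> ('j, 'i, 'q, 'p) kernel" where
  "kadj K = (\<lambda>j i. conj_transpose (K i j))"

definition kid :: "('i, 'i, 'p::finite, 'p) kernel" where
  "kid = (\<lambda>i j. mat (of_bool (i = j)))"

text \<open>With finite columns, \<open>u \<bullet>\<^sub>k L\<close> is a finite sum at every point
  for an arbitrary \<open>u\<close>, of finite norm or not.\<close>

definition fin_cols :: "('i, 'j, 'p::finite, 'q::finite) kernel \<Rightarrow> bool" where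
  "fin_cols K \<longleftrightarrow> (\<forall>j. finite {i. K i j \<noteq> 0})"

lemma kapp_eq_sum:
  assumes "finite F" "\<And>m. m \<notin> F \<Longrightarrow> L m n = 0"
  shows "(u \<bullet>\<^sub>k L) n = (\<Sum>m\<in>F. u m ** L m n)"
  unfolding kapp_def using assms by (intro infsum_finite_support) (auto simp: mm.zero_right)

lemma kapp_eq_sum_left:
  assumes "finite F" "\<And>m. m \<notin> F \<Longrightarrow> u m = 0"
  shows "(u \<bullet>\<^sub>k L) n = (\<Sum>m\<in>F. u m ** L m n)"
  unfolding kapp_def using assms by (intro infsum_finite_support) (auto simp: mm.zero_left)

lemma kapp_eq_sum_support:
  assumes "fin_cols L"
  shows "(u \<bullet>\<^sub>k L) n = (\<Sum>m | L m n \<noteq> 0. u m ** L m n)"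
  using assms by (intro kapp_eq_sum) (auto simp: fin_cols_def)

lemma kapp_eq_0:
  assumes "\<And>m. L m n \<noteq> 0 \<Longrightarrow> u m = 0"
  shows "(u \<bullet>\<^sub>k L) n = 0"
proof -
  have "(\<lambda>m. u m ** L m n) = (\<lambda>m. 0)"
    using assms by (metis mm.zero_left mm.zero_right)
  then show ?thesis by (simp add: kapp_def)
qed

text \<open>Only the finitely many \<open>m\<close> in column \<open>n\<close> of \<open>L'\<close>,
  and then the finitely many \<open>k\<close> in those columns of \<open>L\<close>, can reach
  \<open>n\<close>. The interchange of summations is therefore finite, whatever \<open>u\<close>
  is.\<close>

lemma kapp_assoc:
  assumes "fin_cols L" "fin_cols L'"
  shows "u \<bullet>\<^sub>k L \<bullet>\<^sub>k L' = u \<bullet>\<^sub>k (L \<odot> L')"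
proof
  fix n
  define G where "G = {m. L' m n \<noteq> 0}"
  define F where "F = (\<Union>m\<in>G. {k. L k m \<noteq> 0})"
  have fin: "finite G" "finite F" using assms by (auto simp: G_def F_def fin_cols_def)
  have F0: "L k m = 0" if "k \<notin> F" "m \<in> G" for k m using that by (auto simp: F_def)
  have comp: "(L \<odot> L') k n = (\<Sum>m\<in>G. L k m ** L' m n)" for k
    using fin by (auto simp: kcomp_def G_def intro!: kapp_eq_sum)
  have "(u \<bullet>\<^sub>k L \<bullet>\<^sub>k L') n = (\<Sum>m\<in>G. (\<Sum>k\<in>F. u k ** L k m) ** L' m n)"
    using fin F0 by (subst kapp_eq_sum[of G]) (auto simp: G_def intro!: sum.cong kapp_eq_sum arg_cong2[where f = "(**)"])
  also have "\<dots> = (\<Sum>k\<in>F. \<Sum>m\<in>G. u k ** (L k m ** L' m n))"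
    by (subst sum.swap) (simp add: mm.sum_left matrix_mul_assoc)
  also have "\<dots> = (\<Sum>k\<in>F. u k ** (L \<odot> L') k n)"
    by (simp add: comp mm.sum_right)
  also have "\<dots> = (u \<bullet>\<^sub>k (L \<odot> L')) n"
    using fin by (intro kapp_eq_sum[symmetric]) (auto simp: kcomp_def G_def intro!: kapp_eq_0 dest: F0)
  finally show "(u \<bullet>\<^sub>k L \<bullet>\<^sub>k L') n = (u \<bullet>\<^sub>k (L \<odot> L')) n" .
qed

lemma kcomp_assoc: "fin_cols L \<Longrightarrow> fin_cols L' \<Longrightarrow> K \<odot> L \<odot> L' = K \<odot> (L \<odot> L')"
  by (simp add: kcomp_def kapp_assoc[unfolded kcomp_def])

lemma fin_cols_kcomp:
  assumes "fin_cols K" "fin_cols L"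
  shows "fin_cols (K \<odot> L)"
  unfolding fin_cols_def
proof
  fix n
  have "{k. (K \<odot> L) k n \<noteq> 0} \<subseteq> (\<Union>m\<in>{m. L m n \<noteq> 0}. {k. K k m \<noteq> 0})"
    by (auto simp: kcomp_def dest: kapp_eq_0[rotated])  (metis kapp_eq_0)
  then show "finite {k. (K \<odot> L) k n \<noteq> 0}"
    using assms by (auto simp: fin_cols_def intro: finite_subset)
qed

text \<open>Finite columns of \<open>L\<close> become finite rows of \<open>kadj L\<close>, so on
  the right-hand side it is the left factor that makes the sum finite.\<close>

lemma kadj_kcomp:
  assumes "fin_cols L"
  shows "kadj (K \<odot> L) = kadj L \<odot> kadj K"
proof (intro ext)
  fix j i
  have "kadj (K \<odot> L) j i = (\<Sum>m | L m j \<noteq> 0. conj_transpose (L m j) ** conj_transpose (K i m))"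
    by (simp add: kadj_def kcomp_def kapp_eq_sum_support[OF assms] conj_transpose_sum conj_transpose_mult)
  also have "\<dots> = (kadj L \<odot> kadj K) j i"
    using assms unfolding kcomp_def
    by (subst kapp_eq_sum_left) (auto simp: kadj_def fin_cols_def)
  finally show "kadj (K \<odot> L) j i = (kadj L \<odot> kadj K) j i" .
qed

lemma fin_cols_kid [simp]: "fin_cols (kid :: ('i, 'i, 'p::finite, 'p) kernel)"
proof -
  have "{i. mat (of_bool (i = j)) \<noteq> (0 :: complex^'p^'p)} \<subseteq> {j}" for j :: 'i
    by auto
  then show ?thesis by (auto simp: fin_cols_def kid_def intro: finite_subset)
qed

lemma kapp_kid [simp]: "u \<bullet>\<^sub>k kid = u"
proof
  fix n
  show "(u \<bullet>\<^sub>k kid) n = u n"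
    by (subst kapp_eq_sum[of "{n}"]) (auto simp: kid_def)
qed

lemma kcomp_kid [simp]: "K \<odot> kid = K"
  by (simp add: kcomp_def)

lemma kid_kapp: "kid i \<bullet>\<^sub>k L = L i"
proof
  fix n
  show "(kid i \<bullet>\<^sub>k L) n = L i n"
    by (subst kapp_eq_sum_left[of "{i}"]) (auto simp: kid_def)
qed

lemma kid_kcomp [simp]: "kid \<odot> K = K"
  by (simp add: kcomp_def kid_kapp)

lemma kapp_0_left [simp]: "(\<lambda>_. 0) \<bullet>\<^sub>k L = (\<lambda>_. 0)"
  by (simp add: kapp_def mm.zero_left)

lemma kapp_0_right [simp]: "u \<bullet>\<^sub>k (\<lambda>_ _. 0) = (\<lambda>_. 0)"
  by (simp add: kapp_def mm.zero_right)

lemma kapp_add_left: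
  "fin_cols L \<Longrightarrow> (\<lambda>m. u m + v m) \<bullet>\<^sub>k L = (\<lambda>n. (u \<bullet>\<^sub>k L) n + (v \<bullet>\<^sub>k L) n)"
  by (simp add: kapp_eq_sum_support mm.add_left sum.distrib fun_eq_iff)

lemma kapp_sum_left:
  "fin_cols L \<Longrightarrow> (\<lambda>m. \<Sum>l\<in>S. u l m) \<bullet>\<^sub>k L = (\<lambda>n. \<Sum>l\<in>S. (u l \<bullet>\<^sub>k L) n)"
  by (simp add: kapp_eq_sum_support mm.sum_left fun_eq_iff sum.swap[of _ S])

lemma kapp_add_right:
  assumes "fin_cols K" "fin_cols L"
  shows "u \<bullet>\<^sub>k (\<lambda>m n. K m n + L m n) = (\<lambda>n. (u \<bullet>\<^sub>k K) n + (u \<bullet>\<^sub>k L) n)"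
proof
  fix n
  define F where "F = {m. K m n \<noteq> 0} \<union> {m. L m n \<noteq> 0}"
  have F: "finite F" "\<And>m. m \<notin> F \<Longrightarrow> K m n = 0" "\<And>m. m \<notin> F \<Longrightarrow> L m n = 0"
    using assms by (auto simp: F_def fin_cols_def)
  show "(u \<bullet>\<^sub>k (\<lambda>m n. K m n + L m n)) n = (u \<bullet>\<^sub>k K) n + (u \<bullet>\<^sub>k L) n"
    using F by (simp add: kapp_eq_sum[of F] mm.add_right sum.distrib)
qed

lemma kapp_sum_right:
  assumes "finite S" "\<And>l. l \<in> S \<Longrightarrow> fin_cols (K l)"
  shows "u \<bullet>\<^sub>k (\<lambda>m n. \<Sum>l\<in>S. K l m n) = (\<lambda>n. \<Sum>l\<in>S. (u \<bullet>\<^sub>k K l) n)"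
proof
  fix n
  define F where "F = (\<Union>l\<in>S. {m. K l m n \<noteq> 0})"
  have F: "finite F" "\<And>l m. m \<notin> F \<Longrightarrow> l \<in> S \<Longrightarrow> K l m n = 0"
    using assms by (auto simp: F_def fin_cols_def)
  show "(u \<bullet>\<^sub>k (\<lambda>m n. \<Sum>l\<in>S. K l m n)) n = (\<Sum>l\<in>S. (u \<bullet>\<^sub>k K l) n)"
    using F by (simp add: kapp_eq_sum[of F] mm.sum_right sum.swap[of _ S])
qed

subsection \<open>Characters and Fourier series\<close>

text \<open>Dedekind's argument: translate the relation by \<open>y\<close> and subtract
  \<open>e j y\<close> times the original one. The term of \<open>j\<close> cancels and the
  coefficients become \<open>c i * (e i y - e j y)\<close>, to which the induction hypothesis
  applies.\<close>

lemma characters_independent: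
  fixes e :: "'i \<Rightarrow> 'a::group_add \<Rightarrow> complex"
  assumes "finite S" "inj_on e S"
    and "\<And>i x y. i \<in> S \<Longrightarrow> e i (x + y) = e i x * e i y"
    and "\<And>i. i \<in> S \<Longrightarrow> e i 0 = 1"
    and "\<And>x. (\<Sum>i\<in>S. c i * e i x) = 0"
  shows "\<forall>i\<in>S. c i = 0"
  using assms
proof (induction S arbitrary: c rule: finite_induct)
  case (insert j S)
  note hom = insert.prems(2) and one = insert.prems(3) and rel = insert.prems(4)
  have "c i * (e i y - e j y) = 0" if "i \<in> S" for i y
  proof -
    have "(\<Sum>i\<in>S. (c i * (e i y - e j y)) * e i x) = 0" for x
    proof -
      have "(\<Sum>i\<in>S. (c i * (e i y - e j y)) * e i x) =
          (\<Sum>i\<in>S. c i * e i (y + x)) - e j y * (\<Sum>i\<in>S. c i * e i x)"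
        unfolding sum_distrib_left sum_subtractf[symmetric]
        by (intro sum.cong) (auto simp: hom algebra_simps)
      also have "\<dots> = (\<Sum>i\<in>insert j S. c i * e i (y + x)) - e j y * (\<Sum>i\<in>insert j S. c i * e i x)"
        using insert.hyps by (simp add: hom algebra_simps)
      finally show ?thesis by (simp only: rel) simp
    qed
    then have "\<forall>i\<in>S. c i * (e i y - e j y) = 0"
      using insert.prems by (intro insert.IH) (auto simp: inj_on_def)
    with that show ?thesis by blast
  qed
  moreover have "e i \<noteq> e j" if "i \<in> S" for i
    using insert.prems(1) insert.hyps that by (auto simp: inj_on_def)
  \<comment> \<open>Distinct characters differ at some \<open>y\<close>, and there the second factor
    is nonzero. The coefficient of \<open>j\<close> then vanishes by evaluating the relation at
    0.\<close>
  ultimately have "c i = 0" if "i \<in> S" for i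
    using that by (metis ext mult_eq_0_iff right_minus_eq)
  with rel[of 0] insert.hyps one show ?case by auto
qed simp

text \<open>The pairing of Z^d with R^d is a character in each argument. Both readings are used:
  frequencies \<open>k\<close> as characters of R^d, and digits, scaled by 2 pi, as characters of
  Z^d.\<close>

definition cis_inner :: "int^'d::finite \<Rightarrow> real^'d \<Rightarrow> complex" where
  "cis_inner k \<xi> = cis (real_vec k \<bullet> \<xi>)"

lemma real_vec_add: "real_vec (k + l) = real_vec k + real_vec l"
  and real_vec_diff: "real_vec (k - l) = real_vec k - real_vec l"
  and real_vec_minus: "real_vec (- k) = - real_vec k"
  and real_vec_0 [simp]: "real_vec 0 = 0"
  by (auto simp: real_vec_def vec_eq_iff)

lemma real_vec_eq_iff [simp]: "real_vec k = real_vec l \<longleftrightarrow> k = l"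
  by (simp add: real_vec_def vec_eq_iff)

lemma real_vec_axis: "real_vec (axis i 1) = axis i 1"
  by (auto simp: real_vec_def vec_eq_iff axis_def)

lemma real_vec_matrix_vector: "real_vec (A *v k) = real_mat A *v real_vec k"
  by (auto simp: real_vec_def vec_eq_iff matrix_vector_mult_def map_matrix_def)

lemma cis_inner_simps:
  "cis_inner (k + l) \<xi> = cis_inner k \<xi> * cis_inner l \<xi>"
  "cis_inner k (\<xi> + \<eta>) = cis_inner k \<xi> * cis_inner k \<eta>"
  "cis_inner 0 \<xi> = 1" "cis_inner k 0 = 1"
  "cis_inner (- k) \<xi> = cnj (cis_inner k \<xi>)"
  "cis_inner k (- \<xi>) = cnj (cis_inner k \<xi>)"
  by (simp_all add: cis_inner_def real_vec_add real_vec_minus inner_add_left inner_add_right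
      cis_mult cis_cnj)

text \<open>This adjointness is the source of the transposed matrices in the Fourier domain.\<close>

lemma cis_inner_matrix: "cis_inner (A *v k) \<xi> = cis_inner k (transpose (real_mat A) *v \<xi>)"
  by (simp add: cis_inner_def real_vec_matrix_vector transpose_matrix_vector)
    (metis dot_lmul_matrix inner_commute)

lemma exp_eq_cis_inner:
  "exp (- \<i> * complex_of_real (real_vec k \<bullet> \<xi>)) = cis_inner (- k) \<xi>"
  by (simp add: cis_inner_def cis_conv_exp real_vec_minus)

lemma cis_inner_eq_1_iff: "cis_inner k ((2 * pi) *\<^sub>R \<xi>) = 1 \<longleftrightarrow> real_vec k \<bullet> \<xi> \<in> \<int>"
proof -
  have "cis_inner k ((2 * pi) *\<^sub>R \<xi>) = exp (2 * of_real pi * \<i> * of_real (real_vec k \<bullet> \<xi>))"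
    by (simp add: cis_inner_def cis_conv_exp mult_ac)
  also have "\<dots> = 1 \<longleftrightarrow> (\<exists>n::int. real_vec k \<bullet> \<xi> = of_int n)"
    by (auto simp: exp_eq_1)
  finally show ?thesis by (auto simp: Ints_def)
qed

lemma inj_cis_inner: "inj cis_inner"
proof (rule injI, rule ccontr)
  fix k l :: "int^'d"
  assume eq: "cis_inner k = cis_inner l" and "k \<noteq> l"
  then obtain i where i: "k $ i \<noteq> l $ i" by (auto simp: vec_eq_iff)
  \<comment> \<open>Chosen so that the inner product of \<open>k - l\<close> with \<xi> is 1/2,
    which is not an integer.\<close>
  define \<xi> :: "real^'d" where "\<xi> = axis i (1 / (2 * real_of_int (k $ i - l $ i)))"
  have "cis_inner (k - l) ((2 * pi) *\<^sub>R \<xi>) =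
      cis_inner k ((2 * pi) *\<^sub>R \<xi>) * cnj (cis_inner l ((2 * pi) *\<^sub>R \<xi>))"
    by (simp add: cis_inner_simps(1,5)[symmetric])
  also have "\<dots> = 1"
    unfolding eq by (simp add: cis_inner_def cis_cnj cis_mult)
  finally have "real_vec (k - l) \<bullet> \<xi> \<in> \<int>" by (simp only: cis_inner_eq_1_iff)
  moreover have "real_vec (k - l) \<bullet> \<xi> = 1/2"
    using i by (simp add: \<xi>_def inner_axis real_vec_def)
  ultimately show False by simp
qed

lemma trig_poly_eq_0:
  fixes c :: "int^'d::finite \<Rightarrow> complex"
  assumes "finite T" "\<And>\<xi>. (\<Sum>t\<in>T. c t * cis_inner t \<xi>) = 0"
  shows "\<forall>t\<in>T. c t = 0"
  using assms inj_cis_inner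
  by (intro characters_independent[where e = cis_inner])
    (auto simp: cis_inner_simps intro: inj_on_subset)

text \<open>Here \<open>n\<close> is the variable and \<omega> labels the character. Two labels give
  the same character iff they differ by an integer vector, as testing on unit vectors shows; in the
  half-open cube this forces equality.\<close>

lemma lattice_characters_independent:
  fixes c :: "real^'d::finite \<Rightarrow> complex"
  assumes "finite W" "\<And>\<omega> i. \<omega> \<in> W \<Longrightarrow> 0 \<le> \<omega> $ i \<and> \<omega> $ i < 1"
    and "\<And>n. (\<Sum>\<omega>\<in>W. c \<omega> * cis_inner n ((2 * pi) *\<^sub>R \<omega>)) = 0"
  shows "\<forall>\<omega>\<in>W. c \<omega> = 0"
proof (rule characters_independent)
  show "inj_on (\<lambda>\<omega> n. cis_inner n ((2 * pi) *\<^sub>R \<omega>)) W"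
  proof (rule inj_onI)
    fix \<omega> \<eta> assume W: "\<omega> \<in> W" "\<eta> \<in> W"
      and eq: "(\<lambda>n. cis_inner n ((2 * pi) *\<^sub>R \<omega>)) = (\<lambda>n. cis_inner n ((2 * pi) *\<^sub>R \<eta>))"
    have "cis_inner n ((2 * pi) *\<^sub>R (\<omega> - \<eta>)) = 1" for n
    proof -
      have "cis_inner n ((2 * pi) *\<^sub>R (\<omega> - \<eta>)) = cis_inner n ((2 * pi) *\<^sub>R \<omega>) * cnj (cis_inner n ((2 * pi) *\<^sub>R \<eta>))"
        by (simp add: cis_inner_simps(2,6)[symmetric] scaleR_diff_right)
      also have "\<dots> = cis_inner n ((2 * pi) *\<^sub>R \<eta>) * cnj (cis_inner n ((2 * pi) *\<^sub>R \<eta>))"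
        using fun_cong[OF eq, of n] by simp
      also have "\<dots> = 1" by (simp add: cis_inner_def cis_cnj cis_mult)
      finally show ?thesis .
    qed
    then have int: "(\<omega> - \<eta>) $ i \<in> \<int>" for i
      by (metis cis_inner_eq_1_iff real_vec_axis inner_axis' inner_real_def mult_1)
    show "\<omega> = \<eta>"
      unfolding vec_eq_iff
    proof
      fix i
      from int[of i] obtain z :: int where z: "\<omega> $ i - \<eta> $ i = of_int z" by (auto elim: Ints_cases)
      moreover have "\<bar>\<omega> $ i - \<eta> $ i\<bar> < 1"
        using assms(2)[OF W(1), of i] assms(2)[OF W(2), of i] by auto
      ultimately have "z = 0" by linarith
      with z show "\<omega> $ i = \<eta> $ i" by simp
    qed
  qed
qed (use assms in \<open>auto simp: cis_inner_simps\<close>)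

section \<open>Fourier coefficients determine finitely supported sequences\<close>

lemma fourier_nth:
  assumes "finite P" "\<And>k. k \<notin> P \<Longrightarrow> u k = 0"
  shows "fourier u \<xi> $ i $ j = (\<Sum>k\<in>P. u k $ i $ j * cis_inner (- k) \<xi>)"
  unfolding fourier_def exp_eq_cis_inner using assms
  by (simp add: infsum_finite_support)

lemma fourier_inject:
  assumes "finitely_supported u" "finitely_supported v" "\<And>\<xi>. fourier u \<xi> = fourier v \<xi>"
  shows "u = v"
proof (intro ext, unfold vec_eq_iff, intro allI)
  fix k i j
  define P where "P = insert k ({k. u k \<noteq> 0} \<union> {k. v k \<noteq> 0})"
  have P: "finite P" "\<And>k. k \<notin> P \<Longrightarrow> u k = 0" "\<And>k. k \<notin> P \<Longrightarrow> v k = 0"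
    using assms by (auto simp: P_def finitely_supported_def)
  \<comment> \<open>The exponent in \<open>fourier\<close> is negative, so the value at
    \<open>k\<close> is the coefficient of the character of \<open>- k\<close>.\<close>
  have "(\<Sum>t\<in>uminus ` P. (u (- t) $ i $ j - v (- t) $ i $ j) * cis_inner t \<xi>) = 0" for \<xi>
    using arg_cong[OF assms(3)[of \<xi>], of "\<lambda>A. A $ i $ j"] P
    by (simp add: fourier_nth[of P] sum.reindex left_diff_distrib sum_subtractf)
  then have "\<forall>t\<in>uminus ` P. u (- t) $ i $ j - v (- t) $ i $ j = 0"
    using P by (intro trig_poly_eq_0) auto
  then show "u k $ i $ j = v k $ i $ j" by (auto simp: P_def)
qed

subsection \<open>Filters as kernels and the cascade\<close>

lemma det_of_int: "det (map_matrix of_int A :: 'a::comm_ring_1^'d::finite^'d) = of_int (det A)"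
  by (simp add: det_def of_int_sum of_int_prod)

text \<open>A singular matrix has a complex kernel vector, that is, an eigenvector for 0, whose
  modulus is not greater than 1.\<close>

lemma dilation_matrix_det_nonzero:
  assumes "dilation_matrix (A :: int^'d::finite^'d)"
  shows "det A \<noteq> 0"
proof
  assume "det A = 0"
  then have "det (map_matrix of_int A :: complex^'d^'d) = 0" by (simp add: det_of_int)
  then have "\<not> invertible (map_matrix of_int A :: complex^'d^'d)" by (simp add: invertible_det_nz)
  then obtain x :: "complex^'d" where "x \<noteq> 0" "map_matrix of_int A *v x = 0"
    unfolding invertible_left_inverse matrix_left_invertible_ker by auto
  then have "x \<noteq> 0 \<and> map_matrix of_int A *v x = 0 *s x" by simp
  with assms show False unfolding dilation_matrix_def by fastforce
qed

lemma invertible_real_mat: "det A \<noteq> 0 \<Longrightarrow> invertible (real_mat A)"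
  by (simp add: invertible_det_nz det_of_int)

lemma inj_int_matrix:
  assumes "det (A :: int^'d::finite^'d) \<noteq> 0"
  shows "inj ((*v) A)"
proof (rule injI)
  fix k l :: "int^'d" assume "A *v k = A *v l"
  then have "real_mat A *v real_vec k = real_mat A *v real_vec l"
    by (metis real_vec_matrix_vector)
  then show "k = l"
    using invertible_real_mat[OF assms] by (metis inj_matrix_vector_mult injD real_vec_eq_iff)
qed

definition filter_kernel ::
    "('d::finite, 'p::finite, 'r::finite) mseq \<Rightarrow> int^'d^'d \<Rightarrow> (int^'d, int^'d, 'p, 'r) kernel" where
  "filter_kernel a A = (\<lambda>k n. (real_of_int \<bar>det A\<bar> powr (1 / 2)) *\<^sub>R a (n - A *v k))"

lemma filter_kernel_rows:
  assumes "finitely_supported a"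
  shows "finite {n. filter_kernel a A k n \<noteq> 0}" (is "finite ?N")
    and "card {n. filter_kernel a A k n \<noteq> 0} \<le> card {k. a k \<noteq> 0}"
proof -
  have inj: "inj_on (\<lambda>n. n - A *v k) ?N" by (auto simp: inj_on_def)
  have sub: "(\<lambda>n. n - A *v k) ` ?N \<subseteq> {k. a k \<noteq> 0}" by (auto simp: filter_kernel_def)
  from sub inj show "finite ?N"
    using assms unfolding finitely_supported_def by (meson finite_imageD finite_subset)
  from sub inj show "card ?N \<le> card {k. a k \<noteq> 0}"
    using assms unfolding finitely_supported_def by (metis card_image card_mono)
qed

text \<open>Since \<open>A\<close> is injective on the lattice, distinct \<open>k\<close> read off
  values of \<open>a\<close> at distinct points. The bound on the count does not depend on
  \<open>n\<close>, as the l2 estimate requires.\<close>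

lemma filter_kernel_cols:
  assumes "finitely_supported a" "det A \<noteq> 0"
  shows "finite {k. filter_kernel a A k n \<noteq> 0}" (is "finite ?N")
    and "card {k. filter_kernel a A k n \<noteq> 0} \<le> card {k. a k \<noteq> 0}"
proof -
  have inj: "inj_on (\<lambda>k. n - A *v k) ?N"
    using inj_int_matrix[OF assms(2)] by (auto simp: inj_on_def)
  have sub: "(\<lambda>k. n - A *v k) ` ?N \<subseteq> {k. a k \<noteq> 0}" by (auto simp: filter_kernel_def)
  from sub inj show "finite ?N"
    using assms unfolding finitely_supported_def by (meson finite_imageD finite_subset)
  from sub inj show "card ?N \<le> card {k. a k \<noteq> 0}"
    using assms unfolding finitely_supported_def by (metis card_image card_mono)
qed

lemma fin_cols_filter_kernel:
  "finitely_supported a \<Longrightarrow> det A \<noteq> 0 \<Longrightarrow> fin_cols (filter_kernel a A)"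
  "finitely_supported a \<Longrightarrow> fin_cols (kadj (filter_kernel a A))"
  by (auto simp: fin_cols_def kadj_def filter_kernel_cols filter_kernel_rows)

lemma subdivision_op_eq: "subdivision_op a A u = u \<bullet>\<^sub>k filter_kernel a A"
  by (simp add: subdivision_op_def kapp_def filter_kernel_def mm.scaleR_right infsum_scaleR_right)

lemma transition_op_eq: "transition_op a A u = u \<bullet>\<^sub>k kadj (filter_kernel a A)"
  by (simp add: transition_op_def kapp_def kadj_def filter_kernel_def conj_transpose_scaleR
      mm.scaleR_right infsum_scaleR_right)

text \<open>Pairing \<open>u\<close> with all rows of \<open>K\<close> at once is the application of
  the adjoint kernel.\<close>

lemma inner_seq_eq: "inner_seq u (K k) = (u \<bullet>\<^sub>k kadj K) k"
  by (simp add: inner_seq_def kapp_def kadj_def)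

section \<open>Multilevel filters in the Fourier and in the time domain\<close>

lemma matrix_vector_mult_minus_right: "A *v (- x) = - (A *v (x :: 'a::comm_ring_1^'d::finite))"
  by (simp add: matrix_vector_mult_def vec_eq_iff sum_negf)

definition upsample_conv ::
    "('d::finite, 'p::finite, 'r::finite) mseq \<Rightarrow> ('d, 'r, 'q::finite) mseq \<Rightarrow> int^'d^'d \<Rightarrow> ('d, 'p, 'q) mseq" where
  "upsample_conv u a A = (\<lambda>n. \<Sum>\<^sub>\<infinity>k. u k ** a (n - A *v k))"

lemma upsample_conv_support:
  assumes "upsample_conv u a A n \<noteq> 0"
  shows "\<exists>k q. u k \<noteq> 0 \<and> a q \<noteq> 0 \<and> n = q + A *v k"
proof (rule ccontr)
  assume *: "\<not> ?thesis"
  have "u k ** a (n - A *v k) = 0" for k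
    using * by (metis diff_add_cancel mm.zero_left mm.zero_right)
  with assms show False by (simp add: upsample_conv_def)
qed

lemma finitely_supported_upsample_conv:
  assumes "finitely_supported u" "finitely_supported a"
  shows "finitely_supported (upsample_conv u a A)"
proof -
  have "{n. upsample_conv u a A n \<noteq> 0} \<subseteq> (\<lambda>(k, q). q + A *v k) ` ({k. u k \<noteq> 0} \<times> {q. a q \<noteq> 0})"
    by (auto dest!: upsample_conv_support simp: image_iff) 
  then show ?thesis
    using assms unfolding finitely_supported_def by (meson finite_SigmaI finite_imageI finite_subset)
qed

text \<open>Shifting \<open>a\<close> by \<open>A *v k\<close> multiplies its Fourier series by the
  character of \<open>- (A *v k)\<close>, which is the character of \<open>- k\<close> evaluated at
  the transposed matrix times \<xi>. Summing over \<open>k\<close> produces the dilated series of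
  \<open>u\<close>.\<close>

lemma fourier_upsample_conv:
  assumes u: "finitely_supported u" and a: "finitely_supported a"
  shows "fourier (upsample_conv u a A) \<xi> = fourier u (transpose (real_mat A) *v \<xi>) ** fourier a \<xi>"
  unfolding vec_eq_iff
proof (intro allI)
  fix i j
  \<comment> \<open>\<open>N\<close> contains the support of the convolution and of every shifted
    copy of \<open>a\<close> that enters it, so all sums over \<open>n\<close> may run over this one
    finite set.\<close>
  define U Q N where "U = {k. u k \<noteq> 0}" and "Q = {q. a q \<noteq> 0}"
    and "N = (\<lambda>(k, q). q + A *v k) ` (U \<times> Q)"
  have fin: "finite U" "finite Q" "finite N"
    using u a by (auto simp: U_def Q_def N_def finitely_supported_def)
  have N: "upsample_conv u a A n = 0" if "n \<notin> N" for n
    using upsample_conv_support[of u a A n] that by (force simp: N_def U_def Q_def)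
  have conv: "upsample_conv u a A n = (\<Sum>k\<in>U. u k ** a (n - A *v k))" for n
    unfolding upsample_conv_def using fin
    by (intro infsum_finite_support) (auto simp: U_def mm.zero_left)
  have shift: "(\<Sum>n\<in>N. a (n - A *v k) $ m $ j * cis_inner (- n) \<xi>) =
      cis_inner (- (A *v k)) \<xi> * fourier a \<xi> $ m $ j" if "k \<in> U" for k m
  proof -
    have "(\<Sum>n\<in>N. a (n - A *v k) $ m $ j * cis_inner (- n) \<xi>) =
        (\<Sum>n\<in>(\<lambda>q. q + A *v k) ` Q. a (n - A *v k) $ m $ j * cis_inner (- n) \<xi>)"
    proof (rule sum.mono_neutral_right[OF fin(3)])
      show "(\<lambda>q. q + A *v k) ` Q \<subseteq> N" using that by (auto simp: N_def)
      have "n - A *v k \<notin> Q" if "n \<notin> (\<lambda>q. q + A *v k) ` Q" for n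
        using that by (metis diff_add_cancel image_eqI)
      then show "\<forall>n\<in>N - (\<lambda>q. q + A *v k) ` Q. a (n - A *v k) $ m $ j * cis_inner (- n) \<xi> = 0"
        by (auto simp: Q_def)
    qed
    also have "\<dots> = (\<Sum>q\<in>Q. a q $ m $ j * cis_inner (- q + - (A *v k)) \<xi>)"
      by (subst sum.reindex) (auto simp: inj_on_def add.commute)
    also have "\<dots> = cis_inner (- (A *v k)) \<xi> * (\<Sum>q\<in>Q. a q $ m $ j * cis_inner (- q) \<xi>)"
      unfolding cis_inner_simps(1) by (simp add: sum_distrib_left mult_ac)
    also have "(\<Sum>q\<in>Q. a q $ m $ j * cis_inner (- q) \<xi>) = fourier a \<xi> $ m $ j"
      using fin by (intro fourier_nth[symmetric]) (auto simp: Q_def)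
    finally show ?thesis .
  qed
  have "fourier (upsample_conv u a A) \<xi> $ i $ j =
      (\<Sum>n\<in>N. upsample_conv u a A n $ i $ j * cis_inner (- n) \<xi>)"
    using fin N by (intro fourier_nth)
  also have "\<dots> = (\<Sum>n\<in>N. \<Sum>k\<in>U. \<Sum>m\<in>UNIV. u k $ i $ m * (a (n - A *v k) $ m $ j * cis_inner (- n) \<xi>))"
    by (simp add: conv matrix_matrix_mult_def sum_distrib_right mult.assoc)
  also have "\<dots> = (\<Sum>k\<in>U. \<Sum>m\<in>UNIV. u k $ i $ m * (\<Sum>n\<in>N. a (n - A *v k) $ m $ j * cis_inner (- n) \<xi>))"
    unfolding sum_distrib_left
    by (subst sum.swap) (intro sum.cong refl sum.swap)
  also have "\<dots> = (\<Sum>k\<in>U. \<Sum>m\<in>UNIV. u k $ i $ m * (cis_inner (- (A *v k)) \<xi> * fourier a \<xi> $ m $ j))"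
    using shift by simp
  also have "\<dots> = (\<Sum>m\<in>UNIV. (\<Sum>k\<in>U. u k $ i $ m * cis_inner (- k) (transpose (real_mat A) *v \<xi>)) * fourier a \<xi> $ m $ j)"
    by (subst sum.swap) (simp add: sum_distrib_right mult.assoc cis_inner_matrix[symmetric] matrix_vector_mult_minus_right
        del: transpose_matrix_vector)
  also have "\<dots> = (\<Sum>m\<in>UNIV. fourier u (transpose (real_mat A) *v \<xi>) $ i $ m * fourier a \<xi> $ m $ j)"
    using fin by (subst fourier_nth[of U]) (auto simp: U_def)
  finally show "fourier (upsample_conv u a A) \<xi> $ i $ j =
      (fourier u (transpose (real_mat A) *v \<xi>) ** fourier a \<xi>) $ i $ j"
    by (simp add: matrix_matrix_mult_def)
qed

primrec cascade_seq ::
    "int^'d^'d \<Rightarrow> ('d::finite, 'r::finite, 'r) mseq \<Rightarrow> ('d, 'p::finite, 'r) mseq \<Rightarrow> nat \<Rightarrow> ('d, 'p, 'r) mseq" where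
  "cascade_seq M0 b0 a 0 = a"
| "cascade_seq M0 b0 a (Suc n) = upsample_conv (cascade_seq M0 b0 a n) b0 M0"

lemma finitely_supported_cascade_seq:
  "finitely_supported b0 \<Longrightarrow> finitely_supported a \<Longrightarrow> finitely_supported (cascade_seq M0 b0 a n)"
  by (induction n) (simp_all add: finitely_supported_upsample_conv)

lemma mat_pow_Suc_right: "mat_pow A (Suc n) = mat_pow A n ** A"
  by (induction n) (simp_all add: matrix_mul_assoc)

lemma mat_pow_mult_vector:
  "mat_pow A n *v (A *v x) = mat_pow A (Suc n) *v x" for A :: "'a::comm_semiring_1^'d::finite^'d"
  unfolding mat_pow_Suc_right by (simp add: matrix_vector_mul_assoc)

text \<open>The definition adds the most dilated factor on the left, whereas
  \<open>cascade_seq\<close> adds the undilated factor on the right; this lemma reconciles the two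
  recursions at the price of moving \<xi>.\<close>

lemma fourier_cascade_Suc_right:
  "fourier_cascade M0 b0 (Suc n) \<xi> =
     fourier_cascade M0 b0 n (transpose (real_mat M0) *v \<xi>) ** fourier b0 \<xi>"
proof (induction n)
  case (Suc n)
  show ?case
    by (subst fourier_cascade.simps, subst Suc.IH)
      (simp add: matrix_mul_assoc mat_pow_mult_vector del: mat_pow.simps transpose_matrix_vector)
qed simp

lemma fourier_cascade_seq:
  assumes "finitely_supported b0" "finitely_supported a"
  shows "fourier (cascade_seq M0 b0 a n) \<xi> =
    fourier a (mat_pow (transpose (real_mat M0)) n *v \<xi>) ** fourier_cascade M0 b0 n \<xi>"
proof (induction n arbitrary: \<xi>)
  case (Suc n)
  show ?case
    using assms Suc
    by (simp add: fourier_upsample_conv finitely_supported_cascade_seq fourier_cascade_Suc_right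
        mat_pow_mult_vector matrix_mul_assoc del: mat_pow.simps fourier_cascade.simps transpose_matrix_vector)
qed simp

text \<open>The definite description is justified by \<open>cascade_seq\<close> for existence and by
  injectivity of the Fourier series for uniqueness.\<close>

lemma level_filter_Suc:
  assumes "finitely_supported b0" "finitely_supported a"
  shows "level_filter M0 b0 a (Suc n) = cascade_seq M0 b0 a n"
  unfolding level_filter_def
proof (rule the_equality)
  show "finitely_supported (cascade_seq M0 b0 a n) \<and>
      (\<forall>\<xi>. fourier (cascade_seq M0 b0 a n) \<xi> =
        fourier a (mat_pow (transpose (real_mat M0)) (Suc n - 1) *v \<xi>) ** fourier_cascade M0 b0 (Suc n - 1) \<xi>)"
    using assms by (simp add: finitely_supported_cascade_seq fourier_cascade_seq)
  then show "u = cascade_seq M0 b0 a n" if "finitely_supported u \<and>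
      (\<forall>\<xi>. fourier u \<xi> =
        fourier a (mat_pow (transpose (real_mat M0)) (Suc n - 1) *v \<xi>) ** fourier_cascade M0 b0 (Suc n - 1) \<xi>)" for u
    using that by (intro fourier_inject) auto
qed

text \<open>The counter is the number of factors \<open>K0\<close> to the right of \<open>K\<close>,
  so level j corresponds to j - 1. Starting from \<open>kid\<close> gives the plain powers of
  \<open>K0\<close>.\<close>

primrec kcascade ::
    "('k, 'j, 'p::finite, 'r::finite) kernel \<Rightarrow> ('j, 'j, 'r, 'r) kernel \<Rightarrow> nat \<Rightarrow> ('k, 'j, 'p, 'r) kernel" where
  "kcascade K K0 0 = K"
| "kcascade K K0 (Suc n) = kcascade K K0 n \<odot> K0"

text \<open>Each factor \<open>filter_kernel b0 M0\<close> contributes one square root of the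
  determinant and one upsampled convolution, while the translation by which row \<open>k\<close> is
  shifted gets multiplied by \<open>M0\<close>.\<close>

lemma kcascade_filter_kernel:
  assumes "finitely_supported b0" "finitely_supported a" "det M0 \<noteq> 0"
  shows "kcascade (filter_kernel a N) (filter_kernel b0 M0) n k x =
    (real_of_int \<bar>det M0\<bar> powr (real n / 2) * real_of_int \<bar>det N\<bar> powr (1 / 2)) *\<^sub>R
      cascade_seq M0 b0 a n (x - (mat_pow M0 n ** N) *v k)"
proof (induction n arbitrary: k x)
  case 0
  \<comment> \<open>The factor \<open>\<bar>det M0\<bar> powr 0\<close> is 1 only for a nonzero
    base.\<close>
  show ?case using assms(3) by (simp add: filter_kernel_def)
next
  case (Suc n)
  define p where "p = (mat_pow M0 n ** N) *v k"
  define c where "c = real_of_int \<bar>det M0\<bar> powr (real n / 2) * real_of_int \<bar>det N\<bar> powr (1 / 2)"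
  have p: "(mat_pow M0 (Suc n) ** N) *v k = M0 *v p"
    by (simp add: p_def matrix_vector_mul_assoc matrix_mul_assoc)
  have kernel_b0: "filter_kernel b0 M0 m x = (real_of_int \<bar>det M0\<bar> powr (1 / 2)) *\<^sub>R b0 (x - M0 *v m)" for m
    by (simp add: filter_kernel_def)
  have "kcascade (filter_kernel a N) (filter_kernel b0 M0) (Suc n) k x =
     (\<Sum>\<^sub>\<infinity>m. (c * real_of_int \<bar>det M0\<bar> powr (1 / 2)) *\<^sub>R (cascade_seq M0 b0 a n (m - p) ** b0 (x - M0 *v m)))"
    by (simp only: kcascade.simps kcomp_def kapp_def Suc.IH kernel_b0 mm.scaleR_left
        mm.scaleR_right scaleR_scaleR c_def[symmetric] p_def[symmetric] mult.commute[of c])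
  also have "\<dots> = (c * real_of_int \<bar>det M0\<bar> powr (1 / 2)) *\<^sub>R
      (\<Sum>\<^sub>\<infinity>m. cascade_seq M0 b0 a n (m - p) ** b0 (x - M0 *v m))"
    by (rule infsum_scaleR_right)
  \<comment> \<open>Substituting \<open>m + p\<close> for \<open>m\<close> turns the shift by
    \<open>p\<close> on the coarse side into a shift by \<open>M0 *v p\<close> on the fine
    side.\<close>
  also have "(\<Sum>\<^sub>\<infinity>m. cascade_seq M0 b0 a n (m - p) ** b0 (x - M0 *v m)) =
      (\<Sum>\<^sub>\<infinity>m. cascade_seq M0 b0 a n m ** b0 (x - M0 *v p - M0 *v m))"
    by (rule infsum_reindex_bij_witness[of _ "\<lambda>m. m + p" "\<lambda>m. m - p"])
      (auto simp: matrix_vector_mult_diff_distrib algebra_simps)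
  also have "c * real_of_int \<bar>det M0\<bar> powr (1 / 2) =
      real_of_int \<bar>det M0\<bar> powr (real (Suc n) / 2) * real_of_int \<bar>det N\<bar> powr (1 / 2)"
    by (simp add: c_def add_divide_distrib powr_add)
  finally show ?case
    by (simp only: p cascade_seq.simps upsample_conv_def)
qed

lemma das_elem_eq:
  assumes "finitely_supported b0" "finitely_supported a" "det M0 \<noteq> 0" "j \<ge> 1"
  shows "das_elem M0 b0 N a j = kcascade (filter_kernel a N) (filter_kernel b0 M0) (j - 1)"
proof (intro ext)
  fix k x
  from \<open>j \<ge> 1\<close> obtain n where j: "j = Suc n" by (cases j) auto
  show "das_elem M0 b0 N a j k x = kcascade (filter_kernel a N) (filter_kernel b0 M0) (j - 1) k x"
    using assms by (simp add: j das_elem_def level_filter_Suc kcascade_filter_kernel)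
qed

subsection \<open>The lattice index and character sums over digit sets\<close>

lemma emeasure_lborel_translation:
  fixes S :: "'a::euclidean_space set"
  assumes "S \<in> sets borel"
  shows "emeasure lborel {x. x + c \<in> S} = emeasure lborel S"
proof -
  have "emeasure lborel S = emeasure (distr lborel borel ((+) c)) S"
    by (simp add: lborel_distr_plus)
  also have "\<dots> = emeasure lborel {x. x + c \<in> S}"
    using assms by (subst emeasure_distr) (auto simp: vimage_def add.commute)
  finally show ?thesis by simp
qed

text \<open>Cut \<open>P\<close> into the pieces that lie in the translates of \<open>Q\<close> by
  \<open>t i\<close>. Moving each piece back by \<open>t i\<close> gives the part of
  \<open>Q\<close> that \<open>t i\<close> carries into \<open>P\<close>, and these parts make up
  \<open>Q\<close>.\<close>

lemma emeasure_fundamental_domains: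
  fixes P Q :: "'a::euclidean_space set" and t :: "'i::countable \<Rightarrow> 'a"
  assumes [measurable]: "P \<in> sets borel" "Q \<in> sets borel"
    and P: "\<And>x. \<exists>!i. x + t i \<in> P" and Q: "\<And>x. \<exists>!i. x - t i \<in> Q"
  shows "emeasure lborel P = emeasure lborel Q"
proof -
  have "emeasure lborel P = emeasure lborel (\<Union>i. {x \<in> P. x - t i \<in> Q})"
    using Q by (intro arg_cong[where f = "emeasure lborel"]) blast
  also have "\<dots> = (\<integral>\<^sup>+i. emeasure lborel {x \<in> P. x - t i \<in> Q} \<partial>count_space UNIV)"
  proof (rule emeasure_UN_countable)
    show "disjoint_family (\<lambda>i. {x \<in> P. x - t i \<in> Q})"
      using Q unfolding disjoint_family_on_def by blast
  qed (auto intro!: pred_sets2)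
  also have "\<dots> = (\<integral>\<^sup>+i. emeasure lborel {x \<in> Q. x + t i \<in> P} \<partial>count_space UNIV)"
  proof (rule nn_integral_cong)
    fix i
    have "emeasure lborel {x. x + t i \<in> {x \<in> P. x - t i \<in> Q}} = emeasure lborel {x \<in> P. x - t i \<in> Q}"
      by (intro emeasure_lborel_translation) measurable
    then show "emeasure lborel {x \<in> P. x - t i \<in> Q} = emeasure lborel {x \<in> Q. x + t i \<in> P}"
      by (simp add: conj_commute)
  qed
  also have "\<dots> = emeasure lborel (\<Union>i. {x \<in> Q. x + t i \<in> P})"
  proof (rule emeasure_UN_countable[symmetric])
    show "disjoint_family (\<lambda>i. {x \<in> Q. x + t i \<in> P})"
      using P unfolding disjoint_family_on_def by blast
  qed (auto intro!: pred_sets2)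
  also have "\<dots> = emeasure lborel Q"
    using P by (intro arg_cong[where f = "emeasure lborel"]) blast
  finally show ?thesis .
qed

section \<open>Counting the points of an inverse lattice in the unit cube\<close>

definition unit_cell :: "(real^'d::finite) set" where
  "unit_cell = {x. \<forall>i. 0 \<le> x $ i \<and> x $ i < 1}"

definition floor_vec :: "real^'d::finite \<Rightarrow> int^'d" where
  "floor_vec x = (\<chi> i. \<lfloor>x $ i\<rfloor>)"

lemma diff_in_unit_cell_iff: "x - real_vec k \<in> unit_cell \<longleftrightarrow> k = floor_vec x"
proof -
  have "(0 \<le> a - of_int z \<and> a - of_int z < 1) \<longleftrightarrow> z = \<lfloor>a\<rfloor>" for a :: real and z :: int
    by linarith
  then show ?thesis by (simp add: unit_cell_def floor_vec_def real_vec_def vec_eq_iff)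
qed

lemma add_in_unit_cell_iff: "x + real_vec k \<in> unit_cell \<longleftrightarrow> k = - floor_vec x"
  using diff_in_unit_cell_iff[of x "- k"] by (simp add: real_vec_minus) (metis minus_equation_iff)

lemma borel_unit_cell [measurable]: "unit_cell \<in> sets borel"
  unfolding unit_cell_def by measurable

lemma emeasure_unit_cell: "emeasure lborel (unit_cell :: (real^'d::finite) set) = 1"
proof (rule antisym)
  have *: "(\<Prod>b\<in>Basis. (1 :: real^'d) \<bullet> b) = 1"
    by (intro prod.neutral) (auto simp: Basis_vec_def inner_axis)
  have ge: "(0 :: real^'d) \<bullet> b \<le> 1 \<bullet> b" if "b \<in> Basis" for b :: "real^'d"
    using that by (auto simp: Basis_vec_def inner_axis)
  have "emeasure lborel (unit_cell :: (real^'d) set) \<le> emeasure lborel (cbox 0 (1 :: real^'d))"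
    by (intro emeasure_mono) (auto simp: unit_cell_def mem_box_cart less_imp_le)
  also have "\<dots> = 1" using ge * by (subst emeasure_lborel_cbox) auto
  finally show "emeasure lborel (unit_cell :: (real^'d) set) \<le> 1" .
  have "1 = emeasure lborel (box 0 (1 :: real^'d))" using ge * by (subst emeasure_lborel_box) auto
  also have "\<dots> \<le> emeasure lborel (unit_cell :: (real^'d) set)"
    by (intro emeasure_mono) (auto simp: unit_cell_def mem_box_cart less_imp_le)
  finally show "1 \<le> emeasure lborel (unit_cell :: (real^'d) set)" .
qed

text \<open>For invertible \<open>A\<close> this is the intersection of A^(-1) Z^d with the
  half-open unit cube; phrasing it through \<open>A\<close> avoids the inverse.\<close>

definition dual_cell_points :: "int^'d^'d \<Rightarrow> (real^'d::finite) set" where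
  "dual_cell_points A = {y \<in> unit_cell. \<exists>k. real_mat A *v y = real_vec k}"

text \<open>Both \<open>P\<close>, the image of the unit cube, and \<open>Q\<close>, the union of
  the unit cubes at the integer points of \<open>P\<close>, are fundamental domains for the
  translations by A Z^d. The volume of \<open>P\<close> is \<open>\<bar>det A\<bar>\<close>; that of
  \<open>Q\<close> is the number of integer points of \<open>P\<close>, which correspond to the
  points sought.\<close>

lemma card_dual_cell_points_wellorder:
  fixes A :: "int^'d::{finite,wellorder}^'d::{finite,wellorder}"
  assumes "det A \<noteq> 0"
  shows "finite (dual_cell_points A)" "int (card (dual_cell_points A)) = \<bar>det A\<bar>"
proof -
  define R where "R = real_mat A"
  obtain B where B: "R ** B = mat 1" "B ** R = mat 1"
    using invertible_real_mat[OF assms] by (auto simp: R_def invertible_def)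
  have BR [simp]: "B *v (R *v x) = x" "R *v (B *v x) = x" for x
    by (simp_all add: matrix_vector_mul_assoc B)
  define P where "P = {x. B *v x \<in> unit_cell}"
  define D where "D = {k. real_vec k \<in> P}"
  define Q where "Q = (\<Union>k\<in>D. {x. x - real_vec k \<in> unit_cell})"
  have [measurable]: "(\<lambda>x. B *v x) \<in> borel_measurable borel"
    by (intro borel_measurable_continuous_onI linear_continuous_on) simp
  have [measurable]: "P \<in> sets borel" by (simp add: P_def)
  have Q_eq: "Q = {x. real_vec (floor_vec x) \<in> P}"
    by (auto simp: Q_def D_def diff_in_unit_cell_iff)
  have [measurable]: "Q \<in> sets borel"
    unfolding Q_def by (intro sets.countable_UN') auto
  have P_image: "P = (*v) R ` unit_cell"
    by (force simp: P_def image_iff)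
  have "emeasure lborel P = emeasure lborel Q"
  proof (rule emeasure_fundamental_domains[where t = "\<lambda>m. R *v real_vec m"])
    fix x
    show "\<exists>!m. x + R *v real_vec m \<in> P"
      by (simp add: P_def matrix_vector_right_distrib add_in_unit_cell_iff)
    \<comment> \<open>The translations are integral, so they commute with taking floors; tiling by
      \<open>Q\<close> thus reduces to tiling of the integer points by \<open>P\<close>.\<close>
    have "floor_vec (x - R *v real_vec m) = floor_vec x - A *v m" for m
      unfolding R_def real_vec_matrix_vector[symmetric]
      by (simp add: floor_vec_def vec_eq_iff real_vec_def)
    then show "\<exists>!m. x - R *v real_vec m \<in> Q"
      by (simp add: Q_eq P_def real_vec_diff real_vec_matrix_vector R_def[symmetric]
          matrix_vector_mult_diff_distrib diff_in_unit_cell_iff)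
  qed auto
  moreover have "emeasure lborel P = ennreal (of_int \<bar>det A\<bar>)"
  proof -
    have cell: "(unit_cell :: (real^'d::{finite,wellorder}) set) \<in> lmeasurable"
      by (intro fmeasurableI) (auto simp: emeasure_unit_cell)
    have "measure lebesgue (unit_cell :: (real^'d::{finite,wellorder}) set) = 1"
      by (simp add: measure_def emeasure_unit_cell)
    then have "measure lebesgue P = of_int \<bar>det A\<bar>"
      using measure_linear_image[OF _ cell, of "(*v) R"]
      by (simp add: P_image matrix_of_matrix_vector_mul R_def det_of_int)
    moreover have "P \<in> lmeasurable"
      using measurable_linear_image[OF _ cell, of "(*v) R"] by (simp add: P_image)
    ultimately have "emeasure lebesgue P = ennreal (of_int \<bar>det A\<bar>)"
      by (simp add: emeasure_eq_measure2 fmeasurableD2)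
    then show ?thesis by simp
  qed
  moreover have "emeasure lborel Q = emeasure (count_space UNIV) D"
  proof -
    have "emeasure lborel Q = (\<integral>\<^sup>+k. emeasure lborel {x. x - real_vec k \<in> unit_cell} \<partial>count_space D)"
      unfolding Q_def
    proof (rule emeasure_UN_countable)
      show "disjoint_family_on (\<lambda>k. {x. x - real_vec k \<in> unit_cell}) D"
        unfolding disjoint_family_on_def by (auto simp: diff_in_unit_cell_iff)
    qed auto
    also have "\<dots> = (\<integral>\<^sup>+k. 1 \<partial>count_space D)"
      using emeasure_lborel_translation[OF borel_unit_cell, of "- real_vec _"]
      by (intro nn_integral_cong) (simp add: emeasure_unit_cell)
    also have "\<dots> = emeasure (count_space UNIV) D"
      by (simp add: emeasure_count_space)
    finally show ?thesis .
  qed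
  ultimately have *: "emeasure (count_space UNIV) D = ennreal (of_int \<bar>det A\<bar>)" by simp
  \<comment> \<open>Finiteness is read off from the volume, since an infinite set has infinite
    counting measure.\<close>
  then have "finite D" by (auto simp: emeasure_count_space split: if_splits)
  with * have "int (card D) = \<bar>det A\<bar>"
    by (simp add: emeasure_count_space ennreal_of_nat_eq_real_of_nat) 
  moreover have "bij_betw (\<lambda>k. B *v real_vec k) D (dual_cell_points A)"
  proof (rule bij_betwI')
    show "B *v real_vec k = B *v real_vec l \<longleftrightarrow> k = l" for k l
      by (metis BR(2) real_vec_eq_iff)
    show "B *v real_vec k \<in> dual_cell_points A" if "k \<in> D" for k
      using that by (auto simp: D_def P_def dual_cell_points_def R_def[symmetric])
    show "\<exists>k\<in>D. y = B *v real_vec k" if "y \<in> dual_cell_points A" for y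
      using that unfolding dual_cell_points_def R_def[symmetric] by (auto simp: D_def P_def) (metis BR(1))
  qed
  ultimately show "finite (dual_cell_points A)" "int (card (dual_cell_points A)) = \<bar>det A\<bar>"
    using \<open>finite D\<close> by (auto dest: bij_betw_same_card simp: bij_betw_finite)
qed

text \<open>Conjugation by \<open>f\<close> matches the permutations of the two index types,
  preserving the sign and, after reindexing, the product of entries.\<close>

lemma det_reindex:
  fixes A :: "'a::comm_ring_1^'n::finite^'n" and f :: "'m::finite \<Rightarrow> 'n"
  assumes "bij f"
  shows "det (\<chi> i j. A $ f i $ f j) = det A"
proof -
  have inv: "inv f (f i) = i" "f (inv f k) = k" for i k
    using assms by (simp_all add: bij_is_inj bij_is_surj surj_f_inv_f)
  have bij_inv: "bij (inv f)" using assms by (rule bij_imp_bij_inv)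
  show ?thesis
    unfolding det_def
  proof (rule sum.reindex_bij_witness[where i = "map_permutation UNIV (inv f)" and j = "map_permutation UNIV f"])
    fix p assume p: "p \<in> {p. p permutes (UNIV :: 'm set)}"
    show "map_permutation UNIV (inv f) (map_permutation UNIV f p) = p"
      using p assms by (intro map_permutation_compose_inv) (auto simp: inv)
    show "map_permutation UNIV f p \<in> {p. p permutes UNIV}"
      using p assms map_permutation_permutes[of f UNIV UNIV p] by auto
    have "(\<Prod>i\<in>UNIV. A $ i $ map_permutation UNIV f p i) = (\<Prod>i\<in>UNIV. A $ f i $ map_permutation UNIV f p (f i))"
      using assms by (rule prod.reindex_bij_betw[symmetric])
    also have "\<dots> = (\<Prod>i\<in>UNIV. A $ f i $ f (p i))"
      using assms by (simp add: map_permutation_apply bij_is_inj)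
    finally show "of_int (sign (map_permutation UNIV f p)) * (\<Prod>i\<in>UNIV. A $ i $ map_permutation UNIV f p i) =
        of_int (sign p) * (\<Prod>i\<in>UNIV. (\<chi> i j. A $ f i $ f j) $ i $ p i)"
      using p assms by (simp add: sign_map_permutation bij_is_inj)
  next
    fix p assume p: "p \<in> {p. p permutes (UNIV :: 'n set)}"
    show "map_permutation UNIV f (map_permutation UNIV (inv f) p) = p"
      using p bij_inv by (intro map_permutation_compose_inv) (auto simp: inv)
    show "map_permutation UNIV (inv f) p \<in> {p. p permutes UNIV}"
      using p bij_inv map_permutation_permutes[of "inv f" UNIV UNIV p] by auto
  qed
qed

text \<open>The library's volume formula for linear maps needs well-ordered indices, hence this copy.\<close>

typedef 'a wo_copy = "UNIV :: 'a set" by simp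

lemma bij_Rep_wo_copy: "bij Rep_wo_copy"
  by (metis Rep_wo_copy_inject Abs_wo_copy_inverse UNIV_I bijI')

instance wo_copy :: (finite) finite
  by standard (metis bij_Rep_wo_copy bij_betw_finite finite)

instantiation wo_copy :: (finite) wellorder
begin

definition less_eq_wo_copy :: "'a wo_copy \<Rightarrow> 'a wo_copy \<Rightarrow> bool" where
  "x \<le> y \<longleftrightarrow> to_nat (Rep_wo_copy x) \<le> to_nat (Rep_wo_copy y)"

definition less_wo_copy :: "'a wo_copy \<Rightarrow> 'a wo_copy \<Rightarrow> bool" where
  "x < y \<longleftrightarrow> to_nat (Rep_wo_copy x) < to_nat (Rep_wo_copy y)"

instance
proof
  fix P :: "'a wo_copy \<Rightarrow> bool" and a
  assume step: "\<And>x. (\<And>y. y < x \<Longrightarrow> P y) \<Longrightarrow> P x"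
  show "P a"
    by (induction a rule: measure_induct_rule[where f = "\<lambda>x. to_nat (Rep_wo_copy x)"])
      (auto intro: step simp: less_wo_copy_def)
qed (auto simp: less_eq_wo_copy_def less_wo_copy_def Rep_wo_copy_inject)

end

text \<open>Relabelling the coordinates carries the points for \<open>A\<close> bijectively onto
  those for \<open>A'\<close> and leaves the determinant unchanged.\<close>

lemma card_dual_cell_points:
  fixes A :: "int^'d^'d::finite"
  assumes "det A \<noteq> 0"
  shows "finite (dual_cell_points A)" "int (card (dual_cell_points A)) = \<bar>det A\<bar>"
proof -
  let ?R = "Rep_wo_copy :: 'd wo_copy \<Rightarrow> 'd" and ?I = "Abs_wo_copy :: 'd \<Rightarrow> 'd wo_copy"
  define A' where "A' = (\<chi> i j. A $ ?R i $ ?R j)"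
  have det: "det A' = det A" unfolding A'_def by (rule det_reindex[OF bij_Rep_wo_copy])
  have RI [simp]: "?R (?I i) = i" "?I (?R j) = j" for i j
    by (simp_all add: Abs_wo_copy_inverse Rep_wo_copy_inverse)
  have mult: "(real_mat A' *v (\<chi> i. y $ ?R i)) $ j = (real_mat A *v y) $ ?R j" for y j
    unfolding matrix_vector_mult_def A'_def
    using sum.reindex_bij_betw[OF bij_Rep_wo_copy, of "\<lambda>j'. real_of_int (A $ ?R j $ j') * y $ j'"]
    by simp
  have "bij_betw (\<lambda>y. \<chi> i. y $ ?R i) (dual_cell_points A) (dual_cell_points A')"
  proof (rule bij_betwI')
    show "(\<chi> i. y $ ?R i) = (\<chi> i. z $ ?R i) \<longleftrightarrow> y = z" for y z :: "real^'d"
      by (auto simp: vec_eq_iff) (metis RI(1))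
    show "(\<chi> i. y $ ?R i) \<in> dual_cell_points A'" if y: "y \<in> dual_cell_points A" for y
    proof -
      from y obtain k where "real_mat A *v y = real_vec k" "y \<in> unit_cell"
        by (auto simp: dual_cell_points_def)
      then have "real_mat A' *v (\<chi> i. y $ ?R i) = real_vec (\<chi> j. k $ ?R j)"
        by (simp add: vec_eq_iff mult) (simp add: real_vec_def)
      with \<open>y \<in> unit_cell\<close> show ?thesis by (auto simp: dual_cell_points_def unit_cell_def)
    qed
    show "\<exists>y\<in>dual_cell_points A. z = (\<chi> i. y $ ?R i)" if z: "z \<in> dual_cell_points A'" for z
    proof
      define y where "y = (\<chi> j. z $ ?I j)"
      show zy: "z = (\<chi> i. y $ ?R i)" by (simp add: y_def vec_eq_iff)
      from z obtain k where k: "real_mat A' *v z = real_vec k" "z \<in> unit_cell"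
        by (auto simp: dual_cell_points_def)
      have "(real_mat A *v y) $ j = real_vec (\<chi> j. k $ ?I j) $ j" for j
        using mult[of y "?I j"] k(1) unfolding zy[symmetric] by (simp add: real_vec_def)
      then have "real_mat A *v y = real_vec (\<chi> j. k $ ?I j)" by (simp add: vec_eq_iff)
      with k(2) show "y \<in> dual_cell_points A"
        by (auto simp: dual_cell_points_def unit_cell_def y_def)
    qed
  qed
  then show "finite (dual_cell_points A)" "int (card (dual_cell_points A)) = \<bar>det A\<bar>"
    using card_dual_cell_points_wellorder[of A'] assms det
    by (auto dest: bij_betw_same_card simp: bij_betw_finite)
qed

section \<open>Digit sets and their character sums\<close>

lemma real_mat_transpose: "real_mat (transpose A) = transpose (real_mat A)"
  by (simp add: map_matrix_def transpose_def)

lemma matrix_inv: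
  assumes "invertible (R :: 'a::semiring_1^'d::finite^'d)"
  shows "R ** matrix_inv R = mat 1" "matrix_inv R ** R = mat 1"
  using someI_ex[OF assms[unfolded invertible_def]] by (auto simp: matrix_inv_def)

lemma transpose_matrix_inv:
  assumes "invertible (R :: real^'d^'d::finite)"
  shows "transpose R ** transpose (matrix_inv R) = mat 1" "transpose (matrix_inv R) ** transpose R = mat 1"
  using matrix_inv[OF assms]
  by (simp_all add: matrix_transpose_mul[symmetric])

lemma digit_set_eq:
  assumes "det (A :: int^'d^'d::finite) \<noteq> 0"
  shows "digit_set A = dual_cell_points (transpose A)"
proof -
  note inv = transpose_matrix_inv[OF invertible_real_mat[OF assms]]
  have "\<omega> = transpose (matrix_inv (real_mat A)) *v real_vec k \<longleftrightarrow> transpose (real_mat A) *v \<omega> = real_vec k" for \<omega> k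
    using inv by (metis matrix_vector_mul_assoc matrix_vector_mul_lid)
  then show ?thesis
    by (auto simp: digit_set_def dual_cell_points_def unit_cell_def real_mat_transpose image_iff simp del: transpose_matrix_vector)
qed

lemma digit_set_in_unit_cell: "\<omega> \<in> digit_set A \<Longrightarrow> 0 \<le> \<omega> $ i \<and> \<omega> $ i < 1"
  by (auto simp: digit_set_def)

lemma zero_in_digit_set: "0 \<in> digit_set A"
  unfolding digit_set_def by (auto simp: image_iff intro!: exI[of _ 0])

lemma finite_digit_set: "det (A :: int^'d^'d::finite) \<noteq> 0 \<Longrightarrow> finite (digit_set A)"
  by (simp add: digit_set_eq card_dual_cell_points det_transpose)

text \<open>For \<open>n\<close> in A Z^d every summand is 1. Otherwise some \<omega>0 in A^(-T) Z^d
  has character value z different from 1 at \<open>n\<close>; adding \<omega>0 modulo Z^d permutes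
  the digits, so the sum equals z times itself.\<close>

lemma sum_digit_set:
  fixes A :: "int^'d^'d::finite"
  assumes "det A \<noteq> 0"
  shows "(\<Sum>\<omega>\<in>digit_set A. cis_inner n ((2 * pi) *\<^sub>R \<omega>)) = of_int \<bar>det A\<bar> * of_bool (n \<in> range ((*v) A))"
proof (cases "n \<in> range ((*v) A)")
  case True
  then obtain m where m: "n = A *v m" by auto
  have "cis_inner n ((2 * pi) *\<^sub>R \<omega>) = 1" if \<omega>: "\<omega> \<in> digit_set A" for \<omega>
  proof -
    from \<omega> obtain k where k: "transpose (real_mat A) *v \<omega> = real_vec k"
      unfolding digit_set_eq[OF assms] dual_cell_points_def real_mat_transpose by blast
    have "cis_inner n ((2 * pi) *\<^sub>R \<omega>) = cis_inner m ((2 * pi) *\<^sub>R real_vec k)"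
      unfolding m cis_inner_matrix k[symmetric] matrix_vector_mult_scaleR ..
    then show ?thesis
      by (simp add: cis_inner_eq_1_iff) (auto simp: real_vec_def inner_vec_def)
  qed
  moreover have "of_nat (card (digit_set A)) = (of_int \<bar>det A\<bar> :: complex)"
    using card_dual_cell_points(2)[of "transpose A"] assms
    by (simp add: digit_set_eq det_transpose) (metis of_int_abs of_int_of_nat_eq)
  ultimately show ?thesis using True by simp
next
  case False
  define R where "R = real_mat A"
  have inv: "invertible R" using invertible_real_mat[OF assms] by (simp add: R_def)
  note tinv = transpose_matrix_inv[OF inv]
  \<comment> \<open>\<open>n\<close> lies in A Z^d exactly when this preimage is integral; a
    nonintegral coordinate \<open>i\<close> then selects \<omega>0.\<close>
  define y where "y = matrix_inv R *v real_vec n"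
  have Ry: "R *v y = real_vec n"
    by (simp add: y_def matrix_vector_mul_assoc matrix_inv[OF inv])
  have "\<exists>i. y $ i \<notin> \<int>"
  proof (rule ccontr)
    assume "\<not> ?thesis"
    then have "y $ i = of_int \<lfloor>y $ i\<rfloor>" for i by (auto elim: Ints_cases)
    then have "y = real_vec (floor_vec y)" by (simp add: vec_eq_iff real_vec_def floor_vec_def)
    then have "n = A *v floor_vec y" using Ry by (metis R_def real_vec_eq_iff real_vec_matrix_vector)
    with False show False by blast
  qed
  then obtain i where i: "y $ i \<notin> \<int>" ..
  define \<omega>0 where "\<omega>0 = transpose (matrix_inv R) *v axis i 1"
  have \<omega>0: "transpose R *v \<omega>0 = real_vec (axis i 1)"
    unfolding \<omega>0_def matrix_vector_mul_assoc tinv by (simp add: real_vec_axis)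
  define z where "z = cis_inner n ((2 * pi) *\<^sub>R \<omega>0)"
  \<comment> \<open>This inner product is \<open>y $ i\<close>, so its failure to be an integer is
    what makes \<open>z\<close> differ from 1.\<close>
  have "real_vec n \<bullet> \<omega>0 = y \<bullet> (transpose R *v \<omega>0)"
    unfolding Ry[symmetric] transpose_matrix_vector by (metis dot_lmul_matrix inner_commute)
  then have z: "z \<noteq> 1"
    using i by (simp only: z_def cis_inner_eq_1_iff \<omega>0 real_vec_axis) (simp add: inner_axis)
  \<comment> \<open>Translation by \<omega>0 followed by reduction into the unit cube; the
    subtracted integer vector does not affect the characters.\<close>
  define \<phi> where "\<phi> \<omega> = \<omega> + \<omega>0 - real_vec (floor_vec (\<omega> + \<omega>0))" for \<omega>
  have \<phi>_cell: "\<phi> \<omega> \<in> unit_cell" for \<omega> by (simp add: \<phi>_def diff_in_unit_cell_iff)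
  have maps: "\<phi> ` digit_set A \<subseteq> digit_set A"
  proof
    fix \<eta> assume "\<eta> \<in> \<phi> ` digit_set A"
    then obtain \<omega> k where \<omega>: "\<eta> = \<phi> \<omega>" "transpose R *v \<omega> = real_vec k"
      unfolding digit_set_eq[OF assms] dual_cell_points_def real_mat_transpose R_def by blast
    have "transpose R *v \<eta> = real_vec (k + axis i 1 - transpose A *v floor_vec (\<omega> + \<omega>0))"
      unfolding \<omega> \<phi>_def matrix_vector_mult_diff_distrib matrix_vector_right_distrib \<omega>0 real_vec_diff
        real_vec_add real_vec_matrix_vector real_mat_transpose R_def[symmetric] ..
    with \<phi>_cell \<omega>(1) show "\<eta> \<in> digit_set A"
      unfolding digit_set_eq[OF assms] dual_cell_points_def real_mat_transpose R_def[symmetric] by blast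
  qed
  have inj: "inj_on \<phi> (digit_set A)"
  proof (rule inj_onI)
    fix \<omega> \<eta> assume in_digit: "\<omega> \<in> digit_set A" "\<eta> \<in> digit_set A" and eq: "\<phi> \<omega> = \<phi> \<eta>"
    then have cell: "\<omega> - real_vec 0 \<in> unit_cell" "\<eta> - real_vec 0 \<in> unit_cell"
      by (auto simp: unit_cell_def digit_set_in_unit_cell)
    define l where "l = floor_vec (\<omega> + \<omega>0) - floor_vec (\<eta> + \<omega>0)"
    have "\<eta> = \<omega> - real_vec l"
      using eq by (simp add: \<phi>_def l_def real_vec_diff algebra_simps)
    then have "l = 0" using cell by (simp add: diff_in_unit_cell_iff)
      (metis cell(1) diff_in_unit_cell_iff diff_zero real_vec_0)
    with \<open>\<eta> = \<omega> - real_vec l\<close> show "\<omega> = \<eta>" by simp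
  qed
  have shift: "cis_inner n ((2 * pi) *\<^sub>R \<phi> \<omega>) = z * cis_inner n ((2 * pi) *\<^sub>R \<omega>)" for \<omega>
  proof -
    have "cis_inner n ((2 * pi) *\<^sub>R (- real_vec k)) = 1" for k
      unfolding cis_inner_eq_1_iff real_vec_minus[symmetric] by (auto simp: real_vec_def inner_vec_def)
    then show ?thesis
      unfolding \<phi>_def diff_conv_add_uminus scaleR_add_right cis_inner_simps(2) z_def
      by simp
  qed
  have "(\<Sum>\<omega>\<in>digit_set A. cis_inner n ((2 * pi) *\<^sub>R \<omega>)) =
      (\<Sum>\<omega>\<in>digit_set A. cis_inner n ((2 * pi) *\<^sub>R \<phi> \<omega>))"
    using sum.reindex[OF inj, of "\<lambda>\<omega>. cis_inner n ((2 * pi) *\<^sub>R \<omega>)"]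
      endo_inj_surj[OF finite_digit_set[OF assms] maps inj] by (simp only: o_def)
  then have "(\<Sum>\<omega>\<in>digit_set A. cis_inner n ((2 * pi) *\<^sub>R \<omega>)) =
      z * (\<Sum>\<omega>\<in>digit_set A. cis_inner n ((2 * pi) *\<^sub>R \<omega>))"
    unfolding shift sum_distrib_left[symmetric] .
  with z False show ?thesis by simp
qed

subsection \<open>The filter bank condition in the time domain\<close>

text \<open>The set where \<open>f\<close> is nonzero is open, and a nonempty open set has positive
  measure.\<close>

lemma continuous_AE_eq_0:
  fixes f :: "'a::euclidean_space \<Rightarrow> 'b::{t2_space,zero}"
  assumes "continuous_on UNIV f" "AE x in lborel. f x = 0"
  shows "f x = 0"
proof -
  have "open {x. f x \<noteq> 0}"
    by (rule open_Collect_neq[OF assms(1)]) (rule continuous_on_const)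
  moreover from this have "{x. f x \<noteq> 0} \<in> null_sets lborel"
    using assms(2) by (subst AE_iff_null_sets) auto
  then have "negligible {x. f x \<noteq> 0}"
    by (simp add: negligible_iff_null_sets null_sets_completionI)
  ultimately show ?thesis using open_not_negligible by blast
qed

text \<open>\<open>filter_corr P b bt t \<eta>\<close> is the coefficient of \<open>cis_inner t \<xi>\<close> in the trigonometric polynomial
  \<open>conj_transpose (fourier b \<xi>) ** fourier bt (\<xi> + \<eta>)\<close>, for filters supported in \<open>P\<close>.\<close>

definition filter_corr ::
    "(int^'d) set \<Rightarrow> ('d::finite, 'p::finite, 'r::finite) mseq \<Rightarrow> ('d, 'p, 'q::finite) mseq \<Rightarrow>
      int^'d \<Rightarrow> real^'d \<Rightarrow> complex^'q^'r" where
  "filter_corr P b bt t \<eta> = (\<chi> a c. \<Sum>q\<in>P. (conj_transpose (b (q + t)) ** bt q) $ a $ c * cis_inner (- q) \<eta>)"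

lemma conj_transpose_fourier_mult:
  assumes P: "finite P" "\<And>k. k \<notin> P \<Longrightarrow> b k = 0" "\<And>k. k \<notin> P \<Longrightarrow> bt k = 0"
    and T: "finite T" "\<And>p q. p \<in> P \<Longrightarrow> q \<in> P \<Longrightarrow> p - q \<in> T"
  shows "(conj_transpose (fourier b \<xi>) ** fourier bt (\<xi> + \<eta>)) $ a $ c =
    (\<Sum>t\<in>T. filter_corr P b bt t \<eta> $ a $ c * cis_inner t \<xi>)"
proof -
  have shift: "(\<Sum>p\<in>P. cnj (b p $ i $ a) * cis_inner (p - q) \<xi>) =
      (\<Sum>t\<in>T. cnj (b (q + t) $ i $ a) * cis_inner t \<xi>)" if "q \<in> P" for q i
  proof -
    have "(\<Sum>p\<in>P. cnj (b p $ i $ a) * cis_inner (p - q) \<xi>) =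
        (\<Sum>t\<in>(\<lambda>p. p - q) ` P. cnj (b (q + t) $ i $ a) * cis_inner t \<xi>)"
      by (subst sum.reindex) (auto simp: inj_on_def)
    also have "\<dots> = (\<Sum>t\<in>T. cnj (b (q + t) $ i $ a) * cis_inner t \<xi>)"
    proof (rule sum.mono_neutral_left[OF T(1)])
      show "(\<lambda>p. p - q) ` P \<subseteq> T" using T(2) that by auto
      have "q + t \<notin> P" if "t \<notin> (\<lambda>p. p - q) ` P" for t
        using that by (metis add_diff_cancel_left' image_eqI)
      then show "\<forall>t\<in>T - (\<lambda>p. p - q) ` P. cnj (b (q + t) $ i $ a) * cis_inner t \<xi> = 0"
        using P(2) by auto
    qed
    finally show ?thesis .
  qed
  have "(conj_transpose (fourier b \<xi>) ** fourier bt (\<xi> + \<eta>)) $ a $ c =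
      (\<Sum>i\<in>UNIV. (\<Sum>p\<in>P. cnj (b p $ i $ a) * cis_inner p \<xi>) *
        (\<Sum>q\<in>P. bt q $ i $ c * cis_inner (- q) \<xi> * cis_inner (- q) \<eta>))"
    using P by (simp add: matrix_matrix_mult_def fourier_nth[of P] cis_inner_simps mult.assoc)
  also have "\<dots> = (\<Sum>i\<in>UNIV. \<Sum>q\<in>P. \<Sum>p\<in>P. (cnj (b p $ i $ a) * cis_inner (p - q) \<xi>) * (bt q $ i $ c * cis_inner (- q) \<eta>))"
    unfolding diff_conv_add_uminus cis_inner_simps(1)
    by (intro sum.cong refl, subst sum.swap) (simp add: sum_product mult_ac)
  also have "\<dots> = (\<Sum>i\<in>UNIV. \<Sum>q\<in>P. \<Sum>t\<in>T. (cnj (b (q + t) $ i $ a) * cis_inner t \<xi>) * (bt q $ i $ c * cis_inner (- q) \<eta>))"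
    unfolding sum_distrib_right[symmetric] by (intro sum.cong refl) (simp add: shift)
  also have "\<dots> = (\<Sum>t\<in>T. \<Sum>q\<in>P. \<Sum>i\<in>UNIV. (cnj (b (q + t) $ i $ a) * cis_inner t \<xi>) * (bt q $ i $ c * cis_inner (- q) \<eta>))"
    by (subst sum.swap, subst (2) sum.swap, subst sum.swap) (rule refl)
  also have "\<dots> = (\<Sum>t\<in>T. filter_corr P b bt t \<eta> $ a $ c * cis_inner t \<xi>)"
    by (simp add: filter_corr_def matrix_matrix_mult_def sum_distrib_right sum_distrib_left mult_ac)
  finally show ?thesis .
qed

text \<open>Weighted with the character of \<open>n\<close>, the sum over digits keeps just those
  \<open>q\<close> with \<open>n - q\<close> in A Z^d. With \<open>q = n - A *v k\<close> the
  remaining sum over \<open>k\<close> is a kernel product, whose row is \<open>n + t\<close> because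
  \<open>b\<close> is evaluated at \<open>q + t\<close>.\<close>

lemma sum_digit_set_filter_corr:
  fixes A :: "int^'d^'d::finite"
  assumes A: "det A \<noteq> 0" and P: "finite P" "\<And>k. k \<notin> P \<Longrightarrow> bt k = 0"
  shows "(\<Sum>\<omega>\<in>digit_set A. filter_corr P b bt t ((2 * pi) *\<^sub>R \<omega>) $ a $ c * cis_inner n ((2 * pi) *\<^sub>R \<omega>)) =
    (kadj (filter_kernel b A) \<odot> filter_kernel bt A) (n + t) n $ a $ c"
proof -
  define g where "g q = (conj_transpose (b (q + t)) ** bt q) $ a $ c" for q
  define F where "F = {k. n - A *v k \<in> P}"
  have inj: "inj (\<lambda>k. n - A *v k)" using inj_int_matrix[OF A] by (auto simp: inj_def)
  have F: "finite F"
    unfolding F_def using finite_vimageI[OF P(1) inj] by (simp add: vimage_def)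
  have image: "(\<lambda>k. n - A *v k) ` F = {q \<in> P. n - q \<in> range ((*v) A)}"
    by (auto simp: F_def image_iff algebra_simps)
  have "(\<Sum>\<omega>\<in>digit_set A. filter_corr P b bt t ((2 * pi) *\<^sub>R \<omega>) $ a $ c * cis_inner n ((2 * pi) *\<^sub>R \<omega>)) =
      (\<Sum>q\<in>P. g q * (\<Sum>\<omega>\<in>digit_set A. cis_inner (n - q) ((2 * pi) *\<^sub>R \<omega>)))"
    unfolding filter_corr_def g_def diff_conv_add_uminus cis_inner_simps(1)
    by (simp add: sum_distrib_left sum_distrib_right mult_ac) (rule sum.swap)
  also have "\<dots> = of_int \<bar>det A\<bar> * (\<Sum>q\<in>P. if n - q \<in> range ((*v) A) then g q else 0)"
    unfolding sum_digit_set[OF A] sum_distrib_left by (intro sum.cong) auto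
  also have "(\<Sum>q\<in>P. if n - q \<in> range ((*v) A) then g q else 0) = (\<Sum>k\<in>F. g (n - A *v k))"
    using sum.reindex[OF inj_on_subset[OF inj], of F g] P(1)
    by (simp add: image sum.inter_filter)
  also have "of_int \<bar>det A\<bar> * \<dots> =
      (\<Sum>k\<in>F. (kadj (filter_kernel b A) (n + t) k ** filter_kernel bt A k n) $ a $ c)"
  proof -
    \<comment> \<open>The determinant produced by the character sum is the product of the
      normalising square roots of the two kernels.\<close>
    have "real_of_int \<bar>det A\<bar> powr (1/2) * real_of_int \<bar>det A\<bar> powr (1/2) = real_of_int \<bar>det A\<bar>"
      using A by (simp add: powr_add[symmetric])
    moreover have "complex_of_real \<bar>real_of_int (det A)\<bar> = complex_of_int \<bar>det A\<bar>"
      by (metis of_int_abs of_real_of_int_eq)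
    ultimately have "(kadj (filter_kernel b A) (n + t) k ** filter_kernel bt A k n) $ a $ c =
        of_int \<bar>det A\<bar> * g (n - A *v k)" for k
      by (simp add: kadj_def filter_kernel_def conj_transpose_scaleR mm.scaleR_left mm.scaleR_right
          g_def diff_add_eq scaleR_conv_of_real[where 'a = complex])
    then show ?thesis by (simp add: sum_distrib_left)
  qed
  also have "\<dots> = (kadj (filter_kernel b A) \<odot> filter_kernel bt A) (n + t) n $ a $ c"
    unfolding kcomp_def using F P(2)
    by (subst kapp_eq_sum[of F]) (auto simp: F_def filter_kernel_def)
  finally show ?thesis .
qed

lemma sum_indicator_subset:
  fixes f :: "'a \<Rightarrow> complex"
  assumes "finite W" "D \<subseteq> W"
  shows "(\<Sum>\<omega>\<in>W. indicator D \<omega> * f \<omega>) = (\<Sum>\<omega>\<in>D. f \<omega>)"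
  using assms by (simp add: sum_indicator_mult Int_absorb1 indicator_def if_distrib sum.If_cases cong: if_cong)

text \<open>Both conditions say that the table \<open>H\<close> equals the table \<delta>. In the
  Fourier form, \<open>H\<close> gives the coefficients of trigonometric polynomials in \<xi>; in
  the kernel form, for each \<open>t\<close>, it gives the coefficients of a combination of the
  characters \<omega> of the lattice.\<close>

theorem dual_framelet_filter_bank_iff:
  fixes M0 :: "int^'d^'d::finite" and b0 bt0 :: "('d, 'r::finite, 'r) mseq"
    and M :: "'s::finite \<Rightarrow> int^'d^'d" and b bt :: "'s \<Rightarrow> ('d, 1, 'r) mseq"
  assumes det: "det M0 \<noteq> 0" "\<And>l. det (M l) \<noteq> 0"
    and fs: "finitely_supported b0" "\<And>l. finitely_supported (b l)"
      "finitely_supported bt0" "\<And>l. finitely_supported (bt l)"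
  shows "dual_framelet_filter_bank M0 M b0 b bt0 bt \<longleftrightarrow>
    (\<forall>m n. (kadj (filter_kernel b0 M0) \<odot> filter_kernel bt0 M0) m n +
      (\<Sum>l\<in>UNIV. (kadj (filter_kernel (b l) (M l)) \<odot> filter_kernel (bt l) (M l)) m n) = kid m n)"
    (is "_ \<longleftrightarrow> (\<forall>m n. ?K m n = _)")
proof -
  \<comment> \<open>A common support set for all filters. It contains 0 so that the frequency 0 of
    the identity matrix belongs to \<open>T\<close>.\<close>
  define P where "P = insert 0 ({k. b0 k \<noteq> 0} \<union> {k. bt0 k \<noteq> 0} \<union> (\<Union>l. {k. b l k \<noteq> 0} \<union> {k. bt l k \<noteq> 0}))"
  have finP: "finite P" using fs by (auto simp: P_def finitely_supported_def)
  have P: "k \<notin> P \<Longrightarrow> b0 k = 0" "k \<notin> P \<Longrightarrow> bt0 k = 0" "k \<notin> P \<Longrightarrow> b l k = 0" "k \<notin> P \<Longrightarrow> bt l k = 0" for k l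
    by (auto simp: P_def)
  define T where "T = (\<lambda>(p, q). p - q) ` (P \<times> P)"
  have finT: "finite T" using finP by (simp add: T_def)
  have T: "p \<in> P \<Longrightarrow> q \<in> P \<Longrightarrow> p - q \<in> T" for p q by (auto simp: T_def)
  have "0 \<in> T" using T[of 0 0] by (simp add: P_def)
  define W where "W = digit_set M0 \<union> (\<Union>l. digit_set (M l))"
  have finW: "finite W" using det by (simp add: W_def finite_digit_set)
  have "0 \<in> W" by (simp add: W_def zero_in_digit_set)
  have W_cell: "0 \<le> \<omega> $ i \<and> \<omega> $ i < 1" if "\<omega> \<in> W" for \<omega> i
    using that by (auto simp: W_def digit_set_in_unit_cell)
  define H where "H t \<omega> a c = indicator (digit_set M0) \<omega> * filter_corr P b0 bt0 t ((2 * pi) *\<^sub>R \<omega>) $ a $ c +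
      (\<Sum>l\<in>UNIV. indicator (digit_set (M l)) \<omega> * filter_corr P (b l) (bt l) t ((2 * pi) *\<^sub>R \<omega>) $ a $ c)"
    for t \<omega> a c
  define \<delta> where "\<delta> t \<omega> a c = (of_bool (t = 0 \<and> \<omega> = 0 \<and> a = c) :: complex)"
    for t :: "int^'d" and \<omega> :: "real^'d" and a c :: 'r
  define L where "L \<xi> \<omega> = indicator (digit_set M0) \<omega> *\<^sub>R
          (conj_transpose (fourier b0 \<xi>) ** fourier bt0 (\<xi> + (2 * pi) *\<^sub>R \<omega>)) +
        (\<Sum>l\<in>UNIV. indicator (digit_set (M l)) \<omega> *\<^sub>R
          (conj_transpose (fourier (b l) \<xi>) ** fourier (bt l) (\<xi> + (2 * pi) *\<^sub>R \<omega>)))" for \<xi> \<omega>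
  have L: "L \<xi> \<omega> $ a $ c = (\<Sum>t\<in>T. H t \<omega> a c * cis_inner t \<xi>)" for \<xi> \<omega> a c
  proof -
    have "L \<xi> \<omega> $ a $ c = indicator (digit_set M0) \<omega> * (\<Sum>t\<in>T. filter_corr P b0 bt0 t ((2 * pi) *\<^sub>R \<omega>) $ a $ c * cis_inner t \<xi>) +
        (\<Sum>l\<in>UNIV. indicator (digit_set (M l)) \<omega> * (\<Sum>t\<in>T. filter_corr P (b l) (bt l) t ((2 * pi) *\<^sub>R \<omega>) $ a $ c * cis_inner t \<xi>))"
      unfolding L_def
      by (simp add: conj_transpose_fourier_mult[OF finP P(1,2) finT T]
          conj_transpose_fourier_mult[OF finP P(3,4) finT T] scaleR_conv_of_real[where 'a = complex] of_real_indicator)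
    also have "\<dots> = (\<Sum>t\<in>T. H t \<omega> a c * cis_inner t \<xi>)"
      unfolding H_def distrib_right sum.distrib sum_distrib_left sum_distrib_right
      by (subst (2) sum.swap) (simp add: mult.assoc)
    finally show ?thesis .
  qed
  have \<delta>: "(mat (of_bool (\<omega> = 0)) :: complex^'r^'r) $ a $ c = (\<Sum>t\<in>T. \<delta> t \<omega> a c * cis_inner t \<xi>)" for \<omega> a c \<xi>
  proof -
    have "(\<Sum>t\<in>T. \<delta> t \<omega> a c * cis_inner t \<xi>) = (\<Sum>t\<in>{0}. \<delta> t \<omega> a c * cis_inner t \<xi>)"
      using finT \<open>0 \<in> T\<close> by (intro sum.mono_neutral_right) (auto simp: \<delta>_def)
    then show ?thesis by (simp add: \<delta>_def mat_def cis_inner_simps)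
  qed
  have "dual_framelet_filter_bank M0 M b0 b bt0 bt \<longleftrightarrow> (AE \<xi> in lborel. \<forall>\<omega>\<in>W. L \<xi> \<omega> = mat (of_bool (\<omega> = 0)))"
    by (simp add: dual_framelet_filter_bank_def W_def L_def)
  also have "\<dots> \<longleftrightarrow> (\<forall>\<omega>\<in>W. \<forall>a c. \<forall>t\<in>T. H t \<omega> a c = \<delta> t \<omega> a c)"
  proof
    assume ae: "AE \<xi> in lborel. \<forall>\<omega>\<in>W. L \<xi> \<omega> = mat (of_bool (\<omega> = 0))"
    show "\<forall>\<omega>\<in>W. \<forall>a c. \<forall>t\<in>T. H t \<omega> a c = \<delta> t \<omega> a c"
    proof (intro ballI allI)
      fix \<omega> a c t assume \<omega>: "\<omega> \<in> W" and t: "t \<in> T"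
      \<comment> \<open>For a trigonometric polynomial, vanishing almost everywhere upgrades to
        vanishing everywhere by continuity, and then to vanishing coefficients.\<close>
      have "AE \<xi> in lborel. (\<Sum>t\<in>T. (H t \<omega> a c - \<delta> t \<omega> a c) * cis_inner t \<xi>) = 0"
        using ae
      proof eventually_elim
        case (elim \<xi>)
        then have "L \<xi> \<omega> $ a $ c = (mat (of_bool (\<omega> = 0)) :: complex^'r^'r) $ a $ c"
          using \<omega> by simp
        then show ?case unfolding L \<delta>[of _ _ _ \<xi>] by (simp add: left_diff_distrib sum_subtractf)
      qed
      moreover have "continuous_on UNIV (\<lambda>\<xi>. \<Sum>t\<in>T. (H t \<omega> a c - \<delta> t \<omega> a c) * cis_inner t \<xi>)"
        unfolding cis_inner_def cis_conv_exp by (intro continuous_intros)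
      ultimately have "(\<Sum>t\<in>T. (H t \<omega> a c - \<delta> t \<omega> a c) * cis_inner t \<xi>) = 0" for \<xi>
        using continuous_AE_eq_0 by blast
      then show "H t \<omega> a c = \<delta> t \<omega> a c"
        using trig_poly_eq_0[OF finT, of "\<lambda>t. H t \<omega> a c - \<delta> t \<omega> a c"] t by auto
    qed
  next
    assume "\<forall>\<omega>\<in>W. \<forall>a c. \<forall>t\<in>T. H t \<omega> a c = \<delta> t \<omega> a c"
    then have "L \<xi> \<omega> $ a $ c = (mat (of_bool (\<omega> = 0)) :: complex^'r^'r) $ a $ c" if "\<omega> \<in> W" for \<xi> \<omega> a c
      unfolding L \<delta>[of _ _ _ \<xi>] using that by simp
    then show "AE \<xi> in lborel. \<forall>\<omega>\<in>W. L \<xi> \<omega> = mat (of_bool (\<omega> = 0))"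
      by (simp add: vec_eq_iff)
  qed
  \<comment> \<open>For \<open>t\<close> outside \<open>T\<close>, the point \<open>q + t\<close>
    misses the support for every \<open>q\<close> in \<open>P\<close>, and \<open>t\<close> is not
    0; so both tables vanish there.\<close>
  also have "\<dots> \<longleftrightarrow> (\<forall>t. \<forall>a c. \<forall>\<omega>\<in>W. H t \<omega> a c = \<delta> t \<omega> a c)"
  proof -
    have "H t \<omega> a c = \<delta> t \<omega> a c" if "t \<notin> T" for t \<omega> a c
    proof -
      have "b0 (q + t) = 0" "b l (q + t) = 0" if "q \<in> P" for q l
        using \<open>t \<notin> T\<close> that T[of "q + t" q] P(1,3)[of "q + t"] by auto
      moreover have "t \<noteq> 0" using that \<open>0 \<in> T\<close> by auto
      ultimately show ?thesis by (simp add: H_def \<delta>_def filter_corr_def mm.zero_left)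
    qed
    then show ?thesis by blast
  qed
  \<comment> \<open>For fixed \<open>t\<close>, summing the table over \<open>W\<close> against the
    characters at \<open>n\<close> gives the entries on the diagonal at offset \<open>t\<close>.
    Running through all \<open>n\<close> determines the table again.\<close>
  also have "\<dots> \<longleftrightarrow> (\<forall>t n. ?K (n + t) n = kid (n + t) n)"
  proof -
    have K: "?K (n + t) n $ a $ c = (\<Sum>\<omega>\<in>W. H t \<omega> a c * cis_inner n ((2 * pi) *\<^sub>R \<omega>))" for t n a c
    proof -
      have "(\<Sum>\<omega>\<in>W. H t \<omega> a c * cis_inner n ((2 * pi) *\<^sub>R \<omega>)) =
          (\<Sum>\<omega>\<in>W. indicator (digit_set M0) \<omega> * (filter_corr P b0 bt0 t ((2 * pi) *\<^sub>R \<omega>) $ a $ c * cis_inner n ((2 * pi) *\<^sub>R \<omega>))) +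
          (\<Sum>l\<in>UNIV. \<Sum>\<omega>\<in>W. indicator (digit_set (M l)) \<omega> * (filter_corr P (b l) (bt l) t ((2 * pi) *\<^sub>R \<omega>) $ a $ c * cis_inner n ((2 * pi) *\<^sub>R \<omega>)))"
        unfolding H_def distrib_right sum.distrib sum_distrib_right
        by (subst (2) sum.swap) (simp add: mult.assoc)
      also have "\<dots> = ?K (n + t) n $ a $ c"
      proof -
        have "digit_set M0 \<subseteq> W" "digit_set (M l) \<subseteq> W" for l by (auto simp: W_def)
        then show ?thesis
          by (simp add: sum_indicator_subset[OF finW] sum_digit_set_filter_corr[OF det(1) finP P(2)]
              sum_digit_set_filter_corr[OF det(2) finP P(4)])
      qed
      finally show ?thesis by simp
    qed
    have kid: "kid (n + t) n $ a $ c = (\<Sum>\<omega>\<in>W. \<delta> t \<omega> a c * cis_inner n ((2 * pi) *\<^sub>R \<omega>))" for t n a c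
    proof -
      have "(\<Sum>\<omega>\<in>W. \<delta> t \<omega> a c * cis_inner n ((2 * pi) *\<^sub>R \<omega>)) = (\<Sum>\<omega>\<in>{0}. \<delta> t \<omega> a c * cis_inner n ((2 * pi) *\<^sub>R \<omega>))"
        using finW \<open>0 \<in> W\<close> by (intro sum.mono_neutral_right) (auto simp: \<delta>_def)
      then show ?thesis by (simp add: \<delta>_def kid_def mat_def cis_inner_simps)
    qed
    show ?thesis
    proof
      assume "\<forall>t a c. \<forall>\<omega>\<in>W. H t \<omega> a c = \<delta> t \<omega> a c"
      then show "\<forall>t n. ?K (n + t) n = kid (n + t) n"
        unfolding vec_eq_iff K kid by simp
    next
      assume *: "\<forall>t n. ?K (n + t) n = kid (n + t) n"
      show "\<forall>t a c. \<forall>\<omega>\<in>W. H t \<omega> a c = \<delta> t \<omega> a c"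
      proof (intro allI)
        fix t a c
        have "(\<Sum>\<omega>\<in>W. (H t \<omega> a c - \<delta> t \<omega> a c) * cis_inner n ((2 * pi) *\<^sub>R \<omega>)) = 0" for n
          using arg_cong[OF *[rule_format, of n t], of "\<lambda>A. A $ a $ c"] unfolding K kid
          by (simp add: left_diff_distrib sum_subtractf)
        then show "\<forall>\<omega>\<in>W. H t \<omega> a c = \<delta> t \<omega> a c"
          using lattice_characters_independent[OF finW W_cell, of "\<lambda>\<omega>. H t \<omega> a c - \<delta> t \<omega> a c"]
          by auto
      qed
    qed
  qed
  also have "\<dots> \<longleftrightarrow> (\<forall>m n. ?K m n = kid m n)"
  proof
    assume *: "\<forall>t n. ?K (n + t) n = kid (n + t) n"
    show "\<forall>m n. ?K m n = kid m n"
    proof (intro allI)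
      fix m n show "?K m n = kid m n" using *[rule_format, where n = n and t = "m - n"] by simp
    qed
  qed blast
  finally show ?thesis .
qed

subsection \<open>Boundedness on \<open>l\<^sub>2\<close>\<close>

lemma infsum_ennreal_eq_SUP:
  "infsum (f :: 'a \<Rightarrow> ennreal) A = (SUP F\<in>{F. finite F \<and> F \<subseteq> A}. sum f F)"
  by (intro nonneg_infsum_complete) auto

lemma sum_le_infsum_ennreal: "finite F \<Longrightarrow> sum (f :: 'a \<Rightarrow> ennreal) F \<le> infsum f UNIV"
  unfolding infsum_ennreal_eq_SUP by (rule SUP_upper) auto

lemma infsum_le_ennreal:
  "(\<And>F. finite F \<Longrightarrow> sum f F \<le> c) \<Longrightarrow> infsum (f :: 'a \<Rightarrow> ennreal) UNIV \<le> c"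
  unfolding infsum_ennreal_eq_SUP by (rule SUP_least) auto

lemma l2_norm_sq_eq_infsum:
  assumes "u \<in> l2_seq"
  shows "l2_norm_sq u = ennreal (\<Sum>\<^sub>\<infinity>k. (norm (u k))\<^sup>2)"
proof -
  have "ennreal (\<Sum>\<^sub>\<infinity>k. (norm (u k))\<^sup>2) =
      (SUP F\<in>{F. finite F \<and> F \<subseteq> UNIV}. ennreal (\<Sum>k\<in>F. (norm (u k))\<^sup>2))"
    using assms by (intro infsum_nonneg_is_SUPREMUM_ennreal) (auto simp: l2_seq_def)
  then show ?thesis
    by (simp add: l2_norm_sq_def infsum_ennreal_eq_SUP sum_ennreal)
qed

lemma l2_seq_iff: "u \<in> l2_seq \<longleftrightarrow> l2_norm_sq u < \<infinity>"
proof
  assume "l2_norm_sq u < \<infinity>"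
  then obtain c where c: "l2_norm_sq u = ennreal c" "c \<ge> 0" by (cases "l2_norm_sq u") auto
  have "(\<Sum>k\<in>F. (norm (u k))\<^sup>2) \<le> c" if "finite F" for F
  proof -
    have "ennreal (\<Sum>k\<in>F. (norm (u k))\<^sup>2) \<le> ennreal c"
      using sum_le_infsum_ennreal[OF that, of "\<lambda>k. ennreal ((norm (u k))\<^sup>2)"] c
      by (simp add: l2_norm_sq_def sum_ennreal)
    then show ?thesis using c by (simp add: ennreal_le_iff)
  qed
  then show "u \<in> l2_seq"
    unfolding l2_seq_def by (auto intro!: nonneg_bdd_above_summable_on bdd_aboveI)
qed (simp add: l2_norm_sq_eq_infsum)

lemma finitely_supported_l2_seq: "finitely_supported u \<Longrightarrow> u \<in> l2_seq"
  unfolding l2_seq_def finitely_supported_def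
  by (auto intro!: finite_nonzero_values_imp_summable_on elim: rev_finite_subset)

definition l2_bounded :: "(int^'d::finite, int^'d, 'c::finite, 'q::finite) kernel \<Rightarrow> bool" where
  "l2_bounded L \<longleftrightarrow> (\<exists>C\<ge>0. \<forall>u :: ('d, 1, 'c) mseq.
     l2_norm_sq (u \<bullet>\<^sub>k L) \<le> ennreal C * l2_norm_sq u)"

lemma l2_bounded_l2_seq:
  fixes u :: "('d::finite, 1, 'c::finite) mseq"
  assumes "l2_bounded L" "u \<in> l2_seq"
  shows "u \<bullet>\<^sub>k L \<in> l2_seq"
proof -
  obtain C where "l2_norm_sq (u \<bullet>\<^sub>k L) \<le> ennreal C * l2_norm_sq u"
    using assms(1) by (auto simp: l2_bounded_def)
  also have "\<dots> < \<infinity>" using assms(2) by (auto simp: l2_seq_iff ennreal_mult_less_top)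
  finally show ?thesis by (simp add: l2_seq_iff)
qed

lemma l2_bounded_kcomp:
  fixes K :: "(int^'d::finite, int^'d, 'c::finite, 'm::finite) kernel"
    and L :: "(int^'d, int^'d, 'm, 'q::finite) kernel"
  assumes "l2_bounded K" "l2_bounded L" "fin_cols K" "fin_cols L"
  shows "l2_bounded (K \<odot> L)"
proof -
  obtain C where C: "C \<ge> 0" "\<And>u :: ('d, 1, 'c) mseq. l2_norm_sq (u \<bullet>\<^sub>k K) \<le> ennreal C * l2_norm_sq u"
    using assms(1) by (auto simp: l2_bounded_def)
  obtain D where D: "D \<ge> 0" "\<And>u :: ('d, 1, 'm) mseq. l2_norm_sq (u \<bullet>\<^sub>k L) \<le> ennreal D * l2_norm_sq u"
    using assms(2) by (auto simp: l2_bounded_def)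
  have "l2_norm_sq (u \<bullet>\<^sub>k (K \<odot> L)) \<le> ennreal (D * C) * l2_norm_sq u" for u :: "('d, 1, 'c) mseq"
  proof -
    have "l2_norm_sq (u \<bullet>\<^sub>k (K \<odot> L)) \<le> ennreal D * l2_norm_sq (u \<bullet>\<^sub>k K)"
      using D(2) by (simp add: kapp_assoc[OF assms(3,4), symmetric])
    also have "\<dots> \<le> ennreal D * (ennreal C * l2_norm_sq u)"
      using C(2) by (rule mult_left_mono) simp
    also have "\<dots> = ennreal (D * C) * l2_norm_sq u"
      using C(1) D(1) by (simp add: ennreal_mult mult.assoc)
    finally show ?thesis .
  qed
  with C(1) D(1) show ?thesis unfolding l2_bounded_def by (intro exI[of _ "D * C"] conjI allI) auto
qed

text \<open>Cauchy-Schwarz on a column costs a factor \<open>N\<close>, and when the squares are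
  summed over all columns each \<open>u m\<close> is counted at most \<open>N\<close> times.\<close>

lemma l2_bounded_sparse:
  fixes L :: "(int^'d::finite, int^'d, 'c::finite, 'q::finite) kernel"
  assumes B: "\<And>m n. norm (L m n) \<le> B"
    and cols: "\<And>n. finite {m. L m n \<noteq> 0}" "\<And>n. card {m. L m n \<noteq> 0} \<le> N"
    and rows: "\<And>m. finite {n. L m n \<noteq> 0}" "\<And>m. card {n. L m n \<noteq> 0} \<le> N"
  shows "l2_bounded L"
proof -
  obtain K where K: "K > 0"
    and norm_mult: "\<And>(x :: complex^'c^1) (y :: complex^'q^'c). norm (x ** y) \<le> norm x * norm y * K"
    using mm.pos_bounded by blast
  have "B \<ge> 0" using B[of 0 0] norm_ge_zero[of "L 0 0"] by linarith
  \<comment> \<open>\<open>B * K\<close> bounds the effect of a single entry, \<open>K\<close> being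
    the constant of the matrix product; the factor \<open>N\<close> is from Cauchy-Schwarz. Double
    counting later adds the second \<open>N\<close>.\<close>
  define D where "D = (B * K)\<^sup>2 * real N"
  have "D \<ge> 0" by (simp add: D_def)
  have pointwise: "(norm ((u \<bullet>\<^sub>k L) n))\<^sup>2 \<le> D * (\<Sum>m | L m n \<noteq> 0. (norm (u m))\<^sup>2)"
    for u :: "('d, 1, 'c) mseq" and n
  proof -
    have "norm ((u \<bullet>\<^sub>k L) n) \<le> (\<Sum>m | L m n \<noteq> 0. norm (u m ** L m n))"
      using cols by (simp add: kapp_eq_sum_support fin_cols_def norm_sum)
    also have "\<dots> \<le> (\<Sum>m | L m n \<noteq> 0. norm (u m) * (B * K))"
    proof (rule sum_mono)
      fix m
      have "norm (u m ** L m n) \<le> norm (u m) * norm (L m n) * K" by (rule norm_mult)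
      also have "\<dots> \<le> norm (u m) * B * K"
        using B K by (intro mult_right_mono mult_left_mono) auto
      finally show "norm (u m ** L m n) \<le> norm (u m) * (B * K)" by (simp add: mult.assoc)
    qed
    finally have "(norm ((u \<bullet>\<^sub>k L) n))\<^sup>2 \<le> (\<Sum>m | L m n \<noteq> 0. norm (u m) * (B * K))\<^sup>2"
      by (rule power_mono) simp
    also have "\<dots> \<le> (\<Sum>m | L m n \<noteq> 0. (norm (u m) * (B * K))\<^sup>2) * card {m. L m n \<noteq> 0}"
      by (rule sum_squared_le_sum_of_squares)
    also have "\<dots> \<le> (\<Sum>m | L m n \<noteq> 0. (norm (u m) * (B * K))\<^sup>2) * N"
      using cols(2) by (intro mult_left_mono sum_nonneg) auto
    also have "\<dots> = D * (\<Sum>m | L m n \<noteq> 0. (norm (u m))\<^sup>2)"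
      by (simp add: D_def power_mult_distrib sum_distrib_left sum_distrib_right mult_ac)
    finally show ?thesis .
  qed
  have "l2_norm_sq (u \<bullet>\<^sub>k L) \<le> ennreal (D * N) * l2_norm_sq u" for u :: "('d, 1, 'c) mseq"
    unfolding l2_norm_sq_def[of "u \<bullet>\<^sub>k L"]
  proof (rule infsum_le_ennreal)
    fix F :: "(int^'d) set" assume F: "finite F"
    define G where "G = (\<Union>n\<in>F. {m. L m n \<noteq> 0})"
    have G: "finite G" using F cols by (simp add: G_def)
    have "(\<Sum>n\<in>F. (norm ((u \<bullet>\<^sub>k L) n))\<^sup>2) \<le> (\<Sum>n\<in>F. D * (\<Sum>m | L m n \<noteq> 0. (norm (u m))\<^sup>2))"
      by (intro sum_mono pointwise)
    also have "\<dots> = D * (\<Sum>n\<in>F. \<Sum>m | m \<in> G \<and> L m n \<noteq> 0. (norm (u m))\<^sup>2)"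
      unfolding sum_distrib_left by (intro sum.cong) (auto simp: G_def)
    also have "(\<Sum>n\<in>F. \<Sum>m | m \<in> G \<and> L m n \<noteq> 0. (norm (u m))\<^sup>2) =
        (\<Sum>m\<in>G. \<Sum>n | n \<in> F \<and> L m n \<noteq> 0. (norm (u m))\<^sup>2)"
      using F G by (rule sum.swap_restrict)
    also have "\<dots> \<le> (\<Sum>m\<in>G. N * (norm (u m))\<^sup>2)"
    proof (rule sum_mono)
      fix m
      have "card {n \<in> F. L m n \<noteq> 0} \<le> card {n. L m n \<noteq> 0}"
        using rows(1) by (intro card_mono) auto
      then have "card {n \<in> F. L m n \<noteq> 0} \<le> N" using rows(2)[of m] by linarith
      then show "(\<Sum>n | n \<in> F \<and> L m n \<noteq> 0. (norm (u m))\<^sup>2) \<le> N * (norm (u m))\<^sup>2"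
        by (simp add: mult_right_mono)
    qed
    also have "\<dots> = N * (\<Sum>m\<in>G. (norm (u m))\<^sup>2)" by (simp add: sum_distrib_left)
    finally have "(\<Sum>n\<in>F. (norm ((u \<bullet>\<^sub>k L) n))\<^sup>2) \<le> D * (N * (\<Sum>m\<in>G. (norm (u m))\<^sup>2))"
      using \<open>D \<ge> 0\<close> by (simp add: mult_left_mono)
    then have "(\<Sum>n\<in>F. ennreal ((norm ((u \<bullet>\<^sub>k L) n))\<^sup>2)) \<le> ennreal (D * N * (\<Sum>m\<in>G. (norm (u m))\<^sup>2))"
      by (simp add: sum_ennreal mult.assoc ennreal_leI)
    also have "\<dots> = ennreal (D * N) * (\<Sum>m\<in>G. ennreal ((norm (u m))\<^sup>2))"
      using \<open>D \<ge> 0\<close> by (simp add: ennreal_mult sum_nonneg sum_ennreal)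
    also have "\<dots> \<le> ennreal (D * N) * l2_norm_sq u"
      unfolding l2_norm_sq_def using G by (intro mult_left_mono sum_le_infsum_ennreal) auto
    finally show "(\<Sum>n\<in>F. ennreal ((norm ((u \<bullet>\<^sub>k L) n))\<^sup>2)) \<le> ennreal (D * N) * l2_norm_sq u" .
  qed
  with \<open>D \<ge> 0\<close> show ?thesis unfolding l2_bounded_def by (intro exI[of _ "D * N"]) auto
qed

lemma norm_conj_transpose: "norm (conj_transpose (A :: complex^'q::finite^'p::finite)) = norm A"
proof -
  have "(norm (conj_transpose A))\<^sup>2 = (norm A)\<^sup>2"
    by (simp add: norm_vec_def L2_set_def sum_nonneg) (rule sum.swap)
  then show ?thesis by simp
qed

lemma l2_bounded_filter_kernel:
  assumes a: "finitely_supported a" and A: "det A \<noteq> 0"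
  shows "l2_bounded (filter_kernel a A)" "l2_bounded (kadj (filter_kernel a A))"
proof -
  define B where "B = (real_of_int \<bar>det A\<bar> powr (1 / 2)) * (\<Sum>k | a k \<noteq> 0. norm (a k))"
  have "norm (a k) \<le> (\<Sum>k | a k \<noteq> 0. norm (a k))" for k
    using a unfolding finitely_supported_def
    by (cases "a k = 0") (auto intro: member_le_sum sum_nonneg)
  then have B: "norm (filter_kernel a A m n) \<le> B" for m n
    by (auto simp: filter_kernel_def B_def intro!: mult_left_mono)
  show "l2_bounded (filter_kernel a A)"
    by (rule l2_bounded_sparse[of _ B "card {k. a k \<noteq> 0}"])
      (simp_all add: B filter_kernel_rows[OF a] filter_kernel_cols[OF a A])
  show "l2_bounded (kadj (filter_kernel a A))"
    by (rule l2_bounded_sparse[of _ B "card {k. a k \<noteq> 0}"])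
      (simp_all add: kadj_def norm_conj_transpose B filter_kernel_rows[OF a] filter_kernel_cols[OF a A])
qed

text \<open>The remainder after a finite set \<open>F\<close> is the kernel applied to
  \<open>w\<close> restricted to the complement of \<open>F\<close>. Boundedness reduces the claim
  to the convergence of the tails of the squared norm of \<open>w\<close>.\<close>

lemma l2_has_sum_kapp:
  fixes w :: "('d::finite, 1, 'c::finite) mseq" and L :: "(int^'d, int^'d, 'c, 'q::finite) kernel"
  assumes L: "l2_bounded L" "fin_cols L" and w: "w \<in> l2_seq"
  shows "l2_has_sum (\<lambda>k n. w k ** L k n) (w \<bullet>\<^sub>k L)"
proof -
  obtain C where C: "\<And>u :: ('d, 1, 'c) mseq. l2_norm_sq (u \<bullet>\<^sub>k L) \<le> ennreal C * l2_norm_sq u"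
    using L(1) by (auto simp: l2_bounded_def)
  define S where "S = (\<Sum>\<^sub>\<infinity>k. (norm (w k))\<^sup>2)"
  have summable: "(\<lambda>k. (norm (w k))\<^sup>2) summable_on UNIV" using w by (simp add: l2_seq_def)
  have bound: "l2_norm_sq (\<lambda>n. (w \<bullet>\<^sub>k L) n - (\<Sum>k\<in>F. w k ** L k n)) \<le> ennreal C * ennreal (S - (\<Sum>k\<in>F. (norm (w k))\<^sup>2))"
    if F: "finite F" for F
  proof -
    define w1 where "w1 k = (if k \<in> F then w k else 0)" for k
    define w2 where "w2 k = (if k \<in> F then 0 else w k)" for k
    have "(\<lambda>k. w1 k + w2 k) = w" by (auto simp: w1_def w2_def)
    then have "w \<bullet>\<^sub>k L = (\<lambda>n. (w1 \<bullet>\<^sub>k L) n + (w2 \<bullet>\<^sub>k L) n)"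
      using kapp_add_left[OF L(2), of w1 w2] by simp
    moreover have "(w1 \<bullet>\<^sub>k L) n = (\<Sum>k\<in>F. w k ** L k n)" for n
      using F by (subst kapp_eq_sum_left[of F]) (auto simp: w1_def)
    ultimately have eq: "(\<lambda>n. (w \<bullet>\<^sub>k L) n - (\<Sum>k\<in>F. w k ** L k n)) = w2 \<bullet>\<^sub>k L" by auto
    have s1: "(\<lambda>k. (norm (w1 k))\<^sup>2) summable_on UNIV"
      using F by (intro finite_nonzero_values_imp_summable_on) (auto simp: w1_def intro: finite_subset)
    have "(\<lambda>k. (norm (w k))\<^sup>2 - (norm (w1 k))\<^sup>2) summable_on UNIV"
      using summable_on_add[OF summable summable_on_uminus[THEN iffD2, OF s1]] by simp
    then have s2: "(\<lambda>k. (norm (w2 k))\<^sup>2) summable_on UNIV"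
      by (rule summable_on_cong[THEN iffD1, rotated]) (auto simp: w1_def w2_def)
    have "S = (\<Sum>\<^sub>\<infinity>k. (norm (w1 k))\<^sup>2 + (norm (w2 k))\<^sup>2)"
      unfolding S_def by (intro infsum_cong) (auto simp: w1_def w2_def)
    also have "\<dots> = (\<Sum>\<^sub>\<infinity>k. (norm (w1 k))\<^sup>2) + (\<Sum>\<^sub>\<infinity>k. (norm (w2 k))\<^sup>2)"
      using s1 s2 by (rule infsum_add)
    also have "(\<Sum>\<^sub>\<infinity>k. (norm (w1 k))\<^sup>2) = (\<Sum>k\<in>F. (norm (w k))\<^sup>2)"
      using F by (subst infsum_finite_support[of F]) (auto simp: w1_def)
    finally have "l2_norm_sq w2 = ennreal (S - (\<Sum>k\<in>F. (norm (w k))\<^sup>2))"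
      using s2 by (simp add: l2_norm_sq_eq_infsum l2_seq_def)
    then show ?thesis unfolding eq using C[of w2] by simp
  qed
  have "((\<lambda>F. S - (\<Sum>k\<in>F. (norm (w k))\<^sup>2)) \<longlongrightarrow> S - S) (finite_subsets_at_top UNIV)"
    unfolding S_def using summable by (intro tendsto_intros infsum_tendsto)
  then have "((\<lambda>F. ennreal C * ennreal (S - (\<Sum>k\<in>F. (norm (w k))\<^sup>2))) \<longlongrightarrow> ennreal C * ennreal (S - S))
      (finite_subsets_at_top UNIV)"
    by (intro ennreal_tendsto_cmult tendsto_ennrealI) auto
  then have "((\<lambda>F. ennreal C * ennreal (S - (\<Sum>k\<in>F. (norm (w k))\<^sup>2))) \<longlongrightarrow> 0) (finite_subsets_at_top UNIV)"
    by simp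
  then have "((\<lambda>F. l2_norm_sq (\<lambda>n. (w \<bullet>\<^sub>k L) n - (\<Sum>k\<in>F. w k ** L k n))) \<longlongrightarrow> 0) (finite_subsets_at_top UNIV)"
    by (rule tendsto_sandwich[rotated 3, where f = "\<lambda>_. 0"])
      (auto intro!: eventually_finite_subsets_at_top_weakI bound)
  then show ?thesis
    using l2_bounded_l2_seq[OF L(1) w] by (simp add: l2_has_sum_def)
qed

text \<open>A single value is dominated by the l2 norm. This pins down the sums \<open>g0\<close>
  and \<open>g\<close> that \<open>das_expansion\<close> leaves existentially quantified.\<close>

lemma l2_has_sum_pointwise:
  assumes "l2_has_sum f g"
  shows "((\<lambda>k. f k n) has_sum g n) UNIV"
proof -
  let ?e = "\<lambda>F. g n - (\<Sum>k\<in>F. f k n)"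
  have lim: "((\<lambda>F. l2_norm_sq (\<lambda>n. g n - (\<Sum>k\<in>F. f k n))) \<longlongrightarrow> 0) (finite_subsets_at_top UNIV)"
    using assms by (simp add: l2_has_sum_def)
  have "ennreal ((norm (?e F))\<^sup>2) \<le> l2_norm_sq (\<lambda>n. g n - (\<Sum>k\<in>F. f k n))" for F
    unfolding l2_norm_sq_def
    using sum_le_infsum_ennreal[of "{n}" "\<lambda>n. ennreal ((norm (g n - (\<Sum>k\<in>F. f k n)))\<^sup>2)"] by simp
  then have "((\<lambda>F. ennreal ((norm (?e F))\<^sup>2)) \<longlongrightarrow> 0) (finite_subsets_at_top UNIV)"
    by (intro tendsto_sandwich[OF _ _ tendsto_const lim]) auto
  then have "((\<lambda>F. (norm (?e F))\<^sup>2) \<longlongrightarrow> 0) (finite_subsets_at_top UNIV)"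
    using tendsto_ennrealD[of "\<lambda>F. (norm (?e F))\<^sup>2" 0] by simp
  from tendsto_real_sqrt[OF this] have "(?e \<longlongrightarrow> 0) (finite_subsets_at_top UNIV)"
    by (simp add: tendsto_norm_zero_iff)
  then have "((\<lambda>F. g n - ?e F) \<longlongrightarrow> g n - 0) (finite_subsets_at_top UNIV)"
    by (intro tendsto_intros)
  then show ?thesis by (simp add: has_sum_def)
qed

lemma l2_has_sum_kapp_unique:
  "l2_has_sum (\<lambda>k n. w k ** L k n) g \<Longrightarrow> g n = (w \<bullet>\<^sub>k L) n"
  by (drule l2_has_sum_pointwise[of _ _ n]) (simp add: kapp_def infsumI)

subsection \<open>Multilevel transforms\<close>

text \<open>Testing on unit row vectors placed at one lattice point extracts each matrix
  entry.\<close>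

lemma kernel_eqI:
  fixes L L' :: "(int^'d::finite, 'n, 'c::finite, 'q::finite) kernel"
  assumes "\<And>u :: ('d, 1, 'c) mseq. finitely_supported u \<Longrightarrow> u \<bullet>\<^sub>k L = u \<bullet>\<^sub>k L'"
  shows "L = L'"
proof (intro ext, unfold vec_eq_iff, intro allI)
  fix i n a c
  define u :: "('d, 1, 'c) mseq" where "u m = (if m = i then \<chi> _ a'. of_bool (a' = a) else 0)" for m
  have entry: "(u \<bullet>\<^sub>k X) n $ 1 $ c = X i n $ a $ c" for X :: "(int^'d, 'n, 'c, 'q) kernel"
    by (subst kapp_eq_sum_left[of "{i}"]) (auto simp: u_def matrix_matrix_mult_def)
  have "finitely_supported u"
    by (auto simp: finitely_supported_def u_def intro: finite_subset[of _ "{i}"])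
  then show "L i n $ a $ c = L' i n $ a $ c"
    using assms[of u] entry by metis
qed

lemma fin_cols_kcascade: "fin_cols K \<Longrightarrow> fin_cols K0 \<Longrightarrow> fin_cols (kcascade K K0 n)"
  by (induction n) (simp_all add: fin_cols_kcomp)

lemma fin_cols_kadj_kcascade:
  "fin_cols (kadj K) \<Longrightarrow> fin_cols (kadj K0) \<Longrightarrow> fin_cols K0 \<Longrightarrow> fin_cols (kadj (kcascade K K0 n))"
  by (induction n) (simp_all add: fin_cols_kcomp kadj_kcomp)

lemma l2_bounded_kcascade:
  "l2_bounded K \<Longrightarrow> l2_bounded K0 \<Longrightarrow> fin_cols K \<Longrightarrow> fin_cols K0 \<Longrightarrow> l2_bounded (kcascade K K0 n)"
  by (induction n) (simp_all add: l2_bounded_kcomp fin_cols_kcascade)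

lemma kcomp_kcascade:
  assumes "fin_cols L" "fin_cols K0"
  shows "K \<odot> kcascade L K0 n = kcascade (K \<odot> L) K0 n"
  by (induction n) (simp_all add: assms kcomp_assoc[symmetric] fin_cols_kcascade)

lemma kcascade_Suc_left: "fin_cols K0 \<Longrightarrow> kcascade kid K0 (Suc n) = kcascade K0 K0 n"
  by (induction n) simp_all

text \<open>In the product the rightmost \<open>Kt0\<close> meets the adjoint of the rightmost
  \<open>K0\<close>, and this pair cancels. Two forms are needed, according to the side on which
  factors are left over.\<close>

lemma kcascade_reduce:
  fixes Kt0 :: "('j, 'j, 'r::finite, 'r) kernel"
  assumes inv: "Kt0 \<odot> kadj K0 = kid"
    and fin: "fin_cols Kt0" "fin_cols K0" "fin_cols (kadj K0)" "fin_cols (kadj B)"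
  shows "kcascade A Kt0 (m + n) \<odot> kadj (kcascade B K0 n) = kcascade A Kt0 m \<odot> kadj B"
    and "kcascade A Kt0 n \<odot> kadj (kcascade B K0 (m + n)) = A \<odot> kadj (kcascade B K0 m)"
proof -
  have finB: "fin_cols (kadj (kcascade B K0 n))" for n
    using fin by (intro fin_cols_kadj_kcascade)
  have step: "(X \<odot> Kt0) \<odot> kadj (kcascade B K0 n \<odot> K0) = X \<odot> kadj (kcascade B K0 n)"
    for X :: "('k, 'j, 'p::finite, 'r) kernel" and n
  proof -
    have "(X \<odot> Kt0) \<odot> kadj (kcascade B K0 n \<odot> K0) = X \<odot> ((Kt0 \<odot> kadj K0) \<odot> kadj (kcascade B K0 n))"
      using fin finB by (simp add: kadj_kcomp kcomp_assoc fin_cols_kcomp)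
    then show ?thesis by (simp add: inv)
  qed
  show "kcascade A Kt0 (m + n) \<odot> kadj (kcascade B K0 n) = kcascade A Kt0 m \<odot> kadj B"
    by (induction n) (simp_all add: step)
  show "kcascade A Kt0 n \<odot> kadj (kcascade B K0 (m + n)) = A \<odot> kadj (kcascade B K0 m)"
    by (induction n) (simp_all add: step)
qed

lemma kcomp_0_left [simp]: "(\<lambda>_ _. 0) \<odot> L = (\<lambda>_ _. 0)"
  by (simp add: kcomp_def)

lemma kcomp_0_right [simp]: "K \<odot> (\<lambda>_ _. 0) = (\<lambda>_ _. 0)"
  by (simp add: kcomp_def)

text \<open>A single bank, so that the same results serve the filters \<open>b\<close> and their
  duals; its low-pass and high-pass kernels are the block rows of one infinite matrix.\<close>

locale filter_bank =
  fixes M0 :: "int^'d::finite^'d" and M :: "'s::finite \<Rightarrow> int^'d^'d"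
    and b0 :: "('d, 'r::finite, 'r) mseq" and b :: "'s \<Rightarrow> ('d, 1, 'r) mseq"
  assumes det_M0: "det M0 \<noteq> 0" and det_M: "det (M l) \<noteq> 0"
    and finitely_supported_b0: "finitely_supported b0"
    and finitely_supported_b: "finitely_supported (b l)"
begin

definition low :: "(int^'d, int^'d, 'r, 'r) kernel" where
  "low = filter_kernel b0 M0"

definition high :: "'s \<Rightarrow> (int^'d, int^'d, 1, 'r) kernel" where
  "high l = filter_kernel (b l) (M l)"

lemma fin_cols_low_high [simp]:
  "fin_cols low" "fin_cols (high l)" "fin_cols (kadj low)" "fin_cols (kadj (high l))"
  by (simp_all add: low_def high_def fin_cols_filter_kernel det_M0 det_M
      finitely_supported_b0 finitely_supported_b)

lemma l2_bounded_low_high [simp]: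
  "l2_bounded low" "l2_bounded (high l)" "l2_bounded (kadj low)" "l2_bounded (kadj (high l))"
  by (simp_all add: low_def high_def l2_bounded_filter_kernel det_M0 det_M
      finitely_supported_b0 finitely_supported_b)

lemma transition_op_low_high:
  "transition_op b0 M0 u = u \<bullet>\<^sub>k kadj low" "transition_op (b l) (M l) u = u \<bullet>\<^sub>k kadj (high l)"
  by (simp_all add: transition_op_eq low_def high_def)

lemma subdivision_op_low_high:
  "subdivision_op b0 M0 u = u \<bullet>\<^sub>k low" "subdivision_op (b l) (M l) w = w \<bullet>\<^sub>k high l"
  by (simp_all add: subdivision_op_eq low_def high_def)

lemma das_low_eq: "j \<ge> 1 \<Longrightarrow> das_low M0 b0 j = kcascade low low (j - 1)"
  unfolding das_low_def[abs_def] low_def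
  by (simp add: das_elem_eq det_M0 finitely_supported_b0)

lemma das_high_eq: "j \<ge> 1 \<Longrightarrow> das_high M0 M b0 b (l, j, k) = kcascade (high l) low (j - 1) k"
  by (simp add: das_high_def low_def high_def das_elem_eq det_M0 finitely_supported_b0 finitely_supported_b)

lemma dwt_low_shift: "dwt_low M0 b0 (dwt_low M0 b0 v 1) n = dwt_low M0 b0 v (Suc n)"
  by (induction n) simp_all

text \<open>Taking adjoints reverses the cascade: the low-pass transitions act before the adjoint of
  \<open>K\<close>. Hence inner products with the affine system are outputs of the multilevel
  transform.\<close>

lemma kapp_kadj_kcascade:
  assumes "fin_cols (kadj K)"
  shows "v \<bullet>\<^sub>k kadj (kcascade K low n) = dwt_low M0 b0 v n \<bullet>\<^sub>k kadj K"
proof (induction n arbitrary: v)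
  case (Suc n)
  have "v \<bullet>\<^sub>k kadj (kcascade K low (Suc n)) = v \<bullet>\<^sub>k kadj low \<bullet>\<^sub>k kadj (kcascade K low n)"
    using assms by (simp add: kadj_kcomp kapp_assoc fin_cols_kadj_kcascade)
  also have "\<dots> = dwt_low M0 b0 (dwt_low M0 b0 v 1) n \<bullet>\<^sub>k kadj K"
    by (simp add: Suc.IH transition_op_low_high)
  finally show ?case by (simp only: dwt_low_shift)
qed simp

lemma inner_seq_das_low: "j \<ge> 1 \<Longrightarrow> inner_seq v (das_low M0 b0 j k) = dwt_low M0 b0 v j k"
  by (cases j) (simp_all add: das_low_eq inner_seq_eq kapp_kadj_kcascade transition_op_low_high)

lemma inner_seq_das_high:
  "j \<ge> 1 \<Longrightarrow> inner_seq v (das_high M0 M b0 b (l, j, k)) = dwt_high M0 M b0 b v l j k"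
  by (simp add: das_high_eq inner_seq_eq kapp_kadj_kcascade dwt_high_def transition_op_low_high)

lemma das_coeff_norm_sq_eq: "J \<ge> 1 \<Longrightarrow> das_coeff_norm_sq M0 M b0 b J v = dwt_norm_sq M0 M b0 b J v"
  by (simp add: das_coeff_norm_sq_def dwt_norm_sq_def l2_norm_sq_def inner_seq_das_low
      inner_seq_das_high add.commute)

lemma dwt_low_l2_seq: "v \<in> l2_seq \<Longrightarrow> dwt_low M0 b0 v j \<in> l2_seq"
  by (induction j) (simp_all add: transition_op_low_high l2_bounded_l2_seq)

lemma dwt_high_l2_seq: "v \<in> l2_seq \<Longrightarrow> dwt_high M0 M b0 b v l j \<in> l2_seq"
  by (simp add: dwt_high_def transition_op_low_high l2_bounded_l2_seq dwt_low_l2_seq)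

lemma kernel_row_l2_seq: "fin_cols (kadj K) \<Longrightarrow> K k \<in> l2_seq" for K :: "('k, int^'d, 'p::finite, 'q::finite) kernel"
  by (intro finitely_supported_l2_seq) (auto simp: finitely_supported_def fin_cols_def kadj_def)

lemma das_l2_seq:
  "j \<ge> 1 \<Longrightarrow> das_low M0 b0 j k \<in> l2_seq" "j \<ge> 1 \<Longrightarrow> das_high M0 M b0 b (l, j, k) \<in> l2_seq"
  by (simp_all add: das_low_eq das_high_eq kernel_row_l2_seq fin_cols_kadj_kcascade)

end

section \<open>An analysis bank \<open>an\<close> and a synthesis bank \<open>sy\<close> over the
  same dilations\<close>

locale filter_bank_pair =
  an: filter_bank M0 M b0 b + sy: filter_bank M0 M bt0 bt
  for M0 :: "int^'d::finite^'d" and M :: "'s::finite \<Rightarrow> int^'d^'d"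
    and b0 bt0 :: "('d, 'r::finite, 'r) mseq" and b bt :: "'s \<Rightarrow> ('d, 1, 'r) mseq"
begin

definition perfect_reconstruction :: bool where
  "perfect_reconstruction \<longleftrightarrow>
    (\<lambda>m n. (kadj an.low \<odot> sy.low) m n + (\<Sum>l\<in>UNIV. (kadj (an.high l) \<odot> sy.high l) m n)) = kid"

text \<open>The blocks of the stacked synthesis matrix times the adjoint of the stacked analysis
  matrix, compared with those of the identity; \<open>perfect_reconstruction\<close> is the product
  in the opposite order.\<close>

definition biorthogonal :: bool where
  "biorthogonal \<longleftrightarrow> sy.low \<odot> kadj an.low = kid \<and>
     (\<forall>l. sy.low \<odot> kadj (an.high l) = (\<lambda>_ _. 0)) \<and> (\<forall>l. sy.high l \<odot> kadj an.low = (\<lambda>_ _. 0)) \<and>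
     (\<forall>l l'. sy.high l' \<odot> kadj (an.high l) = (if l = l' then kid else (\<lambda>_ _. 0)))"

lemma dual_framelet_iff: "dual_framelet_filter_bank M0 M b0 b bt0 bt \<longleftrightarrow> perfect_reconstruction"
  unfolding perfect_reconstruction_def an.low_def an.high_def sy.low_def sy.high_def fun_eq_iff
  by (rule dual_framelet_filter_bank_iff)
    (simp_all add: an.det_M0 an.det_M an.finitely_supported_b0 an.finitely_supported_b
      sy.finitely_supported_b0 sy.finitely_supported_b)

lemma synthesis_analysis:
  "(\<lambda>n. (v \<bullet>\<^sub>k kadj an.low \<bullet>\<^sub>k sy.low) n + (\<Sum>l\<in>UNIV. (v \<bullet>\<^sub>k kadj (an.high l) \<bullet>\<^sub>k sy.high l) n)) =
    v \<bullet>\<^sub>k (\<lambda>m n. (kadj an.low \<odot> sy.low) m n + (\<Sum>l\<in>UNIV. (kadj (an.high l) \<odot> sy.high l) m n))"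
proof -
  have fin: "fin_cols (kadj an.low \<odot> sy.low)" "fin_cols (kadj (an.high l) \<odot> sy.high l)" for l
    by (simp_all add: fin_cols_kcomp)
  \<comment> \<open>The column of the sum is contained in a finite union of finite columns; this is
    needed to distribute the application over the low-pass and high-pass parts.\<close>
  have "fin_cols (\<lambda>m n. \<Sum>l\<in>UNIV. (kadj (an.high l) \<odot> sy.high l) m n)"
    unfolding fin_cols_def
  proof
    fix n
    have "{m. (\<Sum>l\<in>UNIV. (kadj (an.high l) \<odot> sy.high l) m n) \<noteq> 0} \<subseteq>
        (\<Union>l. {m. (kadj (an.high l) \<odot> sy.high l) m n \<noteq> 0})"
      by (auto intro: sum.neutral)
    then show "finite {m. (\<Sum>l\<in>UNIV. (kadj (an.high l) \<odot> sy.high l) m n) \<noteq> 0}"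
      using fin(2) by (auto simp: fin_cols_def intro: finite_subset)
  qed
  then show ?thesis
    by (simp add: kapp_add_right kapp_sum_right fin kapp_assoc)
qed

lemma analysis_op_components:
  "(\<lambda>k. \<chi> i c. analysis_op M0 M b0 b v k $ i $ Inr c) = v \<bullet>\<^sub>k kadj an.low"
  "(\<lambda>k. \<chi> i (c::1). analysis_op M0 M b0 b v k $ i $ Inl l) = v \<bullet>\<^sub>k kadj (an.high l)"
  by (simp_all add: analysis_op_def an.transition_op_low_high vec_eq_iff fun_eq_iff forall_1)

lemma analysis_eq_iff:
  "analysis_op M0 M b0 b v = w \<longleftrightarrow>
    v \<bullet>\<^sub>k kadj an.low = (\<lambda>k. \<chi> i c. w k $ i $ Inr c) \<and>
    (\<forall>l. v \<bullet>\<^sub>k kadj (an.high l) = (\<lambda>k. \<chi> i (c::1). w k $ i $ Inl l))"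
proof
  assume "v \<bullet>\<^sub>k kadj an.low = (\<lambda>k. \<chi> i c. w k $ i $ Inr c) \<and>
    (\<forall>l. v \<bullet>\<^sub>k kadj (an.high l) = (\<lambda>k. \<chi> i (c::1). w k $ i $ Inl l))"
  then show "analysis_op M0 M b0 b v = w"
    by (auto simp: analysis_op_def an.transition_op_low_high vec_eq_iff fun_eq_iff split: sum.split)
next
  assume eq: "analysis_op M0 M b0 b v = w"
  show "v \<bullet>\<^sub>k kadj an.low = (\<lambda>k. \<chi> i c. w k $ i $ Inr c) \<and>
    (\<forall>l. v \<bullet>\<^sub>k kadj (an.high l) = (\<lambda>k. \<chi> i (c::1). w k $ i $ Inl l))"
    unfolding eq[symmetric] analysis_op_components by simp
qed

lemma synthesis_op_eq:
  "synthesis_op M0 M bt0 bt w = (\<lambda>n. ((\<lambda>k. \<chi> i c. w k $ i $ Inr c) \<bullet>\<^sub>k sy.low) n +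
     (\<Sum>l\<in>UNIV. ((\<lambda>k. \<chi> i (c::1). w k $ i $ Inl l) \<bullet>\<^sub>k sy.high l) n))"
  by (simp add: synthesis_op_def sy.subdivision_op_low_high)

lemma synthesis_analysis_id:
  assumes perfect_reconstruction
  shows "synthesis_op M0 M bt0 bt (analysis_op M0 M b0 b v) = v"
  using assms synthesis_analysis[of v]
  by (simp add: synthesis_op_eq analysis_op_components perfect_reconstruction_def)

lemma kapp_synthesis:
  assumes "fin_cols L"
  shows "(\<lambda>n. (w0 \<bullet>\<^sub>k sy.low) n + (\<Sum>l\<in>UNIV. (w l \<bullet>\<^sub>k sy.high l) n)) \<bullet>\<^sub>k L =
    (\<lambda>n. (w0 \<bullet>\<^sub>k (sy.low \<odot> L)) n + (\<Sum>l\<in>UNIV. (w l \<bullet>\<^sub>k (sy.high l \<odot> L)) n))"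
  using assms by (simp add: kapp_add_left kapp_sum_left kapp_assoc)

text \<open>An input with one nonzero channel isolates one block row of the product, and the output
  channels separate its blocks.\<close>

lemma analysis_synthesis_id_iff:
  "(\<forall>w. analysis_op M0 M b0 b (synthesis_op M0 M bt0 bt w) = w) \<longleftrightarrow> biorthogonal"
proof
  assume id: "\<forall>w. analysis_op M0 M b0 b (synthesis_op M0 M bt0 bt w) = w"
  have *: "(\<lambda>n. (w0 \<bullet>\<^sub>k (sy.low \<odot> kadj an.low)) n + (\<Sum>l\<in>UNIV. (w l \<bullet>\<^sub>k (sy.high l \<odot> kadj an.low)) n)) = w0"
    "(\<lambda>n. (w0 \<bullet>\<^sub>k (sy.low \<odot> kadj (an.high l'))) n + (\<Sum>l\<in>UNIV. (w l \<bullet>\<^sub>k (sy.high l \<odot> kadj (an.high l'))) n)) = w l'"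
    for w0 :: "('d, 1, 'r) mseq" and w :: "'s \<Rightarrow> ('d, 1, 1) mseq" and l'
  proof -
    \<comment> \<open>Packs freely chosen channels into one sequence over the sum type, so that each
      channel can be prescribed separately.\<close>
    define ww :: "('d, 1, 's + 'r) mseq"
      where "ww = (\<lambda>k. \<chi> i c. case c of Inl l \<Rightarrow> w l k $ i $ 1 | Inr c' \<Rightarrow> w0 k $ i $ c')"
    have ww: "(\<lambda>k. \<chi> i c. ww k $ i $ Inr c) = w0" "(\<lambda>k. \<chi> i (c::1). ww k $ i $ Inl l) = w l" for l
      by (simp_all add: ww_def vec_eq_iff fun_eq_iff forall_1)
    show "(\<lambda>n. (w0 \<bullet>\<^sub>k (sy.low \<odot> kadj an.low)) n + (\<Sum>l\<in>UNIV. (w l \<bullet>\<^sub>k (sy.high l \<odot> kadj an.low)) n)) = w0"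
      "(\<lambda>n. (w0 \<bullet>\<^sub>k (sy.low \<odot> kadj (an.high l'))) n + (\<Sum>l\<in>UNIV. (w l \<bullet>\<^sub>k (sy.high l \<odot> kadj (an.high l'))) n)) = w l'"
      using id[rule_format, of ww] unfolding analysis_eq_iff synthesis_op_eq ww
      by (simp_all add: kapp_synthesis)
  qed
  show biorthogonal
    unfolding biorthogonal_def
  proof (intro conjI allI)
    show "sy.low \<odot> kadj an.low = kid"
      using *(1)[of _ "\<lambda>_ _. 0"] by (intro kernel_eqI) simp
    show "sy.low \<odot> kadj (an.high l) = (\<lambda>_ _. 0)" for l
      using *(2)[of _ l "\<lambda>_ _. 0"] by (intro kernel_eqI) simp
    have single: "(\<lambda>n. \<Sum>l\<in>UNIV. ((if l = l' then u else (\<lambda>_. 0)) \<bullet>\<^sub>k X l) n) = u \<bullet>\<^sub>k X l'"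
      for l' and u :: "('d, 1, 1) mseq" and X :: "'s \<Rightarrow> (int^'d, int^'d, 1, 'q::finite) kernel"
    proof
      fix n
      have "(\<Sum>l\<in>UNIV. ((if l = l' then u else (\<lambda>_. 0)) \<bullet>\<^sub>k X l) n) = (\<Sum>l\<in>UNIV. if l = l' then (u \<bullet>\<^sub>k X l) n else 0)"
        by (intro sum.cong) auto
      then show "(\<Sum>l\<in>UNIV. ((if l = l' then u else (\<lambda>_. 0)) \<bullet>\<^sub>k X l) n) = (u \<bullet>\<^sub>k X l') n" by simp
    qed
    show "sy.high l' \<odot> kadj an.low = (\<lambda>_ _. 0)" for l'
    proof (rule kernel_eqI)
      fix u :: "('d, 1, 1) mseq"
      show "u \<bullet>\<^sub>k (sy.high l' \<odot> kadj an.low) = u \<bullet>\<^sub>k (\<lambda>_ _. 0)"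
        using *(1)[of "\<lambda>_. 0" "\<lambda>l. if l = l' then u else (\<lambda>_. 0)"] by (simp add: single)
    qed
    show "sy.high l' \<odot> kadj (an.high l) = (if l = l' then kid else (\<lambda>_ _. 0))" for l l'
    proof (rule kernel_eqI)
      fix u :: "('d, 1, 1) mseq"
      show "u \<bullet>\<^sub>k (sy.high l' \<odot> kadj (an.high l)) = u \<bullet>\<^sub>k (if l = l' then kid else (\<lambda>_ _. 0))"
        using *(2)[of "\<lambda>_. 0" l "\<lambda>l. if l = l' then u else (\<lambda>_. 0)"] by (simp add: single)
    qed
  qed
next
  assume biorthogonal
  then show "\<forall>w. analysis_op M0 M b0 b (synthesis_op M0 M bt0 bt w) = w"
    unfolding analysis_eq_iff synthesis_op_eq
    by (simp add: kapp_synthesis biorthogonal_def if_distrib[where f = "\<lambda>K. (_ \<bullet>\<^sub>k K) _"] cong: if_cong)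
qed

text \<open>Write S for synthesis and A for analysis, with S A the identity. If A is surjective,
  every w is A v, and A S A v = A v. If S is injective, S A S w = S w gives A S w = w. So each
  alternative amounts to A S being the identity.\<close>

lemma biorthogonal_wavelet_iff:
  "biorthogonal_wavelet_filter_bank M0 M b0 b bt0 bt \<longleftrightarrow> perfect_reconstruction \<and> biorthogonal"
proof -
  let ?A = "analysis_op M0 M b0 b" and ?S = "synthesis_op M0 M bt0 bt"
  have "surj ?A \<or> inj ?S \<or> ?S \<circ> ?A = id \<and> ?A \<circ> ?S = id \<longleftrightarrow> (\<forall>w. ?A (?S w) = w)"
    if "\<And>v. ?S (?A v) = v"
  proof
    assume "surj ?A \<or> inj ?S \<or> ?S \<circ> ?A = id \<and> ?A \<circ> ?S = id"
    then show "\<forall>w. ?A (?S w) = w"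
    proof (elim disjE conjE)
      assume "surj ?A"
      show ?thesis
      proof
        fix w
        obtain v where "w = ?A v" using \<open>surj ?A\<close> by (rule surjE)
        then show "?A (?S w) = w" by (simp only: that)
      qed
    next
      assume "inj ?S"
      then show ?thesis using that by (blast dest: injD)
    qed (simp add: fun_eq_iff)
  next
    assume "\<forall>w. ?A (?S w) = w"
    with that have "?S \<circ> ?A = id \<and> ?A \<circ> ?S = id" by (simp add: fun_eq_iff)
    then show "surj ?A \<or> inj ?S \<or> ?S \<circ> ?A = id \<and> ?A \<circ> ?S = id" by (intro disjI2)
  qed
  then show ?thesis
    unfolding biorthogonal_wavelet_filter_bank_def dual_framelet_iff analysis_synthesis_id_iff[symmetric]
    by (intro conj_cong refl) (simp only: synthesis_analysis_id)
qed

section \<open>From one level to all levels\<close>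

lemma dwt_low_decompose:
  assumes perfect_reconstruction
  shows "dwt_low M0 b0 v n = (\<lambda>x. (dwt_low M0 b0 v (Suc n) \<bullet>\<^sub>k sy.low) x +
    (\<Sum>l\<in>UNIV. (dwt_high M0 M b0 b v l (Suc n) \<bullet>\<^sub>k sy.high l) x))"
  using assms synthesis_analysis[of "dwt_low M0 b0 v n"]
  by (simp add: dwt_high_def an.transition_op_low_high perfect_reconstruction_def)

text \<open>The induction splits the coarsest low-pass part once more and carries the pieces back
  through the \<open>J\<close> synthesis factors. Using powers that start from \<open>kid\<close>
  permits the base case \<open>J = 0\<close>.\<close>

lemma multilevel_reconstruction:
  assumes perfect_reconstruction
  shows "v = (\<lambda>x. (dwt_low M0 b0 v J \<bullet>\<^sub>k kcascade kid sy.low J) x +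
    (\<Sum>j=1..J. \<Sum>l\<in>UNIV. (dwt_high M0 M b0 b v l j \<bullet>\<^sub>k kcascade (sy.high l) sy.low (j - 1)) x))"
proof (induction J)
  case (Suc J)
  have fin: "fin_cols (kcascade kid sy.low J)" by (simp add: fin_cols_kcascade)
  have "dwt_low M0 b0 v J \<bullet>\<^sub>k kcascade kid sy.low J =
      (\<lambda>x. (dwt_low M0 b0 v (Suc J) \<bullet>\<^sub>k (sy.low \<odot> kcascade kid sy.low J)) x +
        (\<Sum>l\<in>UNIV. (dwt_high M0 M b0 b v l (Suc J) \<bullet>\<^sub>k (sy.high l \<odot> kcascade kid sy.low J)) x))"
    by (subst dwt_low_decompose[OF assms]) (rule kapp_synthesis[OF fin])
  also have "\<dots> = (\<lambda>x. (dwt_low M0 b0 v (Suc J) \<bullet>\<^sub>k kcascade kid sy.low (Suc J)) x +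
        (\<Sum>l\<in>UNIV. (dwt_high M0 M b0 b v l (Suc J) \<bullet>\<^sub>k kcascade (sy.high l) sy.low J) x))"
    by (simp add: kcomp_kcascade kcascade_Suc_left del: kcascade.simps(2) dwt_low.simps)
  finally show ?case
    by (subst Suc.IH) (simp add: add_ac del: kcascade.simps(2) dwt_low.simps)
qed simp

lemma das_expansion_if_perfect_reconstruction:
  assumes perfect_reconstruction "J \<ge> 1" "v \<in> l2_seq"
  shows "das_expansion M0 M b0 b bt0 bt J v"
proof -
  have "l2_has_sum (\<lambda>k n. inner_seq v (das_low M0 b0 J k) ** das_low M0 bt0 J k n)
      (dwt_low M0 b0 v J \<bullet>\<^sub>k das_low M0 bt0 J)"
    unfolding an.inner_seq_das_low[OF assms(2)]
    using assms(2,3) by (intro l2_has_sum_kapp)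
      (simp_all add: sy.das_low_eq an.dwt_low_l2_seq l2_bounded_kcascade fin_cols_kcascade)
  moreover have "l2_has_sum (\<lambda>k n. inner_seq v (das_high M0 M b0 b (l, j, k)) ** das_high M0 M bt0 bt (l, j, k) n)
      (dwt_high M0 M b0 b v l j \<bullet>\<^sub>k kcascade (sy.high l) sy.low (j - 1))" if "j \<in> {1..J}" for l j
  proof -
    have "j \<ge> 1" using that by simp
    show ?thesis
      unfolding an.inner_seq_das_high[OF \<open>j \<ge> 1\<close>] sy.das_high_eq[OF \<open>j \<ge> 1\<close>]
      by (intro l2_has_sum_kapp)
        (simp_all add: assms(3) an.dwt_high_l2_seq l2_bounded_kcascade fin_cols_kcascade)
  qed
  moreover have "das_low M0 bt0 J = kcascade kid sy.low J"
    using assms(2) by (cases J) (simp_all add: sy.das_low_eq kcascade_Suc_left del: kcascade.simps)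
  ultimately show ?thesis
    unfolding das_expansion_def
    using fun_cong[OF multilevel_reconstruction[OF assms(1), of v J]]
    by (intro exI[of _ "dwt_low M0 b0 v J \<bullet>\<^sub>k das_low M0 bt0 J"]
      exI[of _ "\<lambda>l j. dwt_high M0 M b0 b v l j \<bullet>\<^sub>k kcascade (sy.high l) sy.low (j - 1)"]) auto
qed

text \<open>For finitely supported \<open>v\<close> the l2 sums are identified pointwise with kernel
  products, and such \<open>v\<close> suffice to identify the kernel.\<close>

lemma perfect_reconstruction_if_expansion:
  assumes "\<And>v. v \<in> l2_seq \<Longrightarrow> das_expansion M0 M b0 b bt0 bt 1 v"
  shows perfect_reconstruction
  unfolding perfect_reconstruction_def
proof (rule kernel_eqI)
  fix v :: "('d, 1, 'r) mseq" assume "finitely_supported v"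
  then have "das_expansion M0 M b0 b bt0 bt 1 v"
    by (intro assms finitely_supported_l2_seq)
  then obtain g0 g where
    g0: "l2_has_sum (\<lambda>k n. inner_seq v (das_low M0 b0 1 k) ** das_low M0 bt0 1 k n) g0" and
    g': "\<forall>l. \<forall>j\<in>{1..1}. l2_has_sum (\<lambda>k n. inner_seq v (das_high M0 M b0 b (l, j, k)) ** das_high M0 M bt0 bt (l, j, k) n) (g l j)" and
    v': "\<forall>n. v n = g0 n + (\<Sum>j=1..1. \<Sum>l\<in>UNIV. g l j n)"
    unfolding das_expansion_def by (elim exE conjE) (rule that)
  have g: "l2_has_sum (\<lambda>k n. inner_seq v (das_high M0 M b0 b (l, 1, k)) ** das_high M0 M bt0 bt (l, 1, k) n) (g l 1)" for l
    using g' by simp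
  have v: "v n = g0 n + (\<Sum>l\<in>UNIV. g l 1 n)" for n
    using v' by simp
  have "g0 n = (v \<bullet>\<^sub>k kadj an.low \<bullet>\<^sub>k sy.low) n" for n
    using g0 by (intro l2_has_sum_kapp_unique) (simp add: an.das_low_eq sy.das_low_eq inner_seq_eq)
  moreover have "g l 1 n = (v \<bullet>\<^sub>k kadj (an.high l) \<bullet>\<^sub>k sy.high l) n" for l n
    using g by (intro l2_has_sum_kapp_unique) (simp add: an.das_high_eq sy.das_high_eq inner_seq_eq)
  ultimately have "v = (\<lambda>n. (v \<bullet>\<^sub>k kadj an.low \<bullet>\<^sub>k sy.low) n + (\<Sum>l\<in>UNIV. (v \<bullet>\<^sub>k kadj (an.high l) \<bullet>\<^sub>k sy.high l) n))"
    using v by auto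
  then show "v \<bullet>\<^sub>k (\<lambda>m n. (kadj an.low \<odot> sy.low) m n + (\<Sum>l\<in>UNIV. (kadj (an.high l) \<odot> sy.high l) m n)) = v \<bullet>\<^sub>k kid"
    unfolding synthesis_analysis by simp
qed

text \<open>The mutual inner products of two families are the entries of one kernel product, so
  biorthogonality becomes cancellation of factors.\<close>

lemma inner_seq_das:
  assumes "j \<ge> 1" "j' \<ge> 1"
  shows "inner_seq (das_low M0 bt0 j' k') (das_low M0 b0 j k) =
      (kcascade sy.low sy.low (j' - 1) \<odot> kadj (kcascade an.low an.low (j - 1))) k' k"
    and "inner_seq (das_low M0 bt0 j' k') (das_high M0 M b0 b (l, j, k)) =
      (kcascade sy.low sy.low (j' - 1) \<odot> kadj (kcascade (an.high l) an.low (j - 1))) k' k"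
    and "inner_seq (das_high M0 M bt0 bt (l', j', k')) (das_low M0 b0 j k) =
      (kcascade (sy.high l') sy.low (j' - 1) \<odot> kadj (kcascade an.low an.low (j - 1))) k' k"
    and "inner_seq (das_high M0 M bt0 bt (l', j', k')) (das_high M0 M b0 b (l, j, k)) =
      (kcascade (sy.high l') sy.low (j' - 1) \<odot> kadj (kcascade (an.high l) an.low (j - 1))) k' k"
  using assms
  by (simp_all add: an.das_low_eq an.das_high_eq sy.das_low_eq sy.das_high_eq inner_seq_eq kcomp_def)

lemma biorthogonal_if_das:
  assumes das: "biorthogonal_das M0 M b0 b bt0 bt 1"
  shows biorthogonal
proof -
  have idx: "(l, 1, k) \<in> das_index 1" for l :: 's and k :: "int^'d" by (simp add: das_index_def)
  note das = das[unfolded biorthogonal_das_def biorthogonal_systems_def]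
  have "inner_seq (das_low M0 bt0 1 k') (das_low M0 b0 1 k) = mat (of_bool (k = k'))" for k k'
    using das by blast
  moreover have "inner_seq (das_low M0 bt0 1 k') (das_high M0 M b0 b (l, 1, k)) = 0" for k k' l
    using das idx by blast
  moreover have "inner_seq (das_high M0 M bt0 bt (l', 1, k')) (das_low M0 b0 1 k) = 0" for k k' l'
    using das idx by blast
  moreover have "inner_seq (das_high M0 M bt0 bt (l', 1, k')) (das_high M0 M b0 b (l, 1, k)) =
      mat (of_bool ((l, 1::nat, k) = (l', 1, k')))" for k k' l l'
    using das idx by blast
  ultimately show ?thesis
    unfolding biorthogonal_def fun_eq_iff by (auto simp: inner_seq_das kid_def)
qed

text \<open>After cancellation of matching low-pass factors, either equal kinds of kernels meet and
  level-one biorthogonality applies, or a low-pass factor is left next to a high-pass one and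
  annihilates the product.\<close>

lemma inner_seq_das_eq:
  assumes bi: biorthogonal and J: "j \<ge> 1" "j' \<ge> 1" "j \<le> J" "j' \<le> J"
  shows "inner_seq (das_low M0 bt0 J k') (das_low M0 b0 J k) = mat (of_bool (k = k'))"
    and "inner_seq (das_low M0 bt0 J k') (das_high M0 M b0 b (l, j, k)) = 0"
    and "inner_seq (das_high M0 M bt0 bt (l', j', k')) (das_low M0 b0 J k) = 0"
    and "inner_seq (das_high M0 M bt0 bt (l', j', k')) (das_high M0 M b0 b (l, j, k)) =
      mat (of_bool (l = l' \<and> j = j' \<and> k = k'))"
proof -
  have J1: "J \<ge> 1" using J by simp
  note bi = bi[unfolded biorthogonal_def]
  have zero_right: "A \<odot> kadj (X \<odot> an.low) = (\<lambda>_ _. 0)" if "A \<odot> kadj an.low = (\<lambda>_ _. 0)" "fin_cols (kadj X)"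
    for A :: "('x, int^'d, 'p::finite, 'r) kernel" and X :: "('y, int^'d, 'q::finite, 'r) kernel"
    using that by (simp add: kadj_kcomp kcomp_assoc[symmetric])
  have zero_left: "(X \<odot> sy.low) \<odot> kadj A = (\<lambda>_ _. 0)" if "sy.low \<odot> kadj A = (\<lambda>_ _. 0)" "fin_cols (kadj A)"
    for A :: "('x, int^'d, 'p::finite, 'r) kernel" and X :: "('y, int^'d, 'q::finite, 'r) kernel"
    using that by (simp add: kcomp_assoc)
  have reduce: "kcascade A sy.low (m + n) \<odot> kadj (kcascade B an.low n) = kcascade A sy.low m \<odot> kadj B"
    "kcascade A sy.low n \<odot> kadj (kcascade B an.low (m + n)) = A \<odot> kadj (kcascade B an.low m)"
    if "fin_cols (kadj B)" for m n
      and A :: "('x, int^'d, 'p::finite, 'r) kernel" and B :: "('y, int^'d, 'q::finite, 'r) kernel"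
    using bi that by - (rule kcascade_reduce(1), simp_all, rule kcascade_reduce(2), simp_all)
  show "inner_seq (das_low M0 bt0 J k') (das_low M0 b0 J k) = mat (of_bool (k = k'))"
    using reduce(1)[of an.low sy.low 0 "J - 1"] bi J1 by (auto simp: inner_seq_das kid_def)
  show "inner_seq (das_low M0 bt0 J k') (das_high M0 M b0 b (l, j, k)) = 0"
  proof -
    have "kcascade sy.low sy.low (J - 1) \<odot> kadj (kcascade (an.high l) an.low (j - 1)) =
        kcascade sy.low sy.low (J - j) \<odot> kadj (an.high l)"
    proof -
      \<comment> \<open>Besides the \<open>J - j\<close> surplus factors, the low-pass element has
        its initial \<open>sy.low\<close>; so even for \<open>j = J\<close> a low-pass kernel meets
        the high-pass one.\<close>
      have "J - 1 = (J - j) + (j - 1)" using J by simp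
      then show ?thesis by (simp only: reduce an.fin_cols_low_high)
    qed
    also have "\<dots> = (\<lambda>_ _. 0)"
      using bi by (cases "J - j") (simp_all add: zero_left)
    finally show ?thesis using J J1 by (simp add: inner_seq_das)
  qed
  show "inner_seq (das_high M0 M bt0 bt (l', j', k')) (das_low M0 b0 J k) = 0"
  proof -
    have "kcascade (sy.high l') sy.low (j' - 1) \<odot> kadj (kcascade an.low an.low (J - 1)) =
        sy.high l' \<odot> kadj (kcascade an.low an.low (J - j'))"
    proof -
      have "J - 1 = (J - j') + (j' - 1)" using J by simp
      then show ?thesis by (simp only: reduce an.fin_cols_low_high)
    qed
    also have "\<dots> = (\<lambda>_ _. 0)"
      using bi by (cases "J - j'") (simp_all add: zero_right fin_cols_kadj_kcascade)
    finally show ?thesis using J J1 by (simp add: inner_seq_das)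
  qed
  show "inner_seq (das_high M0 M bt0 bt (l', j', k')) (das_high M0 M b0 b (l, j, k)) =
      mat (of_bool (l = l' \<and> j = j' \<and> k = k'))"
  proof (cases j j' rule: linorder_cases)
    case equal
    have "kcascade (sy.high l') sy.low (j - 1) \<odot> kadj (kcascade (an.high l) an.low (j - 1)) =
        sy.high l' \<odot> kadj (an.high l)"
      using reduce(1)[of "an.high l" "sy.high l'" 0 "j - 1"] by simp
    then show ?thesis using bi J equal by (auto simp: inner_seq_das kid_def)
  next
    case less
    have "kcascade (sy.high l') sy.low (j' - 1) \<odot> kadj (kcascade (an.high l) an.low (j - 1)) =
        kcascade (sy.high l') sy.low (Suc (j' - j - 1)) \<odot> kadj (an.high l)"
    proof -
      \<comment> \<open>The \<open>Suc\<close> exhibits the surplus low-pass factor, present because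
        the levels differ strictly.\<close>
      have "j' - 1 = Suc (j' - j - 1) + (j - 1)" using J less by simp
      then show ?thesis by (simp only: reduce an.fin_cols_low_high)
    qed
    also have "\<dots> = (\<lambda>_ _. 0)" using bi by (simp add: zero_left)
    finally show ?thesis using J less by (simp add: inner_seq_das)
  next
    case greater
    have "kcascade (sy.high l') sy.low (j' - 1) \<odot> kadj (kcascade (an.high l) an.low (j - 1)) =
        sy.high l' \<odot> kadj (kcascade (an.high l) an.low (Suc (j - j' - 1)))"
    proof -
      have "j - 1 = Suc (j - j' - 1) + (j' - 1)" using J greater by simp
      then show ?thesis by (simp only: reduce an.fin_cols_low_high)
    qed
    also have "\<dots> = (\<lambda>_ _. 0)" using bi by (simp add: zero_right fin_cols_kadj_kcascade)
    finally show ?thesis using J greater by (simp add: inner_seq_das)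
  qed
qed

lemma biorthogonal_das_if_biorthogonal:
  assumes biorthogonal "J \<ge> 1"
  shows "biorthogonal_das M0 M b0 b bt0 bt J"
  unfolding biorthogonal_das_def biorthogonal_systems_def das_index_def
  using assms by (auto simp: an.das_l2_seq sy.das_l2_seq inner_seq_das_eq)

lemma biorthogonality_relations_if_biorthogonal:
  assumes biorthogonal "J \<ge> 1"
  shows "biorthogonality_relations M0 M b0 b bt0 bt J"
  unfolding biorthogonality_relations_def
  using assms by (auto simp: inner_seq_das_eq of_bool_conj)

end

text \<open>Stability gives independent constants for the two banks, whereas the frame bounds of the
  dual system must be the reciprocals of those of the primal one. Lowering the lower and raising the
  upper constants achieves this.\<close>

lemma l2_stable_common_bounds:
  fixes M0 :: "int^'d::finite^'d" and b0 bt0 :: "('d, 'r::finite, 'r) mseq"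
  assumes "l2_stable M0 M b0 b" "l2_stable M0 M bt0 bt"
  shows "\<exists>C1>0. \<exists>C2>0. \<forall>J\<ge>1. \<forall>v\<in>l2_seq.
    ennreal C1 * l2_norm_sq v \<le> dwt_norm_sq M0 M b0 b J v \<and>
    dwt_norm_sq M0 M b0 b J v \<le> ennreal C2 * l2_norm_sq v \<and>
    ennreal (inverse C2) * l2_norm_sq v \<le> dwt_norm_sq M0 M bt0 bt J v \<and>
    dwt_norm_sq M0 M bt0 bt J v \<le> ennreal (inverse C1) * l2_norm_sq v"
proof -
  obtain c1 c2 where c: "c1 > 0" "c2 > 0"
    and an: "\<And>J v. J \<ge> 1 \<Longrightarrow> v \<in> l2_seq \<Longrightarrow> ennreal c1 * l2_norm_sq v \<le> dwt_norm_sq M0 M b0 b J v \<and>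
      dwt_norm_sq M0 M b0 b J v \<le> ennreal c2 * l2_norm_sq v"
    using assms(1) unfolding l2_stable_def by blast
  obtain d1 d2 where d: "d1 > 0" "d2 > 0"
    and sy: "\<And>J v. J \<ge> 1 \<Longrightarrow> v \<in> l2_seq \<Longrightarrow> ennreal d1 * l2_norm_sq v \<le> dwt_norm_sq M0 M bt0 bt J v \<and>
      dwt_norm_sq M0 M bt0 bt J v \<le> ennreal d2 * l2_norm_sq v"
    using assms(2) unfolding l2_stable_def by blast
  \<comment> \<open>\<open>C1\<close> must be at most \<open>c1\<close>, with reciprocal at least
    \<open>d2\<close>; \<open>C2\<close> must be at least \<open>c2\<close>, with reciprocal at most
    \<open>d1\<close>.\<close>
  define C1 C2 where "C1 = min c1 (inverse d2)" and "C2 = max c2 (inverse d1)"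
  have C: "C1 > 0" "C2 > 0" "C1 \<le> c1" "c2 \<le> C2"
    using c d by (auto simp: C1_def C2_def)
  have "inverse C2 \<le> inverse (inverse d1)"
    using d by (intro le_imp_inverse_le) (auto simp: C2_def)
  moreover have "inverse (inverse d2) \<le> inverse C1"
    using C(1) by (intro le_imp_inverse_le) (auto simp: C1_def)
  ultimately have C': "inverse C2 \<le> d1" "d2 \<le> inverse C1" by simp_all
  have mono: "ennreal x * N \<le> ennreal y * N" if "x \<le> y" for x y :: real and N
    using that by (intro mult_right_mono ennreal_leI) auto
  have "\<forall>J\<ge>1. \<forall>v\<in>l2_seq.
    ennreal C1 * l2_norm_sq v \<le> dwt_norm_sq M0 M b0 b J v \<and>
    dwt_norm_sq M0 M b0 b J v \<le> ennreal C2 * l2_norm_sq v \<and>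
    ennreal (inverse C2) * l2_norm_sq v \<le> dwt_norm_sq M0 M bt0 bt J v \<and>
    dwt_norm_sq M0 M bt0 bt J v \<le> ennreal (inverse C1) * l2_norm_sq v"
  proof (intro conjI allI impI ballI)
    fix J :: nat and v :: "('d, 1, 'r) mseq" assume J: "1 \<le> J" and v: "v \<in> l2_seq"
    show "ennreal C1 * l2_norm_sq v \<le> dwt_norm_sq M0 M b0 b J v"
      using an[OF J v] mono[OF C(3)] by (meson order_trans)
    show "dwt_norm_sq M0 M b0 b J v \<le> ennreal C2 * l2_norm_sq v"
      using an[OF J v] mono[OF C(4)] by (meson order_trans)
    show "ennreal (inverse C2) * l2_norm_sq v \<le> dwt_norm_sq M0 M bt0 bt J v"
      using sy[OF J v] mono[OF C'(1)] by (meson order_trans)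
    show "dwt_norm_sq M0 M bt0 bt J v \<le> ennreal (inverse C1) * l2_norm_sq v"
      using sy[OF J v] mono[OF C'(2)] by (meson order_trans)
  qed
  with C(1,2) show ?thesis by - (rule exI[of _ C1], rule conjI, assumption, rule exI[of _ C2], rule conjI)
qed

theorem theorem4p6:
  fixes M0 :: "int^'d^'d::finite"
    and M :: "'s::finite \<Rightarrow> int^'d^'d"
    and b0 bt0 :: "int^'d \<Rightarrow> complex^'r^'r::finite"
    and b bt :: "'s \<Rightarrow> int^'d \<Rightarrow> complex^'r^1"
  assumes "dilation_matrix M0" and "\<And>l. dilation_matrix (M l)"
    and "finitely_supported b0" and "\<And>l. finitely_supported (b l)"
    and "finitely_supported bt0" and "\<And>l. finitely_supported (bt l)"
  shows "let
      cond_i = biorthogonal_wavelet_filter_bank M0 M b0 b bt0 bt;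
      cond_ii = (\<forall>J\<ge>1.
        (\<forall>v\<in>l2_seq. das_expansion M0 M b0 b bt0 bt J v) \<and>
        biorthogonal_das M0 M b0 b bt0 bt J \<and>
        biorthogonality_relations M0 M b0 b bt0 bt J);
      cond_iii =
        ((\<forall>J\<ge>1. \<forall>v\<in>l2_seq. das_expansion M0 M b0 b bt0 bt J v) \<and>
         (\<exists>C1>0. \<exists>C2>0. \<forall>J\<ge>1. \<forall>v\<in>l2_seq.
           ennreal C1 * l2_norm_sq v \<le> das_coeff_norm_sq M0 M b0 b J v \<and>
           das_coeff_norm_sq M0 M b0 b J v \<le> ennreal C2 * l2_norm_sq v \<and>
           ennreal (inverse C2) * l2_norm_sq v \<le> das_coeff_norm_sq M0 M bt0 bt J v \<and>
           das_coeff_norm_sq M0 M bt0 bt J v \<le> ennreal (inverse C1) * l2_norm_sq v) \<and>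
         (\<forall>J\<ge>1. biorthogonal_das M0 M b0 b bt0 bt J \<and>
           biorthogonality_relations M0 M b0 b bt0 bt J))
    in
      (cond_i \<longleftrightarrow> cond_ii) \<and>
      (l2_stable M0 M b0 b \<and> l2_stable M0 M bt0 bt \<longrightarrow>
         (cond_i \<longleftrightarrow> cond_iii) \<and> (cond_ii \<longleftrightarrow> cond_iii))"
proof -
  interpret filter_bank_pair M0 M b0 bt0 b bt
    using assms by unfold_locales (auto simp: dilation_matrix_det_nonzero)
  let ?ii = "\<forall>J\<ge>1. (\<forall>v\<in>l2_seq. das_expansion M0 M b0 b bt0 bt J v) \<and>
        biorthogonal_das M0 M b0 b bt0 bt J \<and> biorthogonality_relations M0 M b0 b bt0 bt J"
  have "biorthogonal_wavelet_filter_bank M0 M b0 b bt0 bt \<longleftrightarrow> ?ii"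
  proof
    assume "biorthogonal_wavelet_filter_bank M0 M b0 b bt0 bt"
    then show ?ii
      by (auto simp: biorthogonal_wavelet_iff das_expansion_if_perfect_reconstruction
          biorthogonal_das_if_biorthogonal biorthogonality_relations_if_biorthogonal)
  next
    \<comment> \<open>The instance \<open>J = 1\<close> yields both kernel identities.\<close>
    assume ?ii
    then show "biorthogonal_wavelet_filter_bank M0 M b0 b bt0 bt"
      unfolding biorthogonal_wavelet_iff
      using perfect_reconstruction_if_expansion biorthogonal_if_das by blast
  qed
  moreover have "\<exists>C1>0. \<exists>C2>0. \<forall>J\<ge>1. \<forall>v\<in>l2_seq.
      ennreal C1 * l2_norm_sq v \<le> das_coeff_norm_sq M0 M b0 b J v \<and>
      das_coeff_norm_sq M0 M b0 b J v \<le> ennreal C2 * l2_norm_sq v \<and>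
      ennreal (inverse C2) * l2_norm_sq v \<le> das_coeff_norm_sq M0 M bt0 bt J v \<and>
      das_coeff_norm_sq M0 M bt0 bt J v \<le> ennreal (inverse C1) * l2_norm_sq v"
    if "l2_stable M0 M b0 b" "l2_stable M0 M bt0 bt"
    using l2_stable_common_bounds[OF that]
    by (simp add: an.das_coeff_norm_sq_eq sy.das_coeff_norm_sq_eq)
  ultimately show ?thesis
    unfolding Let_def by (intro conjI impI iffI) (simp_all only:, blast+)
qed

end
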